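(* Let $M,C,K$ be selfadjoint positive definite operators in a Hilbert space $\mathcal X$, with $M$ and $C$ bounded, and let $\mathcal A$, $\gamma$, $K(\mu)$, $\mathcal L(\mu)$, $\widehat{\mathcal A}$ and $\omega_0(\mathcal A)$ be as defined in the context. Assume that $\mu$ is a real number with $\gamma<\mu\le 0$. Then: (i) The operator $\mathcal L(\mu)$ together with its inverse is bounded and everywhere defined on $\mathcal X\oplus\mathcal X$. (ii) Both operators $\mathcal L(\mu)$ and $\mathcal L(\mu)^{-1}$ leave the subspace $\mathcal D(\mathcal A)$ invariant, and $$\mathcal L(\mu)\,\widehat{\mathcal A}=(\mathcal A-\mu I)\,\mathcal L(\mu).$$ (iii) For all $t\ge 0$, $$\|e^{\mathcal A t}\|\le \|\mathcal L(\mu)\|\,\|\mathcal L(\mu)^{-1}\|\,e^{\mu t}.$$ (iv) The type of the semigroup is bounded by $$\omega_0(\mathcal A)\le\gamma .$$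
   Context: $\mathcal X$ is a (nonzero) complex Hilbert space with scalar product $x^*y$, linear in the second and antilinear in the first variable. The operators $M,C,K$ are selfadjoint in $\mathcal X$ and positive definite, where a selfadjoint operator $T$ is called positive definite if $T\ge cI$ for some constant $c>0$. $M$ and $C$ are bounded; $K$ may be unbounded. $\mathcal D(\cdot)$ denotes the domain of an operator. The phase space operator of the second order system $M\ddot x+C\dot x+Kx=0$ is the operator in $\mathcal X\oplus\mathcal X$ $$\mathcal A=\begin{bmatrix}0&K^{1/2}M^{-1/2}\\-M^{-1/2}K^{1/2}&-M^{-1/2}CM^{-1/2}\end{bmatrix},\qquad \mathcal D(\mathcal A)=\mathcal D(K^{1/2})\oplus M^{1/2}\mathcal D(K^{1/2}).$$ It is maximal dissipative and generates a contractive strongly continuous semigroup $e^{\mathcal A t}$, $t\ge0$. Its type $\omega_0(\mathcal A)$ is the infimum of all real $\beta$ for which there is a constant $C_\beta$ with $\|e^{\mathcal A t}\|\le C_\beta e^{\beta t}$ for all $t\ge 0$. Define $$\gamma=\sup_{x\in\mathcal D(K^{1/2}),\,x\ne0}\Re\,\frac{-x^*Cx+\sqrt{(x^*Cx)^2-4\,(x^*Mx)\,\|K^{1/2}x\|^2}}{2x^*Mx},$$ where the square root of a negative number is taken with positive imaginary part. For real $\mu$, $K(\mu)=\mu^2M+\mu C+K$ (selfadjoint, with domain $\mathcal D(K)$) and $C(\mu)=2\mu M+C$. For $\mu>\gamma$ both $K(\mu)$ and $C(\mu)$ are positive definite and one sets $$\mathcal L(\mu)=\begin{bmatrix}K^{1/2}K(\mu)^{-1/2}&0\\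 \mu M^{1/2}K(\mu)^{-1/2}&I\end{bmatrix},\qquad \widehat{\mathcal A}=\begin{bmatrix}0&K(\mu)^{1/2}M^{-1/2}\\-M^{-1/2}K(\mu)^{1/2}&-M^{-1/2}C(\mu)M^{-1/2}\end{bmatrix},$$ with $\mathcal D(\widehat{\mathcal A})=\mathcal D(K(\mu)^{1/2})\oplus M^{1/2}\mathcal D(K(\mu)^{1/2})$. *)

theory Defs
  imports "HOL-Analysis.Analysis"
begin

section \<open>Complex Hilbert spaces\<close>

text \<open>The scalar product is antilinear in the first and linear in the second variable; its real
  part is the inherited real inner product, so that norm, topology and completeness are the
  library ones.\<close>

class complex_hilbert = real_inner + complete_space +
  fixes scaleC :: "complex \<Rightarrow> 'a \<Rightarrow> 'a" (infixr "*\<^sub>C" 75)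
    and cinner :: "'a \<Rightarrow> 'a \<Rightarrow> complex"
  assumes scaleC_add_right: "a *\<^sub>C (x + y) = a *\<^sub>C x + a *\<^sub>C y"
    and scaleC_add_left: "(a + b) *\<^sub>C x = a *\<^sub>C x + b *\<^sub>C x"
    and scaleC_scaleC: "a *\<^sub>C (b *\<^sub>C x) = (a * b) *\<^sub>C x"
    and scaleR_scaleC: "r *\<^sub>R x = complex_of_real r *\<^sub>C x"
    and cinner_commute: "cinner x y = cnj (cinner y x)"
    and cinner_add_right: "cinner x (y + z) = cinner x y + cinner x z"
    and cinner_scaleC_right: "cinner x (a *\<^sub>C y) = a * cinner x y"
    and inner_eq_Re_cinner: "inner x y = Re (cinner x y)"
begin

subclass banach ..

end

instantiation prod :: (complex_hilbert, complex_hilbert) complex_hilbert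
begin

definition "a *\<^sub>C z = (a *\<^sub>C fst z, a *\<^sub>C snd z)"

definition "cinner z w = cinner (fst z) (fst w) + cinner (snd z) (snd w)"

instance
proof
  fix x y :: "'a \<times> 'b"
  show "cinner x y = cnj (cinner y x)"
    unfolding cinner_prod_def complex_cnj_add
    by (subst (1 2) cinner_commute) simp
qed (auto simp: scaleC_prod_def cinner_prod_def scaleC_add_right scaleC_add_left scaleC_scaleC
      scaleR_prod_def scaleR_scaleC cinner_add_right cinner_scaleC_right inner_prod_def
      inner_eq_Re_cinner algebra_simps)

end


section \<open>Operators\<close>

text \<open>A possibly unbounded operator is a partial function, its domain being \<^const>\<open>dom\<close>.
  Hence equality of operators includes equality of their domains, and \<^const>\<open>map_comp\<close> is the
  product of operators with its natural domain.\<close>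

definition linear_op :: "('a::complex_hilbert \<rightharpoonup> 'b::complex_hilbert) \<Rightarrow> bool" where
  "linear_op T \<longleftrightarrow> 0 \<in> dom T \<and>
     (\<forall>x\<in>dom T. \<forall>y\<in>dom T. x + y \<in> dom T \<and> the (T (x + y)) = the (T x) + the (T y)) \<and>
     (\<forall>a. \<forall>x\<in>dom T. a *\<^sub>C x \<in> dom T \<and> the (T (a *\<^sub>C x)) = a *\<^sub>C the (T x))"

definition bounded_op :: "('a::complex_hilbert \<rightharpoonup> 'b::complex_hilbert) \<Rightarrow> bool" where
  "bounded_op T \<longleftrightarrow> linear_op T \<and> (\<exists>B. \<forall>x\<in>dom T. norm (the (T x)) \<le> B * norm x)"

definition op_zero :: "'a::complex_hilbert \<rightharpoonup> 'b::complex_hilbert" where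
  "op_zero = (\<lambda>x. Some 0)"

definition op_id :: "'a::complex_hilbert \<rightharpoonup> 'a" where
  "op_id = (\<lambda>x. Some x)"

definition op_add :: "('a::complex_hilbert \<rightharpoonup> 'b::complex_hilbert) \<Rightarrow> ('a \<rightharpoonup> 'b) \<Rightarrow> 'a \<rightharpoonup> 'b"
    (infixl "\<oplus>" 65) where
  "S \<oplus> T = (\<lambda>x. if x \<in> dom S \<inter> dom T then Some (the (S x) + the (T x)) else None)"

definition op_scale :: "complex \<Rightarrow> ('a::complex_hilbert \<rightharpoonup> 'b::complex_hilbert) \<Rightarrow> 'a \<rightharpoonup> 'b"
    (infixr "\<odot>" 75) where
  "a \<odot> T = (\<lambda>x. map_option (\<lambda>y. a *\<^sub>C y) (T x))"

definition pfun_of :: "('a \<Rightarrow> 'b \<Rightarrow> bool) \<Rightarrow> 'a \<rightharpoonup> 'b" where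
  "pfun_of R = (\<lambda>x. if \<exists>!y. R x y then Some (THE y. R x y) else None)"

text \<open>For a non-injective operator this is defined only at the values attained exactly once;
  in particular, if the inverse is everywhere defined, then the operator is bijective from its
  domain.\<close>

definition op_inv :: "('a::complex_hilbert \<rightharpoonup> 'b::complex_hilbert) \<Rightarrow> 'b \<rightharpoonup> 'a" where
  "op_inv T = pfun_of (\<lambda>y x. T x = Some y)"

definition adjoint_op :: "('a::complex_hilbert \<rightharpoonup> 'b::complex_hilbert) \<Rightarrow> 'b \<rightharpoonup> 'a" where
  "adjoint_op T = pfun_of (\<lambda>y z. \<forall>x\<in>dom T. cinner y (the (T x)) = cinner z x)"

definition selfadjoint :: "('a::complex_hilbert \<rightharpoonup> 'a) \<Rightarrow> bool" where
  "selfadjoint T \<longleftrightarrow> linear_op T \<and> closure (dom T) = UNIV \<and> adjoint_op T = T"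

text \<open>For selfadjoint \<open>T\<close> the number \<open>cinner x (T x)\<close> is real, so taking the real part in the
  next two definitions loses nothing.\<close>

definition nonneg_op :: "('a::complex_hilbert \<rightharpoonup> 'a) \<Rightarrow> bool" where
  "nonneg_op T \<longleftrightarrow> selfadjoint T \<and> (\<forall>x\<in>dom T. 0 \<le> Re (cinner x (the (T x))))"

definition posdef_op :: "('a::complex_hilbert \<rightharpoonup> 'a) \<Rightarrow> bool" where
  "posdef_op T \<longleftrightarrow> selfadjoint T \<and>
     (\<exists>c>0. \<forall>x\<in>dom T. c * (norm x)\<^sup>2 \<le> Re (cinner x (the (T x))))"

text \<open>A nonnegative selfadjoint operator has exactly one nonnegative selfadjoint square root, so
  the choice is not arbitrary.\<close>

definition op_sqrt :: "('a::complex_hilbert \<rightharpoonup> 'a) \<Rightarrow> 'a \<rightharpoonup> 'a" where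
  "op_sqrt T = (SOME S. nonneg_op S \<and> S \<circ>\<^sub>m S = T)"

definition leaves_invariant :: "('a::complex_hilbert \<rightharpoonup> 'a) \<Rightarrow> 'a set \<Rightarrow> bool" where
  "leaves_invariant T V \<longleftrightarrow> V \<subseteq> dom T \<and> (\<forall>x\<in>V. the (T x) \<in> V)"

definition op_norm :: "('a::complex_hilbert \<rightharpoonup> 'b::complex_hilbert) \<Rightarrow> real" where
  "op_norm T = onorm (\<lambda>x. the (T x))"

definition block_op ::
  "('a::complex_hilbert \<rightharpoonup> 'c::complex_hilbert) \<Rightarrow> ('b::complex_hilbert \<rightharpoonup> 'c) \<Rightarrow>
   ('a \<rightharpoonup> 'd::complex_hilbert) \<Rightarrow> ('b \<rightharpoonup> 'd) \<Rightarrow> 'a \<times> 'b \<rightharpoonup> 'c \<times> 'd" where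
  "block_op T11 T12 T21 T22 = (\<lambda>(x, y).
     if x \<in> dom T11 \<inter> dom T21 \<and> y \<in> dom T12 \<inter> dom T22
     then Some (the (T11 x) + the (T12 y), the (T21 x) + the (T22 y)) else None)"


section \<open>Strongly continuous semigroups\<close>

text \<open>Only the parameters \<open>t \<ge> 0\<close> matter.\<close>

definition C0_semigroup :: "(real \<Rightarrow> 'a::complex_hilbert \<Rightarrow> 'a) \<Rightarrow> bool" where
  "C0_semigroup T \<longleftrightarrow>
     (\<forall>t\<ge>0. bounded_linear (T t) \<and> (\<forall>a x. T t (a *\<^sub>C x) = a *\<^sub>C T t x)) \<and>
     (\<forall>x. T 0 x = x) \<and>
     (\<forall>s\<ge>0. \<forall>t\<ge>0. \<forall>x. T (s + t) x = T s (T t x)) \<and>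
     (\<forall>x. continuous_on {0..} (\<lambda>t. T t x))"

definition generator :: "(real \<Rightarrow> 'a::complex_hilbert \<Rightarrow> 'a) \<Rightarrow> 'a \<rightharpoonup> 'a" where
  "generator T = pfun_of (\<lambda>x y. ((\<lambda>h. (T h x - x) /\<^sub>R h) \<longlongrightarrow> y) (at_right 0))"

text \<open>A generator determines its semigroup, so for generators \<open>A\<close> and \<open>t \<ge> 0\<close> the operator
  \<open>op_exp A t\<close> does not depend on the choice.\<close>

definition op_exp :: "('a::complex_hilbert \<rightharpoonup> 'a) \<Rightarrow> real \<Rightarrow> 'a \<Rightarrow> 'a" where
  "op_exp A = (SOME T. C0_semigroup T \<and> generator T = A)"

text \<open>The type is extended real, since it is \<open>-\<infinity>\<close> when every real \<open>\<beta>\<close> is admissible.\<close>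

definition semigroup_type :: "('a::complex_hilbert \<rightharpoonup> 'a) \<Rightarrow> ereal" where
  "semigroup_type A =
     Inf {ereal \<beta> |\<beta>. \<exists>c. \<forall>t\<ge>0. onorm (op_exp A t) \<le> c * exp (\<beta> * t)}"


section \<open>The damped system\<close>

text \<open>The final restriction only spells out the domain: when \<open>M\<close> is bounded and positive definite
  it is the natural domain of the block matrix.\<close>

definition phase_op ::
  "('a::complex_hilbert \<rightharpoonup> 'a) \<Rightarrow> ('a \<rightharpoonup> 'a) \<Rightarrow> ('a \<rightharpoonup> 'a) \<Rightarrow> 'a \<times> 'a \<rightharpoonup> 'a \<times> 'a" where
  "phase_op M C K =
     block_op
       op_zero
       (op_sqrt K \<circ>\<^sub>m op_inv (op_sqrt M))
       ((- 1) \<odot> (op_inv (op_sqrt M) \<circ>\<^sub>m op_sqrt K))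
       ((- 1) \<odot> (op_inv (op_sqrt M) \<circ>\<^sub>m (C \<circ>\<^sub>m op_inv (op_sqrt M))))
     |` (dom (op_sqrt K) \<times> (\<lambda>x. the (op_sqrt M x)) ` dom (op_sqrt K))"

text \<open>The real supremum below is a genuine one: for positive definite \<open>M\<close>, \<open>C\<close>, \<open>K\<close> on a nonzero
  space the set is nonempty and bounded above by \<open>0\<close>. On negative reals \<^const>\<open>csqrt\<close> has
  positive imaginary part.\<close>

definition decay_bound ::
  "('a::complex_hilbert \<rightharpoonup> 'a) \<Rightarrow> ('a \<rightharpoonup> 'a) \<Rightarrow> ('a \<rightharpoonup> 'a) \<Rightarrow> real" where
  "decay_bound M C K =
     (SUP x \<in> dom (op_sqrt K) - {0}.
        Re ((- cinner x (the (C x))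
             + csqrt ((cinner x (the (C x)))\<^sup>2
                 - 4 * cinner x (the (M x)) * complex_of_real ((norm (the (op_sqrt K x)))\<^sup>2)))
            / (2 * cinner x (the (M x)))))"

definition K_shift ::
  "('a::complex_hilbert \<rightharpoonup> 'a) \<Rightarrow> ('a \<rightharpoonup> 'a) \<Rightarrow> ('a \<rightharpoonup> 'a) \<Rightarrow> real \<Rightarrow> 'a \<rightharpoonup> 'a" where
  "K_shift M C K \<mu> =
     (complex_of_real (\<mu>\<^sup>2) \<odot> M) \<oplus> (complex_of_real \<mu> \<odot> C) \<oplus> K"

definition C_shift :: "('a::complex_hilbert \<rightharpoonup> 'a) \<Rightarrow> ('a \<rightharpoonup> 'a) \<Rightarrow> real \<Rightarrow> 'a \<rightharpoonup> 'a" where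
  "C_shift M C \<mu> = (complex_of_real (2 * \<mu>) \<odot> M) \<oplus> C"

definition L_op ::
  "('a::complex_hilbert \<rightharpoonup> 'a) \<Rightarrow> ('a \<rightharpoonup> 'a) \<Rightarrow> ('a \<rightharpoonup> 'a) \<Rightarrow> real \<Rightarrow> 'a \<times> 'a \<rightharpoonup> 'a \<times> 'a" where
  "L_op M C K \<mu> =
     block_op
       (op_sqrt K \<circ>\<^sub>m op_inv (op_sqrt (K_shift M C K \<mu>)))
       op_zero
       (complex_of_real \<mu> \<odot> (op_sqrt M \<circ>\<^sub>m op_inv (op_sqrt (K_shift M C K \<mu>))))
       op_id"

definition phase_op_shifted ::
  "('a::complex_hilbert \<rightharpoonup> 'a) \<Rightarrow> ('a \<rightharpoonup> 'a) \<Rightarrow> ('a \<rightharpoonup> 'a) \<Rightarrow> real \<Rightarrow> 'a \<times> 'a \<rightharpoonup> 'a \<times> 'a" where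
  "phase_op_shifted M C K \<mu> = phase_op M (C_shift M C \<mu>) (K_shift M C K \<mu>)"

end

theory Submission
  imports Defs
begin

text \<open>
  The shifted operator \<open>A - \<mu>\<close> is, up to a bounded change of coordinates, the phase operator of
  another damped system. Substituting \<open>x = e\<^bsup>\<mu>t\<^esup> y\<close> in the second order equation leads to a system with
  mass \<open>M\<close>, damping \<open>C(\<mu>) = 2 \<mu> M + C\<close> and stiffness \<open>K(\<mu>) = \<mu>\<^sup>2 M + \<mu> C + K\<close>, and \<open>L(\<mu>)\<close> is the
  corresponding change of phase space coordinates. For \<open>\<mu>\<close> above the decay bound this is again a system
  with positive definite stiffness and nonnegative damping: for each \<open>x\<close> the number \<open>\<mu>\<close> lies to the right
  of both roots of the quadratic polynomial \<open>(x, M x) \<lambda>\<^sup>2 + (x, C x) \<lambda> + \<parallel>K\<^bsup>1/2\<^esup> x\<parallel>\<^sup>2\<close>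
  (\<open>quadratic_above_decay_rate\<close>). Hence its phase operator is dissipative, \<open>A - \<mu>\<close> is dissipative in the
  norm \<open>\<parallel>L(\<mu>)\<^bsup>-1\<^esup> u\<parallel>\<close> (\<open>shifted_dissipative\<close>), and along orbits this norm decays like \<open>e\<^bsup>\<mu>t\<^esup>\<close>
  (\<open>semigroup_decay\<close>). Letting \<open>\<mu>\<close> decrease to the decay bound gives the bound on the type.

  Unbounded operators are treated through their bounded inverses. A positive definite
  operator has a bounded symmetric inverse (\<open>posdef_op_inverse\<close>), and so has its square root
  (\<open>posdef_op_sqrt_inverse\<close>), and conversely a bounded symmetric injective map is the inverse of a
  selfadjoint operator (\<open>selfadjoint_if_inverts\<close>). With \<open>R = K\<^bsup>-1/2\<^esup>\<close> and \<open>N = M\<^bsup>1/2\<^esup>\<close> the phase operator is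
  the inverse of the bounded map that sends \<open>(f, g)\<close> to \<open>(- R (N g + C R f), N R f)\<close>
  (\<open>phase_op_inverts\<close>), and \<open>K(\<mu>)\<close> is the inverse of \<open>R (I + R F R)\<^bsup>-1\<^esup> R\<close> with \<open>F = \<mu>\<^sup>2 M + \<mu> C\<close>
  (\<open>shifted_inverse\<close>). That the entries \<open>K\<^bsup>1/2\<^esup> K(\<mu>)\<^bsup>-1/2\<^esup>\<close> of \<open>L(\<mu>)\<close> and \<open>K(\<mu>)\<^bsup>1/2\<^esup> K\<^bsup>-1/2\<^esup>\<close> of its inverse are
  everywhere defined and bounded is a factorisation argument (\<open>douglas_factor\<close>). The intertwining
  relation then is an identity between bounded maps (\<open>intertwine\<close>) that contains the statement about
  domains.

  The exponential of an operator is defined through the existence of a semigroup with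
  that generator, so one has to be constructed. For a dissipative operator with bounded inverse the
  implicit Euler scheme with dyadic step lengths converges on the domain of the squared operator, and
  by contractivity everywhere (\<open>dissipative_generates_semigroup\<close>).
\<close>

section \<open>Bounded complex-linear maps and inverses of operators\<close>

lemma scaleC_of_real [simp]: "complex_of_real r *\<^sub>C x = r *\<^sub>R (x::'a::complex_hilbert)"
  by (simp add: scaleR_scaleC)

lemma scaleC_minus_one [simp]: "(- 1) *\<^sub>C x = - (x::'a::complex_hilbert)"
  using scaleC_of_real[of "-1" x] by simp

lemma scaleC_scaleR_commute: "a *\<^sub>C (r *\<^sub>R x) = r *\<^sub>R (a *\<^sub>C (x::'a::complex_hilbert))"
  unfolding scaleR_scaleC by (simp only: scaleC_scaleC mult.commute)

lemma cinner_scaleC_left: "cinner (a *\<^sub>C x) y = cnj a * cinner x (y::'a::complex_hilbert)"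
  by (metis cinner_commute cinner_scaleC_right complex_cnj_mult)

lemma Im_cinner: "Im (cinner x y) = inner (\<i> *\<^sub>C x) (y::'a::complex_hilbert)"
  by (simp add: inner_eq_Re_cinner cinner_scaleC_left)

lemma inner_scaleC_left: "inner (a *\<^sub>C x) y = inner x (cnj a *\<^sub>C (y::'a::complex_hilbert))"
  by (simp add: inner_eq_Re_cinner cinner_scaleC_left cinner_scaleC_right)

lemma norm_scaleC: "norm (a *\<^sub>C x) = cmod a * norm (x::'a::complex_hilbert)"
proof -
  have "cnj a * a = complex_of_real ((cmod a)\<^sup>2)"
    by (simp only: complex_norm_square mult.commute)
  then have "inner (a *\<^sub>C x) (a *\<^sub>C x) = (cmod a)\<^sup>2 * inner x x"
    unfolding inner_scaleC_left scaleC_scaleC by (simp only: scaleC_of_real inner_scaleR_right)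
  then show ?thesis
    by (simp add: norm_eq_sqrt_inner real_sqrt_mult)
qed

lemma bounded_linear_scaleC: "bounded_linear (\<lambda>x::'a::complex_hilbert. a *\<^sub>C x)"
  by (rule bounded_linear_intro[where K="cmod a"])
    (simp_all add: scaleC_add_right scaleC_scaleR_commute norm_scaleC mult.commute)

definition bounded_clinear :: "('a::complex_hilbert \<Rightarrow> 'b::complex_hilbert) \<Rightarrow> bool" where
  "bounded_clinear f \<longleftrightarrow> bounded_linear f \<and> (\<forall>a x. f (a *\<^sub>C x) = a *\<^sub>C f x)"

lemma bounded_clinearI:
  assumes "\<And>x y. f (x + y) = f x + f y" "\<And>a x. f (a *\<^sub>C x) = a *\<^sub>C f x"
    and "\<And>x. norm (f x) \<le> B * norm x"
  shows "bounded_clinear f"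
  unfolding bounded_clinear_def
  by (intro conjI bounded_linear_intro[where K=B] allI)
    (use assms(1,3) assms(2)[of "complex_of_real _"] assms(2) in \<open>simp_all add: mult.commute\<close>)

lemma bounded_clinear_linear: "bounded_clinear f \<Longrightarrow> bounded_linear f"
  by (simp add: bounded_clinear_def)

lemma bounded_clinear_compose:
  "bounded_clinear f \<Longrightarrow> bounded_clinear g \<Longrightarrow> bounded_clinear (\<lambda>x. f (g x))"
  by (auto simp: bounded_clinear_def intro: bounded_linear_compose)

lemma bounded_clinear_add:
  "bounded_clinear f \<Longrightarrow> bounded_clinear g \<Longrightarrow> bounded_clinear (\<lambda>x. f x + g x)"
  by (auto simp: bounded_clinear_def scaleC_add_right intro: bounded_linear_add)

lemma bounded_clinear_ident: "bounded_clinear (\<lambda>x. x)"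
  by (simp add: bounded_clinear_def bounded_linear_ident)

lemma bounded_clinear_scaleR:
  "bounded_clinear f \<Longrightarrow> bounded_clinear (\<lambda>x. r *\<^sub>R f x)"
  by (auto simp: bounded_clinear_def scaleC_scaleR_commute intro: bounded_linear_const_scaleR)

lemma bounded_clinear_uminus: "bounded_clinear f \<Longrightarrow> bounded_clinear (\<lambda>x. - f x)"
  using bounded_clinear_scaleR[of f "-1"] by simp

lemma bounded_clinear_fst: "bounded_clinear fst"
  by (simp add: bounded_clinear_def bounded_linear_fst scaleC_prod_def)

lemma bounded_clinear_snd: "bounded_clinear snd"
  by (simp add: bounded_clinear_def bounded_linear_snd scaleC_prod_def)

lemma bounded_clinear_Pair:
  "bounded_clinear f \<Longrightarrow> bounded_clinear g \<Longrightarrow> bounded_clinear (\<lambda>x. (f x, g x))"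
  by (simp add: bounded_clinear_def bounded_linear_Pair scaleC_prod_def)

text \<open>Only the real scalar product enters: for complex-linear maps symmetry of its values already
  gives symmetry of the complex scalar product, because the imaginary part of \<^term>\<open>cinner x y\<close> is
  \<^term>\<open>inner (\<i> *\<^sub>C x) y\<close>.\<close>

definition symmetric_map :: "('a::real_inner \<Rightarrow> 'a) \<Rightarrow> bool" where
  "symmetric_map f \<longleftrightarrow> (\<forall>x y. inner (f x) y = inner x (f y))"

text \<open>An unbounded operator that has an everywhere defined inverse is handled through that inverse:
  the graph of \<open>T\<close> is the transposed graph of a total map \<open>G\<close>, so the domain of \<open>T\<close> is the range of
  \<open>G\<close> and all statements about domains become statements about ranges.\<close>

definition inverts :: "('a \<rightharpoonup> 'b) \<Rightarrow> ('b \<Rightarrow> 'a) \<Rightarrow> bool" where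
  "inverts T G \<longleftrightarrow> (\<forall>x y. T x = Some y \<longleftrightarrow> G y = x)"

lemma inverts_eq_Some: "inverts T G \<Longrightarrow> T x = Some y \<longleftrightarrow> G y = x"
  by (simp add: inverts_def)

lemma invertsD:
  assumes "inverts T G"
  shows "T (G y) = Some y" "dom T = range G" "inj G" "x \<in> dom T \<Longrightarrow> G (the (T x)) = x"
proof -
  have *: "T x = Some y \<longleftrightarrow> G y = x" for x y using assms by (simp add: inverts_def)
  show "T (G y) = Some y" by (simp add: *)
  show "dom T = range G" by (auto simp: dom_def *)
  show "inj G" by (metis * injI option.inject)
  show "x \<in> dom T \<Longrightarrow> G (the (T x)) = x" by (metis * domD option.sel)
qed

lemma inverts_unique: "inverts S G \<Longrightarrow> inverts T G \<Longrightarrow> S = T"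
  unfolding inverts_def by (metis (full_types) ext not_Some_eq)

section \<open>Orthogonality and bounded inverses\<close>

text \<open>The point of \<open>V\<close> nearest to a point outside \<open>V\<close> is the limit of a minimising sequence, which
  is Cauchy by the parallelogram law; the difference vector is orthogonal to \<open>V\<close>.\<close>

lemma orthogonal_vector_exists:
  fixes V :: "'a::{real_inner,complete_space} set"
  assumes V: "subspace V" "closed V" "V \<noteq> UNIV"
  obtains z where "z \<noteq> 0" "\<And>v. v \<in> V \<Longrightarrow> inner z v = 0"
proof -
  obtain x where x: "x \<notin> V" using V(3) by auto
  have ne: "V \<noteq> {}" using subspace_0[OF V(1)] by auto
  define d where "d = infdist x V"
  have d: "d \<le> dist x v" if "v \<in> V" for v unfolding d_def using that by (rule infdist_le)
  have d0: "0 \<le> d" unfolding d_def by (rule infdist_nonneg)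
  have "\<exists>v\<in>V. (dist x v)\<^sup>2 < d\<^sup>2 + e" if "e > 0" for e
  proof (rule ccontr)
    assume "\<not> ?thesis"
    then have "sqrt (d\<^sup>2 + e) \<le> dist x v" if "v \<in> V" for v
      using that by (meson not_less real_le_lsqrt zero_le_dist)
    then have "sqrt (d\<^sup>2 + e) \<le> d"
      unfolding d_def infdist_def using ne by (auto intro: cINF_greatest)
    then have "(sqrt (d\<^sup>2 + e))\<^sup>2 \<le> d\<^sup>2" using that by (intro power_mono) auto
    with that show False by simp
  qed
  then have "\<forall>n. \<exists>v\<in>V. (dist x v)\<^sup>2 < d\<^sup>2 + 1 / real (Suc n)" by simp
  then obtain v where v: "\<And>n. v n \<in> V" "\<And>n. (dist x (v n))\<^sup>2 < d\<^sup>2 + 1 / real (Suc n)"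
    by metis
  have par: "(norm (v n - v m))\<^sup>2 \<le> 2 / real (Suc n) + 2 / real (Suc m)" for n m
  proof -
    have "(1/2) *\<^sub>R (v n + v m) \<in> V" by (intro subspace_scale subspace_add V v)
    from d[OF this] d0 have "d\<^sup>2 \<le> (norm (x - (1/2) *\<^sub>R (v n + v m)))\<^sup>2"
      unfolding dist_norm by (rule power_mono)
    moreover have "(norm (v n - v m))\<^sup>2 = 2 * (norm (x - v n))\<^sup>2 + 2 * (norm (x - v m))\<^sup>2
        - 4 * (norm (x - (1/2) *\<^sub>R (v n + v m)))\<^sup>2"
      by (simp add: power2_norm_eq_inner inner_diff_left inner_diff_right inner_add_left
          inner_add_right inner_commute algebra_simps)
    ultimately show ?thesis using v(2)[of n] v(2)[of m] by (simp add: dist_norm)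
  qed
  have "Cauchy v"
  proof (rule metric_CauchyI)
    fix e :: real assume e: "0 < e"
    obtain N where N: "4 / e\<^sup>2 < real N" using reals_Archimedean2 by blast
    show "\<exists>M. \<forall>m\<ge>M. \<forall>n\<ge>M. dist (v m) (v n) < e"
    proof (intro exI allI impI)
      fix m n assume mn: "N \<le> m" "N \<le> n"
      have *: "1 / real (Suc k) < e\<^sup>2 / 4" if "N \<le> k" for k
      proof -
        have "4 / e\<^sup>2 < real (Suc k)" using N that by linarith
        then show ?thesis using e by (simp add: field_simps)
      qed
      have "(norm (v m - v n))\<^sup>2 < e\<^sup>2"
        using par[of m n] *[OF mn(1)] *[OF mn(2)] by simp
      then show "dist (v m) (v n) < e"
        unfolding dist_norm using e by (simp add: power2_less_imp_less)
    qed
  qed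
  then obtain w where w: "v \<longlonglongrightarrow> w" using Cauchy_convergent convergent_def by blast
  have wV: "w \<in> V" using closed_sequentially[OF V(2) v(1) w] .
  have "(dist x w)\<^sup>2 \<le> d\<^sup>2"
  proof (rule LIMSEQ_le)
    show "(\<lambda>n. (dist x (v n))\<^sup>2) \<longlonglongrightarrow> (dist x w)\<^sup>2" by (intro tendsto_intros w)
    show "(\<lambda>n. d\<^sup>2 + 1 / real (Suc n)) \<longlonglongrightarrow> d\<^sup>2"
      using tendsto_add[OF tendsto_const[of "d\<^sup>2"] LIMSEQ_inverse_real_of_nat]
      by (simp add: inverse_eq_divide)
  qed (use v(2) less_imp_le in blast)
  then have wd: "dist x w \<le> d" using d0 by (rule power2_le_imp_le)
  define z where "z = x - w"
  have min: "(norm z)\<^sup>2 \<le> (norm (z - u))\<^sup>2" if "u \<in> V" for u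
  proof -
    have "norm z \<le> norm (z - u)"
      using wd d[of "w + u"] subspace_add[OF V(1) wV that] by (simp add: z_def dist_norm algebra_simps)
    then show ?thesis by (simp add: power_mono)
  qed
  show ?thesis
  proof
    show "z \<noteq> 0" using x wV by (auto simp: z_def)
    fix u assume u: "u \<in> V"
    show "inner z u = 0"
    proof (cases "u = 0")
      case False
      define t where "t = inner z u / inner u u"
      have "(norm z)\<^sup>2 \<le> (norm (z - t *\<^sub>R u))\<^sup>2" by (intro min subspace_scale V u)
      then have "2 * t * inner z u \<le> t * t * inner u u"
        by (simp add: power2_norm_eq_inner inner_diff_left inner_diff_right inner_commute)
      then have "(inner z u)\<^sup>2 \<le> 0" using False
        by (simp add: t_def field_simps power2_eq_square)
      then show ?thesis by simp
    qed simp
  qed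
qed

lemma subspace_closure:
  fixes V :: "'a::real_normed_vector set"
  assumes V: "subspace V"
  shows "subspace (closure V)"
proof (rule subspaceI)
  show "0 \<in> closure V" using subspace_0[OF V] closure_subset by blast
next
  fix x y assume "x \<in> closure V" "y \<in> closure V"
  then obtain X Y where X: "\<forall>n. X n \<in> V" "X \<longlonglongrightarrow> x" and Y: "\<forall>n. Y n \<in> V" "Y \<longlonglongrightarrow> y"
    unfolding closure_sequential by blast
  have "\<forall>n. X n + Y n \<in> V" using X(1) Y(1) subspace_add[OF V] by blast
  then show "x + y \<in> closure V"
    unfolding closure_sequential using tendsto_add[OF X(2) Y(2)]
    by (intro exI[of _ "\<lambda>n. X n + Y n"] conjI)
next
  fix r x assume "x \<in> closure V"
  then obtain X where X: "\<forall>n. X n \<in> V" "X \<longlonglongrightarrow> x" unfolding closure_sequential by blast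
  have "\<forall>n. r *\<^sub>R X n \<in> V" using X(1) subspace_scale[OF V] by blast
  then show "r *\<^sub>R x \<in> closure V"
    unfolding closure_sequential using tendsto_scaleR[OF tendsto_const X(2)]
    by (intro exI[of _ "\<lambda>n. r *\<^sub>R X n"] conjI)
qed

lemma subspace_dense_if_no_orthogonal:
  fixes V :: "'a::{real_inner,complete_space} set"
  assumes "subspace V" "\<And>z. (\<And>v. v \<in> V \<Longrightarrow> inner z v = 0) \<Longrightarrow> z = 0"
  shows "closure V = UNIV"
proof (rule ccontr)
  assume "closure V \<noteq> UNIV"
  then obtain z where z: "z \<noteq> 0" "\<And>v. v \<in> closure V \<Longrightarrow> inner z v = 0"
    using orthogonal_vector_exists[OF subspace_closure[OF assms(1)] closed_closure] by blast
  then show False using assms(2)[of z] closure_subset[of V] by auto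
qed

lemma eq_0_if_orthogonal_dense:
  fixes z :: "'a::real_inner"
  assumes "closure V = UNIV" "\<And>v. v \<in> V \<Longrightarrow> inner z v = 0"
  shows "z = 0"
proof -
  have "closure V \<subseteq> {v. inner z v = 0}"
    by (rule closure_minimal) (use assms(2) in \<open>auto intro!: closed_Collect_eq continuous_intros\<close>)
  then have "z \<in> {v. inner z v = 0}" using assms(1) by blast
  then show ?thesis by simp
qed

lemma dense_range_of_symmetric_inj:
  fixes G :: "'a::{real_inner,complete_space} \<Rightarrow> 'a"
  assumes "bounded_linear G" "symmetric_map G" "inj G"
  shows "closure (range G) = UNIV"
proof (rule subspace_dense_if_no_orthogonal)
  interpret bounded_linear G by fact
  show "subspace (range G)"
    using linear_axioms by (intro linear_subspace_image) (auto simp: subspace_UNIV)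
  fix z assume "\<And>v. v \<in> range G \<Longrightarrow> inner z v = 0"
  then have "inner (G z) (G z) = 0"
    using assms(2) unfolding symmetric_map_def by auto
  then have "G z = G 0" using zero by simp
  then show "z = 0" by (rule injD[OF assms(3)])
qed

text \<open>A lower bound turns convergence of the values into convergence of the arguments, so the range
  of a closed map is closed; a closed subspace without orthogonal vectors is the whole space. The map
  need only be linear on its domain, so that this covers unbounded operators too.\<close>

lemma surj_if_bounded_below:
  fixes D :: "'a::banach set" and f :: "'a \<Rightarrow> 'b::{real_inner,complete_space}"
  assumes D: "subspace D"
    and lin: "\<And>x y. x \<in> D \<Longrightarrow> y \<in> D \<Longrightarrow> f (x + y) = f x + f y"
      "\<And>r x. x \<in> D \<Longrightarrow> f (r *\<^sub>R x) = r *\<^sub>R f x"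
    and cl: "\<And>X x y. \<lbrakk>\<And>n. X n \<in> D; X \<longlonglongrightarrow> x; (\<lambda>n. f (X n)) \<longlonglongrightarrow> y\<rbrakk> \<Longrightarrow> x \<in> D \<and> f x = y"
    and c: "c > 0" "\<And>x. x \<in> D \<Longrightarrow> c * norm x \<le> norm (f x)"
    and orth: "\<And>z. (\<And>x. x \<in> D \<Longrightarrow> inner z (f x) = 0) \<Longrightarrow> z = 0"
  shows "f ` D = UNIV"
proof -
  have diff: "x - y \<in> D \<and> f (x - y) = f x - f y" if "x \<in> D" "y \<in> D" for x y
  proof -
    have y: "- y \<in> D" "f (- y) = - f y"
      using subspace_neg[OF D that(2)] lin(2)[OF that(2), of "-1"] by simp_all
    show ?thesis using subspace_add[OF D that(1) y(1)] lin(1)[OF that(1) y(1)] y(2) by simp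
  qed
  have sub: "subspace (f ` D)"
  proof (rule subspaceI)
    show "0 \<in> f ` D"
    by (rule image_eqI[of _ _ 0]) (use lin(2)[OF subspace_0[OF D], of 0] subspace_0[OF D] in simp_all)
  next
    fix x y assume "x \<in> f ` D" "y \<in> f ` D"
    then obtain a b where "x = f a" "y = f b" "a \<in> D" "b \<in> D" by blast
    then show "x + y \<in> f ` D" using lin(1)[of a b] subspace_add[OF D, of a b] by (metis image_eqI)
  next
    fix r x assume "x \<in> f ` D"
    then obtain a where "x = f a" "a \<in> D" by blast
    then show "r *\<^sub>R x \<in> f ` D" using lin(2)[of a r] subspace_scale[OF D, of a r] by (metis image_eqI)
  qed
  have "closed (f ` D)"
  proof (rule closed_sequential_limits[THEN iffD2], intro allI impI, elim conjE)
    fix Y y assume Y: "\<forall>n. Y n \<in> f ` D" "Y \<longlonglongrightarrow> y"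
    then have "\<forall>n. \<exists>x. x \<in> D \<and> Y n = f x" by blast
    from choice[OF this] obtain X where X: "\<And>n. X n \<in> D" "\<And>n. Y n = f (X n)" by blast
    have "Cauchy X"
    proof (rule metric_CauchyI)
      fix e :: real assume e: "0 < e"
      have "Cauchy Y" using Y(2) by (rule LIMSEQ_imp_Cauchy)
      then obtain M where M: "\<And>m n. m \<ge> M \<Longrightarrow> n \<ge> M \<Longrightarrow> dist (Y m) (Y n) < c * e"
        using metric_CauchyD[of Y "c * e"] c(1) e by auto
      have "dist (X m) (X n) < e" if "m \<ge> M" "n \<ge> M" for m n
      proof -
        have "c * dist (X m) (X n) \<le> dist (Y m) (Y n)"
          using c(2)[of "X m - X n"] diff[of "X m" "X n"] X by (simp add: dist_norm)
        then show ?thesis using M[OF that] c(1) by (smt (verit) mult_left_less_imp_less)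
      qed
      then show "\<exists>M. \<forall>m\<ge>M. \<forall>n\<ge>M. dist (X m) (X n) < e" by blast
    qed
    then obtain x where "X \<longlonglongrightarrow> x" using Cauchy_convergent convergent_def by blast
    then have "x \<in> D \<and> f x = y"
      using cl[of X x y] X(1) Y(2) unfolding X(2)[symmetric] by blast
    then show "y \<in> f ` D" by blast
  qed
  moreover have "closure (f ` D) = UNIV"
    by (rule subspace_dense_if_no_orthogonal[OF sub]) (use orth in blast)
  ultimately show ?thesis by (simp add: closure_closed)
qed

text \<open>The Lax-Milgram lemma: a vector orthogonal to the range is in particular orthogonal to its own
  image, hence \<open>0\<close> by coercivity.\<close>

lemma coercive_inverse:
  fixes f :: "'a::complex_hilbert \<Rightarrow> 'a"
  assumes f: "bounded_clinear f" and c: "c > 0" "\<And>x. c * (norm x)\<^sup>2 \<le> inner x (f x)"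
  obtains g where "bounded_clinear g" "\<And>x. f (g x) = x" "\<And>x. g (f x) = x"
    "\<And>x. c * norm (g x) \<le> norm x"
proof -
  interpret bounded_linear f using f by (rule bounded_clinear_linear)
  have low: "c * norm x \<le> norm (f x)" for x
  proof (cases "x = 0")
    case False
    have "c * norm x * norm x \<le> norm (f x) * norm x"
      using c(2)[of x] norm_cauchy_schwarz[of x "f x"] by (simp add: power2_eq_square mult.commute mult.assoc mult.left_commute)
    then show ?thesis using False by simp
  qed simp
  have "f ` UNIV = UNIV"
  proof (rule surj_if_bounded_below[OF _ _ _ _ c(1) low])
    fix X x y assume "X \<longlonglongrightarrow> x" "(\<lambda>n. f (X n)) \<longlonglongrightarrow> y"
    then show "x \<in> UNIV \<and> f x = y"
      using LIMSEQ_unique[OF tendsto] by blast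
  next
    fix z assume "\<And>x. x \<in> UNIV \<Longrightarrow> inner z (f x) = 0"
    then have "c * (norm z)\<^sup>2 \<le> 0" using c(2)[of z] by simp
    then show "z = 0" using c(1) by (simp add: mult_le_0_iff)
  qed (auto simp: add scaleR)
  then have surj: "surj f" .
  have inj: "inj f"
  proof (rule injI)
    fix x y assume "f x = f y"
    then have "c * norm (x - y) \<le> 0" using low[of "x - y"] by (simp add: diff)
    then show "x = y" using c(1) by (simp add: mult_le_0_iff)
  qed
  define g where "g = inv f"
  have fg: "f (g x) = x" for x unfolding g_def using surj by (rule surj_f_inv_f)
  have gf: "g (f x) = x" for x unfolding g_def using inj by (rule inv_f_f)
  have bd: "c * norm (g x) \<le> norm x" for x using low[of "g x"] by (simp add: fg)
  show ?thesis
  proof (rule that[OF _ fg gf bd])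
    show "bounded_clinear g"
    proof (rule bounded_clinearI[where B="1/c"])
      show "g (x + y) = g x + g y" for x y by (metis add fg gf)
      show "g (a *\<^sub>C x) = a *\<^sub>C g x" for a x using f by (metis bounded_clinear_def fg gf)
      show "norm (g x) \<le> 1 / c * norm x" for x using bd[of x] c(1) by (simp add: field_simps)
    qed
  qed
qed

section \<open>Selfadjoint and positive definite operators\<close>

lemma linear_opD:
  assumes "linear_op T"
  shows "0 \<in> dom T" "x \<in> dom T \<Longrightarrow> y \<in> dom T \<Longrightarrow> x + y \<in> dom T"
    "x \<in> dom T \<Longrightarrow> y \<in> dom T \<Longrightarrow> the (T (x + y)) = the (T x) + the (T y)"
    "x \<in> dom T \<Longrightarrow> a *\<^sub>C x \<in> dom T" "x \<in> dom T \<Longrightarrow> the (T (a *\<^sub>C x)) = a *\<^sub>C the (T x)"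
    "subspace (dom T)" "x \<in> dom T \<Longrightarrow> the (T (r *\<^sub>R x)) = r *\<^sub>R the (T x)"
    "the (T 0) = 0"
proof -
  note l = assms[unfolded linear_op_def]
  show *: "0 \<in> dom T" "x \<in> dom T \<Longrightarrow> y \<in> dom T \<Longrightarrow> x + y \<in> dom T"
    "x \<in> dom T \<Longrightarrow> y \<in> dom T \<Longrightarrow> the (T (x + y)) = the (T x) + the (T y)"
    "x \<in> dom T \<Longrightarrow> a *\<^sub>C x \<in> dom T" "x \<in> dom T \<Longrightarrow> the (T (a *\<^sub>C x)) = a *\<^sub>C the (T x)"
    for x y a
    using l by blast+
  show sc: "the (T (r *\<^sub>R x)) = r *\<^sub>R the (T x)" if "x \<in> dom T" for r x
    using *(5)[OF that, of "complex_of_real r"] by simp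
  show "subspace (dom T)"
    using * *(4)[of _ "complex_of_real _"] by (intro subspaceI) (simp_all only: scaleC_of_real)
  show "the (T 0) = 0" using sc[OF *(1), of 0] by simp
qed

lemma inverse_of_linear_op:
  assumes lin: "linear_op T" and ker: "\<And>x. T x = Some 0 \<Longrightarrow> x = 0"
    and R: "\<And>y. T (R y) = Some y" "\<And>y. norm (R y) \<le> B * norm y"
  shows "inverts T R" "bounded_clinear R"
proof -
  note l = linear_opD[OF lin]
  have inj: "x = x'" if "T x = Some y" "T x' = Some y" for x x' y
  proof -
    have x: "x \<in> dom T" and x': "- x' \<in> dom T" "the (T (- x')) = - y"
      using that l(4)[of x' "-1"] l(5)[of x' "-1"] by auto
    have "x - x' \<in> dom T" "the (T (x - x')) = 0"
      using l(2)[OF x x'(1)] l(3)[OF x x'(1)] x'(2) that(1) by simp_all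
    then have "T (x - x') = Some 0" by auto
    then show ?thesis using ker by fastforce
  qed
  show "inverts T R" unfolding inverts_def using R(1) inj by metis
  have dom: "R y \<in> dom T" "the (T (R y)) = y" for y using R(1)[of y] by auto
  show "bounded_clinear R"
  proof (rule bounded_clinearI[OF _ _ R(2)])
    fix x y
    have "T (R x + R y) = Some (x + y)" using l(2,3)[OF dom(1) dom(1), of x y] by (auto simp: dom(2))
    then show "R (x + y) = R x + R y" using inj R(1) by blast
  next
    fix a x
    have "T (a *\<^sub>C R x) = Some (a *\<^sub>C x)" using l(4,5)[OF dom(1), of a x] by (auto simp: dom(2))
    then show "R (a *\<^sub>C x) = a *\<^sub>C R x" using inj R(1) by blast
  qed
qed

lemma pfun_of_eq_Some: "(\<And>y z. R x y \<Longrightarrow> R x z \<Longrightarrow> y = z) \<Longrightarrow> pfun_of R x = Some y \<longleftrightarrow> R x y"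
  unfolding pfun_of_def by (auto intro: theI2)

text \<open>As the domain is a complex subspace, the real parts of the scalar products decide.\<close>

lemma adjoint_op_eq_Some:
  assumes "linear_op T" "closure (dom T) = UNIV"
  shows "adjoint_op T x = Some y \<longleftrightarrow> (\<forall>z\<in>dom T. inner x (the (T z)) = inner y z)"
proof -
  have eq: "(\<forall>z\<in>dom T. cinner x (the (T z)) = cinner y z) \<longleftrightarrow> (\<forall>z\<in>dom T. inner x (the (T z)) = inner y z)" for y
  proof
    assume r: "\<forall>z\<in>dom T. inner x (the (T z)) = inner y z"
    show "\<forall>z\<in>dom T. cinner x (the (T z)) = cinner y z"
    proof
      fix z assume z: "z \<in> dom T"
      have "inner x (the (T (- \<i> *\<^sub>C z))) = inner y (- \<i> *\<^sub>C z)"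
        using r linear_opD(4)[OF assms(1) z] by blast
      then have "Im (cinner x (the (T z))) = Im (cinner y z)"
        using linear_opD(5)[OF assms(1) z] by (simp add: Im_cinner inner_scaleC_left)
      then show "cinner x (the (T z)) = cinner y z"
        using r z by (simp add: complex_eq_iff inner_eq_Re_cinner)
    qed
  qed (simp add: inner_eq_Re_cinner)
  show ?thesis
    unfolding adjoint_op_def
  proof (subst pfun_of_eq_Some, unfold eq)
    fix y z assume y: "\<forall>w\<in>dom T. inner x (the (T w)) = inner y w" and z: "\<forall>w\<in>dom T. inner x (the (T w)) = inner z w"
    have "y - z = 0"
      by (rule eq_0_if_orthogonal_dense[OF assms(2)]) (use y z in \<open>simp add: inner_diff_left\<close>)
    then show "y = z" by simp
  qed simp
qed

lemma selfadjoint_eq_Some: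
  assumes "selfadjoint T"
  shows "T x = Some y \<longleftrightarrow> (\<forall>z\<in>dom T. inner x (the (T z)) = inner y z)"
  using adjoint_op_eq_Some[of T x y] assms unfolding selfadjoint_def by simp

lemma selfadjoint_symmetric:
  assumes "selfadjoint T" "x \<in> dom T" "y \<in> dom T"
  shows "inner x (the (T y)) = inner (the (T x)) y"
  using selfadjoint_eq_Some[OF assms(1), of x "the (T x)"] assms(2,3) by auto

lemma selfadjoint_closed:
  assumes "selfadjoint T" "\<And>n. X n \<in> dom T" "X \<longlonglongrightarrow> x" "(\<lambda>n. the (T (X n))) \<longlonglongrightarrow> y"
  shows "T x = Some y"
  unfolding selfadjoint_eq_Some[OF assms(1)]
proof
  fix z assume z: "z \<in> dom T"
  have "(\<lambda>n. inner (X n) (the (T z))) \<longlonglongrightarrow> inner x (the (T z))"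
    by (intro tendsto_intros assms)
  moreover have "(\<lambda>n. inner (the (T (X n))) z) \<longlonglongrightarrow> inner y z"
    by (intro tendsto_intros assms)
  ultimately show "inner x (the (T z)) = inner y z"
    using selfadjoint_symmetric[OF assms(1,2) z] by (simp add: LIMSEQ_unique)
qed

text \<open>A vector orthogonal to the range of a selfadjoint operator lies in the domain of the adjoint,
  hence of \<open>T\<close> itself, and is annihilated by \<open>T\<close>; positive definiteness excludes this unless it is
  \<open>0\<close>.\<close>

lemma posdef_op_inverse:
  assumes "posdef_op T"
  obtains G c where "c > 0" "bounded_clinear G" "symmetric_map G" "inverts T G"
    "\<And>y. c * (norm (G y))\<^sup>2 \<le> inner y (G y)"
proof -
  from assms obtain c where sa: "selfadjoint T" and c: "c > 0"
    "\<And>x. x \<in> dom T \<Longrightarrow> c * (norm x)\<^sup>2 \<le> inner x (the (T x))"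
    unfolding posdef_op_def inner_eq_Re_cinner by auto
  have lin: "linear_op T" using sa by (simp add: selfadjoint_def)
  note l = linear_opD[OF lin]
  have low: "c * norm x \<le> norm (the (T x))" if "x \<in> dom T" for x
  proof (cases "x = 0")
    case False
    have "c * norm x * norm x \<le> norm (the (T x)) * norm x"
      using c(2)[OF that] norm_cauchy_schwarz[of x "the (T x)"]
      by (simp add: power2_eq_square mult.commute mult.assoc mult.left_commute)
    then show ?thesis using False by simp
  qed simp
  have "(\<lambda>x. the (T x)) ` dom T = UNIV"
  proof (rule surj_if_bounded_below[OF l(6) l(3) l(7) _ c(1) low])
    fix X x y assume "\<And>n. X n \<in> dom T" "X \<longlonglongrightarrow> x" "(\<lambda>n. the (T (X n))) \<longlonglongrightarrow> y"
    from selfadjoint_closed[OF sa this] show "x \<in> dom T \<and> the (T x) = y" by auto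
  next
    fix z assume "\<And>x. x \<in> dom T \<Longrightarrow> inner z (the (T x)) = 0"
    then have "T z = Some 0" unfolding selfadjoint_eq_Some[OF sa] by simp
    then have "c * (norm z)\<^sup>2 \<le> 0" using c(2)[of z] by auto
    then show "z = 0" using c(1) by (simp add: mult_le_0_iff)
  qed auto
  then have "\<exists>x. x \<in> dom T \<and> the (T x) = y" for y
    by (metis (no_types, lifting) UNIV_I imageE)
  then obtain G where G: "\<And>y. G y \<in> dom T" "\<And>y. the (T (G y)) = y" by metis
  have TG: "T (G y) = Some y" for y using G[of y] by auto
  have ker: "x = 0" if "T x = Some 0" for x
  proof -
    have "c * norm x \<le> 0" using low[of x] that by auto
    then show ?thesis using c(1) by (simp add: mult_le_0_iff)
  qed
  have "norm (G y) \<le> 1 / c * norm y" for y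
    using low[OF G(1), of y] c(1) by (simp add: field_simps G)
  note inv = inverse_of_linear_op[OF lin ker TG this]
  have bd: "c * (norm (G y))\<^sup>2 \<le> inner y (G y)" for y
    using c(2)[OF G(1)[of y]] by (simp add: G(2) inner_commute)
  show ?thesis
  proof (rule that[OF c(1) inv(2) _ inv(1) bd])
    show "symmetric_map G"
      unfolding symmetric_map_def using selfadjoint_symmetric[OF sa G(1) G(1)] by (simp add: G(2))
  qed
qed

text \<open>Conversely, selfadjointness of an unbounded operator can be read off from its bounded
  inverse.\<close>

lemma selfadjoint_if_inverts:
  assumes "inverts T G" "bounded_clinear G" "symmetric_map G"
  shows "selfadjoint T"
proof -
  note i = invertsD[OF assms(1)]
  interpret bounded_linear G using assms(2) by (rule bounded_clinear_linear)
  have lin: "linear_op T"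
  proof -
    have "a *\<^sub>C G y \<in> dom T \<and> the (T (a *\<^sub>C G y)) = a *\<^sub>C the (T (G y))" for a y
      using assms(2) i(1)[of "a *\<^sub>C y"] i(1)[of y] by (auto simp: bounded_clinear_def)
    moreover have "G x + G y \<in> dom T \<and> the (T (G x + G y)) = the (T (G x)) + the (T (G y))" for x y
      using i(1)[of "x + y"] i(1)[of y] i(1)[of x] by (auto simp: add)
    ultimately show ?thesis unfolding linear_op_def i(2) using zero by (auto simp: image_iff intro: exI[of _ 0])
  qed
  have dense: "closure (dom T) = UNIV"
    unfolding i(2) by (rule dense_range_of_symmetric_inj) (use bounded_linear_axioms assms i in auto)
  have "adjoint_op T x = Some y \<longleftrightarrow> T x = Some y" for x y
  proof -
    have "(\<forall>w. inner x w = inner y (G w)) \<longleftrightarrow> (\<forall>w. inner (x - G y) w = 0)"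
      using assms(3) by (auto simp: symmetric_map_def inner_diff_left)
    also have "\<dots> \<longleftrightarrow> G y = x"
      by (metis eq_iff_diff_eq_0 inner_eq_zero_iff inner_zero_left)
    finally show ?thesis
      unfolding adjoint_op_eq_Some[OF lin dense] i(2) using assms(1) by (simp add: i(1) inverts_def)
  qed
  then have "adjoint_op T = T" by (metis (full_types) ext not_Some_eq)
  with lin dense show ?thesis by (simp add: selfadjoint_def)
qed

section \<open>Square roots\<close>

text \<open>The scalar form of the iteration used below for \<open>I - sqrt (I - A)\<close>, with \<open>A\<close> replaced by \<open>1\<close>.\<close>

lemma sqrt_majorant:
  fixes y :: "nat \<Rightarrow> real"
  assumes "y 0 = 0" "\<And>n. y (Suc n) = (1 + (y n)\<^sup>2) / 2"
  shows "0 \<le> y n" "y n \<le> 1" "y n \<le> y (Suc n)"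
proof -
  have b: "0 \<le> y n \<and> y n \<le> 1" for n
    by (induction n) (auto simp: assms power_le_one)
  then show "0 \<le> y n" "y n \<le> 1" by auto
  have "0 \<le> (1 - y n)\<^sup>2" by simp
  then show "y n \<le> y (Suc n)" by (simp add: assms power2_eq_square algebra_simps)
qed

text \<open>The increments satisfy
  \<open>2 (Y\<^sub>n\<^sub>+\<^sub>2 - Y\<^sub>n\<^sub>+\<^sub>1) = Y\<^sub>n\<^sub>+\<^sub>1 (Y\<^sub>n\<^sub>+\<^sub>1 - Y\<^sub>n) + (Y\<^sub>n\<^sub>+\<^sub>1 - Y\<^sub>n) Y\<^sub>n\<close>, and those of the scalar iteration
  the same relation, so the latter dominate the norms of the former; the scalar iteration is
  increasing and bounded. The limit satisfies \<open>(I - Z)\<^sup>2 = I - A\<close>.\<close>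

lemma sqrt_iteration_converges:
  fixes A :: "'a::banach \<Rightarrow>\<^sub>L 'a"
  assumes A: "norm A \<le> 1" and Y0: "Y 0 = 0"
    and YS: "\<And>n. Y (Suc n) = (1/2) *\<^sub>R (A + (Y n o\<^sub>L Y n))"
  obtains Z where "Y \<longlonglongrightarrow> Z" "Z = (1/2) *\<^sub>R (A + (Z o\<^sub>L Z))" "norm Z \<le> 1"
proof -
  define y where "y = rec_nat (0::real) (\<lambda>n s. (1 + s\<^sup>2) / 2)"
  have y: "y 0 = 0" "\<And>n. y (Suc n) = (1 + (y n)\<^sup>2) / 2" by (simp_all add: y_def)
  note m = sqrt_majorant[of y, OF y]
  have b: "norm (Y n) \<le> y n" for n
  proof (induction n)
    case (Suc n)
    have "norm (A + (Y n o\<^sub>L Y n)) \<le> 1 + y n * y n"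
      using A mult_mono[OF Suc Suc m(1)] norm_blinfun_compose[of "Y n" "Y n"]
        norm_triangle_ineq[of A "Y n o\<^sub>L Y n"] by auto
    then show ?case by (simp add: YS y power2_eq_square)
  qed (simp add: Y0 y)
  have step: "norm (Y (Suc n) - Y n) \<le> y (Suc n) - y n" for n
  proof (induction n)
    case (Suc n)
    have "2 *\<^sub>R Y (Suc (Suc n)) = A + (Y (Suc n) o\<^sub>L Y (Suc n))" "2 *\<^sub>R Y (Suc n) = A + (Y n o\<^sub>L Y n)"
      by (simp_all add: YS)
    then have "2 *\<^sub>R (Y (Suc (Suc n)) - Y (Suc n))
        = (Y (Suc n) o\<^sub>L (Y (Suc n) - Y n)) + ((Y (Suc n) - Y n) o\<^sub>L Y n)"
      by (simp add: scaleR_right_diff_distrib bounded_bilinear.diff_left[OF bounded_bilinear_blinfun_compose]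
          bounded_bilinear.diff_right[OF bounded_bilinear_blinfun_compose])
    then have "2 * norm (Y (Suc (Suc n)) - Y (Suc n))
        = norm ((Y (Suc n) o\<^sub>L (Y (Suc n) - Y n)) + ((Y (Suc n) - Y n) o\<^sub>L Y n))"
      using norm_scaleR[of 2 "Y (Suc (Suc n)) - Y (Suc n)"] by simp
    also have "\<dots> \<le> norm (Y (Suc n)) * norm (Y (Suc n) - Y n) + norm (Y (Suc n) - Y n) * norm (Y n)"
      by (intro norm_triangle_le add_mono norm_blinfun_compose)
    also have "\<dots> \<le> y (Suc n) * (y (Suc n) - y n) + (y (Suc n) - y n) * y n"
      using m(1,3) by (intro add_mono mult_mono b Suc) auto
    also have "\<dots> = 2 * (y (Suc (Suc n)) - y (Suc n))"
    proof -
      have "2 * y (Suc m) = 1 + y m * y m" for m by (simp add: y power2_eq_square)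
      from this[of "Suc n"] this[of n] show ?thesis by (simp add: algebra_simps)
    qed
    finally show ?case by simp
  qed (use A in \<open>simp add: YS Y0 y\<close>)
  have diff: "norm (Y (n + k) - Y n) \<le> y (n + k) - y n" for n k
  proof (induction k)
    case (Suc k)
    have "norm (Y (n + Suc k) - Y n) \<le> norm (Y (Suc (n + k)) - Y (n + k)) + norm (Y (n + k) - Y n)"
      using norm_triangle_ineq[of "Y (Suc (n + k)) - Y (n + k)" "Y (n + k) - Y n"] by simp
    then show ?case using Suc step[of "n + k"] by simp
  qed simp
  have "incseq y" using m(3) by (rule incseq_SucI)
  moreover have "bdd_above (range y)" using m(2) by (intro bdd_aboveI2)
  ultimately have "convergent y"
    using LIMSEQ_incseq_SUP[of y] by (auto simp: convergent_def)
  then have Cy: "Cauchy y" by (rule convergent_Cauchy)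
  have "Cauchy Y"
  proof (rule metric_CauchyI)
    fix e :: real assume "0 < e"
    then obtain M where M: "\<And>p q. p \<ge> M \<Longrightarrow> q \<ge> M \<Longrightarrow> dist (y p) (y q) < e"
      using metric_CauchyD[OF Cy] by blast
    have *: "dist (Y p) (Y q) < e" if "M \<le> q" "q \<le> p" for p q
      using diff[of q "p - q"] M[of p q] that by (simp add: dist_norm)
    have "dist (Y p) (Y q) < e" if "M \<le> q" "M \<le> p" for p q
      using *[of p q] *[of q p] that by (cases "q \<le> p") (auto simp: dist_commute)
    then show "\<exists>M. \<forall>p\<ge>M. \<forall>q\<ge>M. dist (Y p) (Y q) < e" by blast
  qed
  then obtain Z where Z: "Y \<longlonglongrightarrow> Z" using Cauchy_convergent convergent_def by blast
  have "(\<lambda>n. (1/2) *\<^sub>R (A + (Y n o\<^sub>L Y n))) \<longlonglongrightarrow> (1/2) *\<^sub>R (A + (Z o\<^sub>L Z))"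
    by (intro tendsto_intros bounded_bilinear.tendsto[OF bounded_bilinear_blinfun_compose] Z)
  then have "(\<lambda>n. Y (Suc n)) \<longlonglongrightarrow> (1/2) *\<^sub>R (A + (Z o\<^sub>L Z))" by (simp only: YS)
  then have "Z = (1/2) *\<^sub>R (A + (Z o\<^sub>L Z))" using LIMSEQ_unique[OF LIMSEQ_Suc[OF Z]] by blast
  moreover have "norm Z \<le> 1"
    using b m(2) by (intro LIMSEQ_le_const2[OF tendsto_norm[OF Z]]) (meson order.trans)
  ultimately show ?thesis using that Z by blast
qed

text \<open>The hypothesis makes \<open>A = I - G\<close> a contraction, since \<open>\<parallel>x - G x\<parallel>\<^sup>2\<close> expands to
  \<open>\<parallel>x\<parallel>\<^sup>2 - 2 (x, G x) + \<parallel>G x\<parallel>\<^sup>2\<close>. The square root of \<open>G\<close> is then \<open>I - Z\<close> with the limit \<open>Z\<close> of the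
  iteration; \<open>Z\<close> inherits symmetry and complex linearity from the iterates.\<close>

lemma bounded_sqrt_of_contraction:
  fixes G :: "'a::complex_hilbert \<Rightarrow> 'a"
  assumes G: "bounded_clinear G" "symmetric_map G" "\<And>x. (norm (G x))\<^sup>2 \<le> inner x (G x)"
  obtains R where "bounded_clinear R" "symmetric_map R" "\<And>x. 0 \<le> inner x (R x)" "\<And>x. R (R x) = G x"
proof -
  have bG: "bounded_linear G" using G(1) by (rule bounded_clinear_linear)
  interpret G: bounded_linear G by fact
  define A where "A = Blinfun (\<lambda>x. x - G x)"
  have A: "blinfun_apply A x = x - G x" for x
    unfolding A_def by (subst bounded_linear_Blinfun_apply) (intro bounded_linear_sub bounded_linear_ident bG, simp)
  have nA: "norm A \<le> 1"
  proof (rule norm_blinfun_bound)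
    fix x
    have "(norm (x - G x))\<^sup>2 = (norm x)\<^sup>2 - 2 * inner x (G x) + (norm (G x))\<^sup>2"
      by (simp add: power2_norm_eq_inner inner_diff_left inner_diff_right inner_commute)
    also have "\<dots> \<le> (norm x)\<^sup>2" using G(3)[of x] zero_le_power2[of "norm (G x)"] by linarith
    finally show "norm (blinfun_apply A x) \<le> 1 * norm x" unfolding A by simp
  qed simp
  define Y where "Y = rec_nat (0::'a \<Rightarrow>\<^sub>L 'a) (\<lambda>n s. (1/2) *\<^sub>R (A + (s o\<^sub>L s)))"
  have Y: "Y 0 = 0" "\<And>n. Y (Suc n) = (1/2) *\<^sub>R (A + (Y n o\<^sub>L Y n))" by (simp_all add: Y_def)
  obtain Z where Z: "Y \<longlonglongrightarrow> Z" "Z = (1/2) *\<^sub>R (A + (Z o\<^sub>L Z))" "norm Z \<le> 1"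
    by (rule sqrt_iteration_converges[OF nA Y])
  have app: "blinfun_apply (Y (Suc n)) x = (1/2) *\<^sub>R (x - G x + blinfun_apply (Y n) (blinfun_apply (Y n) x))" for n x
    by (simp add: Y(2) A blinfun.add_left blinfun.scaleR_left)
  have lim: "(\<lambda>n. blinfun_apply (Y n) x) \<longlonglongrightarrow> blinfun_apply Z x" for x
    by (intro blinfun.tendsto Z tendsto_const)
  have symY: "inner (blinfun_apply (Y n) x) y = inner x (blinfun_apply (Y n) y)" for n x y
  proof (induction n arbitrary: x y)
    case (Suc n)
    then show ?case using G(2) unfolding app symmetric_map_def
      by (simp add: inner_add_left inner_add_right inner_diff_left inner_diff_right)
  qed (simp add: Y)
  have scY: "blinfun_apply (Y n) (a *\<^sub>C x) = a *\<^sub>C blinfun_apply (Y n) x" for n a x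
  proof (induction n arbitrary: x)
    case 0
    then show ?case using linear_0[OF bounded_linear.linear[OF bounded_linear_scaleC[of a]]] by (simp add: Y)
  next
    case (Suc n)
    then show ?case using G(1) unfolding app bounded_clinear_def
      by (simp add: scaleC_scaleR_commute scaleC_add_right linear_diff[OF bounded_linear.linear[OF bounded_linear_scaleC[of a]]])
  qed
  have symZ: "inner (blinfun_apply Z x) y = inner x (blinfun_apply Z y)" for x y
    using tendsto_inner[OF lim[of x] tendsto_const[of y]] tendsto_inner[OF tendsto_const[of x] lim[of y]]
    by (simp add: symY LIMSEQ_unique)
  have scZ: "blinfun_apply Z (a *\<^sub>C x) = a *\<^sub>C blinfun_apply Z x" for a x
    using lim[of "a *\<^sub>C x"] bounded_linear.tendsto[OF bounded_linear_scaleC lim[of x], of a]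
    by (simp add: scY LIMSEQ_unique)
  have nZ: "norm (blinfun_apply Z x) \<le> norm x" for x
    using norm_blinfun[of Z x] mult_right_mono[OF Z(3) norm_ge_zero[of x]] by simp
  define R where "R x = x - blinfun_apply Z x" for x
  show ?thesis
  proof
    show "bounded_clinear R"
      unfolding R_def
    proof (rule bounded_clinearI[where B=2])
      show "norm (x - blinfun_apply Z x) \<le> 2 * norm x" for x
        using nZ[of x] norm_triangle_ineq4[of x "blinfun_apply Z x"] by simp
    qed (simp_all add: blinfun.add_right scZ
          linear_diff[OF bounded_linear.linear[OF bounded_linear_scaleC]])
    show "symmetric_map R"
      by (simp add: symmetric_map_def R_def inner_diff_left inner_diff_right symZ)
    fix x
    show "0 \<le> inner x (R x)"
      using norm_cauchy_schwarz[of x "blinfun_apply Z x"] mult_left_mono[OF nZ norm_ge_zero, of x x]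
      by (simp add: R_def inner_diff_right power2_norm_eq_inner[symmetric] power2_eq_square)
    have "blinfun_apply Z x = (1/2) *\<^sub>R (x - G x + blinfun_apply Z (blinfun_apply Z x))"
      by (subst Z(2)) (simp add: A blinfun.add_left blinfun.scaleR_left)
    then have "2 *\<^sub>R blinfun_apply Z x = x - G x + blinfun_apply Z (blinfun_apply Z x)"
      by (metis scaleR_2 scaleR_half_double scaleR_right_distrib)
    then show "R (R x) = G x"
      by (simp add: R_def blinfun.diff_right scaleR_2 algebra_simps)
  qed
qed

lemma bounded_sqrt_exists:
  fixes G :: "'a::complex_hilbert \<Rightarrow> 'a"
  assumes c: "c > 0" and G: "bounded_clinear G" "symmetric_map G" "\<And>x. c * (norm (G x))\<^sup>2 \<le> inner x (G x)"
  obtains R where "bounded_clinear R" "symmetric_map R" "\<And>x. 0 \<le> inner x (R x)" "\<And>x. R (R x) = G x"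
proof -
  have 1: "bounded_clinear (\<lambda>x. c *\<^sub>R G x)" by (rule bounded_clinear_scaleR[OF G(1)])
  have 2: "symmetric_map (\<lambda>x. c *\<^sub>R G x)" using G(2) by (simp add: symmetric_map_def)
  have 3: "(norm (c *\<^sub>R G x))\<^sup>2 \<le> inner x (c *\<^sub>R G x)" for x
    using mult_left_mono[OF G(3)[of x], of c] c
    by (simp add: power_mult_distrib power2_eq_square mult_ac)
  obtain R where R: "bounded_clinear R" "symmetric_map R" "\<And>x. 0 \<le> inner x (R x)" "\<And>x. R (R x) = c *\<^sub>R G x"
    using bounded_sqrt_of_contraction[OF 1 2 3] by blast
  interpret bounded_linear R using R(1) by (rule bounded_clinear_linear)
  show ?thesis
  proof
    show "bounded_clinear (\<lambda>x. (1 / sqrt c) *\<^sub>R R x)" by (rule bounded_clinear_scaleR[OF R(1)])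
    show "symmetric_map (\<lambda>x. (1 / sqrt c) *\<^sub>R R x)" using R(2) by (simp add: symmetric_map_def)
    fix x
    show "0 \<le> inner x ((1 / sqrt c) *\<^sub>R R x)" using R(3)[of x] c by simp
    show "(1 / sqrt c) *\<^sub>R R ((1 / sqrt c) *\<^sub>R R x) = G x"
      using c by (simp add: scaleR R(4))
  qed
qed

lemma op_inv_inverts: "inj G \<Longrightarrow> inverts (op_inv (\<lambda>x. Some (G x))) G"
  unfolding inverts_def op_inv_def
  by (subst pfun_of_eq_Some) (auto dest: injD)

lemma op_inv_eq: "inverts T G \<Longrightarrow> op_inv T = (\<lambda>y. Some (G y))"
proof (rule ext)
  fix y assume T: "inverts T G"
  have "op_inv T y = Some (G y) \<longleftrightarrow> T (G y) = Some y"
    unfolding op_inv_def by (rule pfun_of_eq_Some) (use T in \<open>simp add: inverts_def\<close>)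
  then show "op_inv T y = Some (G y)" using invertsD(1)[OF T] by simp
qed

lemma inverts_map_comp:
  assumes "inverts S P" "inverts T Q"
  shows "inverts (S \<circ>\<^sub>m T) (\<lambda>y. Q (P y))"
  using assms unfolding inverts_def map_comp_Some_iff by auto

text \<open>The square root of the bounded inverse of \<open>T\<close> is inverted.\<close>

lemma nonneg_sqrt_exists:
  assumes "posdef_op T"
  shows "\<exists>S. nonneg_op S \<and> S \<circ>\<^sub>m S = T"
proof -
  obtain G c where G: "c > 0" "bounded_clinear G" "symmetric_map G" "inverts T G"
    "\<And>y. c * (norm (G y))\<^sup>2 \<le> inner y (G y)"
    by (rule posdef_op_inverse[OF assms]) (rule that; assumption)
  obtain R where R: "bounded_clinear R" "symmetric_map R" "\<And>x. 0 \<le> inner x (R x)" "\<And>x. R (R x) = G x"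
    using bounded_sqrt_exists[OF G(1,2,3,5)] by blast
  have "inj R"
  proof (rule injI)
    fix x y assume "R x = R y"
    then have "G x = G y" by (metis R(4))
    then show "x = y" using invertsD(3)[OF G(4)] by (simp add: inj_eq)
  qed
  then have S: "inverts (op_inv (\<lambda>x. Some (R x))) R" (is "inverts ?S R") by (rule op_inv_inverts)
  have "nonneg_op ?S"
    unfolding nonneg_op_def
    using selfadjoint_if_inverts[OF S R(1,2)] R(3) invertsD(1)[OF S]
    by (auto simp: invertsD(2)[OF S] inner_eq_Re_cinner[symmetric] inner_commute)
  moreover have "inverts (?S \<circ>\<^sub>m ?S) G"
    using inverts_map_comp[OF S S] by (simp add: R(4))
  then have "?S \<circ>\<^sub>m ?S = T" using inverts_unique G(4) by blast
  ultimately show ?thesis by blast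
qed

text \<open>Surjectivity of \<open>T = S S\<close> passes to \<open>S\<close>, injectivity too, and
  \<open>\<parallel>R y\<parallel>\<^sup>2 = (y, G y)\<close> for the inverses \<open>R\<close> of \<open>S\<close> and \<open>G\<close> of \<open>T\<close> bounds \<open>R\<close>. The argument applies to
  every nonnegative selfadjoint \<open>S\<close> with \<open>S S = T\<close>, whichever of them is selected.\<close>

lemma posdef_op_sqrt_inverse:
  assumes "posdef_op T"
  obtains R where "bounded_clinear R" "symmetric_map R" "inverts (op_sqrt T) R"
    "inverts T (\<lambda>x. R (R x))"
proof -
  define S where "S = op_sqrt T"
  have S: "nonneg_op S" "S \<circ>\<^sub>m S = T"
    unfolding S_def op_sqrt_def using someI_ex[OF nonneg_sqrt_exists[OF assms]] by auto
  have sa: "selfadjoint S" using S(1) by (simp add: nonneg_op_def)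
  have lin: "linear_op S" using sa by (simp add: selfadjoint_def)
  obtain G and c :: real where "c > 0" "symmetric_map G" "\<And>y. c * (norm (G y))\<^sup>2 \<le> inner y (G y)"
    and G: "bounded_clinear G" "inverts T G"
    by (rule posdef_op_inverse[OF assms]) (rule that; assumption)
  define R where "R y = the (S (G y))" for y
  have "\<exists>z. S (G y) = Some z \<and> S z = Some y" for y
    using invertsD(1)[OF G(2), of y] unfolding S(2)[symmetric] map_comp_def by (auto split: option.splits)
  then have R: "S (G y) = Some (R y)" "S (R y) = Some y" for y
    unfolding R_def by (metis option.sel)+
  have ker: "x = 0" if "S x = Some 0" for x
  proof -
    have "S 0 = Some 0" using linear_opD(1,8)[OF lin] by auto
    then have "T x = Some 0" using that unfolding S(2)[symmetric] by (simp add: map_comp_def)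
    then have "G 0 = x" using G(2) by (simp add: inverts_def)
    then show ?thesis using linear_0[OF bounded_linear.linear[OF bounded_clinear_linear[OF G(1)]]] by simp
  qed
  have sym: "inner (R x) y = inner x (R y)" for x y
    using selfadjoint_symmetric[OF sa, of "R x" "R y"] R(2)[of x] R(2)[of y] by (auto simp: domI)
  obtain B where B: "B > 0" "\<And>y. norm (G y) \<le> norm y * B"
    using bounded_linear.pos_bounded[OF bounded_clinear_linear[OF G(1)]] by blast
  have bd: "norm (R y) \<le> sqrt B * norm y" for y
  proof -
    have "inner (R y) (R y) = inner y (G y)"
      using selfadjoint_symmetric[OF sa, of "G y" "R y"] R(1)[of y] R(2)[of y]
      by (auto simp: domI inner_commute)
    also have "\<dots> \<le> norm y * norm (G y)" by (rule norm_cauchy_schwarz)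
    also have "\<dots> \<le> norm y * (norm y * B)" by (intro mult_left_mono B) simp
    also have "\<dots> = (sqrt B * norm y)\<^sup>2" using B(1) by (simp add: power_mult_distrib power2_eq_square)
    finally have "(norm (R y))\<^sup>2 \<le> (sqrt B * norm y)\<^sup>2" by (simp add: power2_norm_eq_inner)
    then show ?thesis by (rule power2_le_imp_le) (use B in simp)
  qed
  note inv = inverse_of_linear_op[OF lin ker R(2) bd]
  have "inverts T (\<lambda>x. R (R x))" using inverts_map_comp[OF inv(1) inv(1)] S(2) by simp
  moreover have "symmetric_map R" using sym by (simp add: symmetric_map_def)
  ultimately show ?thesis using that[of R] inv unfolding S_def by simp
qed

section \<open>Generation of contraction semigroups\<close>

lemma contraction_power:
  fixes f :: "'a::real_normed_vector \<Rightarrow> 'a"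
  assumes "\<And>x. norm (f x) \<le> norm x"
  shows "norm ((f ^^ n) x) \<le> norm x"
  by (induction n) (use assms order.trans in auto)

lemma bounded_clinear_power:
  fixes f :: "'a::complex_hilbert \<Rightarrow> 'a"
  assumes "bounded_clinear f"
  shows "bounded_clinear (f ^^ n)"
proof (induction n)
  case 0
  then show ?case using bounded_clinear_ident by (simp add: id_def)
next
  case (Suc n)
  then show ?case using bounded_clinear_compose[OF assms Suc] by (simp add: comp_def)
qed

lemma convergent_if_geometric_steps:
  fixes X :: "nat \<Rightarrow> 'a::banach"
  assumes "\<And>k. norm (X (Suc k) - X k) \<le> c * (1/2) ^ k"
  shows "convergent X"
proof -
  have "summable (\<lambda>k. c * (1/2::real) ^ k)" by (intro summable_mult summable_geometric) simp
  then have "summable (\<lambda>k. X (Suc k) - X k)"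
    by (rule summable_comparison_test'[where N=0]) (use assms in auto)
  then have "(\<lambda>n. \<Sum>k<n. X (Suc k) - X k) \<longlonglongrightarrow> (\<Sum>k. X (Suc k) - X k)" by (rule summable_LIMSEQ)
  then have "(\<lambda>n. X n - X 0) \<longlonglongrightarrow> (\<Sum>k. X (Suc k) - X k)" by (simp only: sum_lessThan_telescope)
  then have "(\<lambda>n. (X n - X 0) + X 0) \<longlonglongrightarrow> (\<Sum>k. X (Suc k) - X k) + X 0" by (intro tendsto_add tendsto_const)
  then show ?thesis by (auto simp: convergent_def)
qed

text \<open>An \<open>\<epsilon>/3\<close> argument: convergence on a dense set suffices.\<close>

lemma closed_convergent_contractions:
  fixes E :: "nat \<Rightarrow> 'a::real_normed_vector \<Rightarrow> 'b::banach"
  assumes "\<And>k x y. norm (E k x - E k y) \<le> norm (x - y)"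
  shows "closed {x. convergent (\<lambda>k. E k x)}"
proof -
  have "convergent (\<lambda>k. E k x)" if x: "x \<in> closure {x. convergent (\<lambda>k. E k x)}" for x
  proof (rule Cauchy_convergent, rule metric_CauchyI)
    fix e :: real assume e: "0 < e"
    obtain y where y: "convergent (\<lambda>k. E k y)" "dist y x < e/3"
      using x e unfolding closure_approachable by (metis divide_pos_pos mem_Collect_eq zero_less_numeral)
    obtain M where M: "\<And>m n. m \<ge> M \<Longrightarrow> n \<ge> M \<Longrightarrow> dist (E m y) (E n y) < e/3"
      using metric_CauchyD[OF convergent_Cauchy[OF y(1)], of "e/3"] e by auto
    have d: "dist (E n x) (E n y) < e/3" for n
      using assms[of n x y] y(2) by (simp add: dist_norm norm_minus_commute)
    have "dist (E m x) (E n x) < e" if "m \<ge> M" "n \<ge> M" for m n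
      using d[of m] d[of n] M[OF that] dist_triangle[of "E m x" "E n x" "E m y"]
        dist_triangle[of "E m y" "E n x" "E n y"] by (simp add: dist_commute)
    then show "\<exists>M. \<forall>m\<ge>M. \<forall>n\<ge>M. dist (E m x) (E n x) < e" by blast
  qed
  then show ?thesis
    using closure_subset closure_subset_eq by blast
qed

text \<open>The semigroup is constructed from the inverse \<open>B\<close> of its generator \<open>A\<close>. With \<open>p = B q\<close> the
  dissipativity of \<open>A\<close>, which says that the real part of \<open>(p, A p)\<close> is at most \<open>0\<close>, becomes the condition
  \<open>diss\<close>.\<close>

locale dissipative_inverse =
  fixes B :: "'a::complex_hilbert \<Rightarrow> 'a"
  assumes B: "bounded_clinear B" and inj_B: "inj B" and diss: "\<And>q. inner q (B q) \<le> 0"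
begin

interpretation B: bounded_linear B using B by (rule bounded_clinear_linear)

text \<open>For \<open>z\<close> orthogonal to the range of \<open>B\<close>, dissipativity at \<open>B z + s z\<close> bounds the affine function
  \<open>s \<mapsto> (B z, B B z) + s \<parallel>B z\<parallel>\<^sup>2\<close> from above, so \<open>B z = 0\<close>.\<close>

lemma dense_range: "closure (range B) = UNIV"
proof (rule subspace_dense_if_no_orthogonal)
  show "subspace (range B)"
    using B.linear_axioms by (intro linear_subspace_image) (auto simp: subspace_UNIV)
  fix z assume z: "\<And>v. v \<in> range B \<Longrightarrow> inner z v = 0"
  have "B z = 0"
  proof (rule ccontr)
    assume ne: "B z \<noteq> 0"
    define q where "q = B z"
    \<comment> \<open>the value of \<open>s\<close> at which the affine function equals \<open>1\<close>\<close>
    define s where "s = (1 - inner q (B q)) / inner q q"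
    have "inner (q + s *\<^sub>R z) (B (q + s *\<^sub>R z)) = inner q (B q) + s * inner q q"
      using z by (simp add: B.add B.scaleR inner_add_left inner_add_right q_def[symmetric] z[unfolded q_def])
        (simp add: q_def z)
    also have "\<dots> = 1" using ne by (simp add: s_def q_def)
    finally show False using diss[of "q + s *\<^sub>R z"] by linarith
  qed
  then have "B z = B 0" using B.zero by simp
  then show "z = 0" by (rule injD[OF inj_B])
qed

text \<open>The resolvent \<open>(I - h A)\<^bsup>-1\<^esup>\<close>: for \<open>p = B z\<close> one has \<open>p - h A p = B z - h z\<close>, and \<open>h I - B\<close> is
  coercive.\<close>

lemma resolvent_exists:
  assumes "h > 0"
  shows "\<exists>J. bounded_clinear J \<and> (\<forall>z. J (B z - h *\<^sub>R z) = B z) \<and> (\<forall>y. \<exists>z. y = B z - h *\<^sub>R z)"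
proof -
  have f: "bounded_clinear (\<lambda>x. h *\<^sub>R x + (-1) *\<^sub>R B x)" (is "bounded_clinear ?f")
    by (intro bounded_clinear_add bounded_clinear_scaleR B bounded_clinear_ident)
  have co: "h * (norm x)\<^sup>2 \<le> inner x (?f x)" for x
    using diss[of x] by (simp add: inner_diff_right power2_norm_eq_inner)
  obtain g where g: "bounded_clinear g" "\<And>x. ?f (g x) = x" "\<And>x. g (?f x) = x"
    by (rule coercive_inverse[OF f assms co]) (rule that; assumption)
  interpret g: bounded_linear g using g(1) by (rule bounded_clinear_linear)
  have "bounded_clinear (\<lambda>y. (-1) *\<^sub>R B (g y))"
    by (intro bounded_clinear_scaleR bounded_clinear_compose[OF B g(1)])
  moreover have "(-1) *\<^sub>R B (g (B z - h *\<^sub>R z)) = B z" for z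
  proof -
    have "B z - h *\<^sub>R z = - ?f z" by simp
    then have "g (B z - h *\<^sub>R z) = - g (?f z)" by (simp only: linear_neg[OF g.linear])
    also have "\<dots> = - z" by (simp only: g(3))
    finally show ?thesis by (simp add: linear_neg[OF B.linear])
  qed
  moreover have "\<exists>z. y = B z - h *\<^sub>R z" for y
  proof
    have "B (g (- y)) - h *\<^sub>R g (- y) = - (h *\<^sub>R g (- y) + (- 1) *\<^sub>R B (g (- y)))" by simp
    then show "y = B (g (- y)) - h *\<^sub>R g (- y)" unfolding g(2) by simp
  qed
  ultimately show ?thesis by blast
qed

text \<open>One step of length \<open>h\<close> of the implicit Euler scheme for \<open>x' = A x\<close>, that is, the resolvent
  \<open>(I - h A)\<^bsup>-1\<^esup>\<close>.\<close>

definition J :: "real \<Rightarrow> 'a \<Rightarrow> 'a" where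
  "J h = (SOME J. bounded_clinear J \<and> (\<forall>z. J (B z - h *\<^sub>R z) = B z) \<and> (\<forall>y. \<exists>z. y = B z - h *\<^sub>R z))"

context
  fixes h :: real
  assumes h: "h > 0"
begin

lemma J_props: "bounded_clinear (J h)" "J h (B z - h *\<^sub>R z) = B z" "\<exists>z. y = B z - h *\<^sub>R z"
  using someI_ex[OF resolvent_exists[OF h]] unfolding J_def[symmetric] by auto

lemmas J_lin = bounded_clinear_linear[OF J_props(1)]

lemma J_step: "J h (B x) = B x + h *\<^sub>R J h x"
  using J_props(2)[of x] by (simp add: linear_diff[OF bounded_linear.linear[OF J_lin]]
      linear_scale[OF bounded_linear.linear[OF J_lin]] algebra_simps)

lemma J_B: "J h (B x) = B (J h x)"
proof -
  obtain z where z: "x = B z - h *\<^sub>R z" using J_props(3) by blast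
  have "B x = B (B z) - h *\<^sub>R B z" by (simp add: z B.diff B.scaleR)
  then have "J h (B x) = B (B z)" using J_props(2)[of "B z"] by simp
  then show ?thesis using J_props(2)[of z] z by simp
qed

lemma J_contraction: "norm (J h y) \<le> norm y"
proof -
  obtain z where z: "y = B z - h *\<^sub>R z" using J_props(3) by blast
  have "(norm y)\<^sup>2 = (norm (B z))\<^sup>2 - 2 * h * inner z (B z) + h\<^sup>2 * (norm z)\<^sup>2"
    unfolding z power2_norm_eq_inner power2_eq_square[of h]
    by (simp add: inner_diff_left inner_diff_right inner_commute algebra_simps)
  moreover have "2 * h * inner z (B z) \<le> 0" using diss h by (simp add: mult_le_0_iff)
  moreover have "0 \<le> h\<^sup>2 * (norm z)\<^sup>2" by simp
  ultimately have "(norm (B z))\<^sup>2 \<le> (norm y)\<^sup>2" by linarith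
  moreover have "J h y = B z" using J_props(2)[of z] z by simp
  ultimately have "(norm (J h y))\<^sup>2 \<le> (norm y)\<^sup>2" by simp
  then show ?thesis by (rule power2_le_imp_le) simp
qed

lemmas Jn_contraction = contraction_power[OF J_contraction]
lemmas Jn_clinear = bounded_clinear_power[OF J_props(1)]
lemmas Jn_lin = bounded_clinear_linear[OF Jn_clinear]

lemma Jn_diff: "(J h ^^ n) x - (J h ^^ n) y = (J h ^^ n) (x - y)"
  by (simp add: linear_diff[OF bounded_linear.linear[OF Jn_lin]])

lemma Jn_B: "(J h ^^ n) (B x) = B ((J h ^^ n) x)"
  by (induction n) (simp_all add: J_B)

lemma Jn_Suc_B: "(J h ^^ Suc n) (B x) = (J h ^^ n) (B x) + h *\<^sub>R (J h ^^ Suc n) x"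
  by (simp add: Jn_B J_step)

lemma Jn_B_diff: "norm ((J h ^^ n) (B r) - B r) \<le> n * h * norm r"
proof (induction n)
  case (Suc n)
  have "(J h ^^ Suc n) (B r) - B r = ((J h ^^ n) (B r) - B r) + h *\<^sub>R (J h ^^ Suc n) r"
    by (simp only: Jn_Suc_B algebra_simps)
  also have "norm \<dots> \<le> n * h * norm r + h * norm r"
    by (rule norm_triangle_le)
      (use h in \<open>intro add_mono Suc; simp only: norm_scaleR abs_of_pos mult_left_mono Jn_contraction less_imp_le\<close>)
  finally show ?case by (simp add: algebra_simps)
qed simp

lemma Jn_diff_le: "norm ((J h ^^ n) q - q) \<le> n * h * norm r + 2 * norm (q - B r)"
proof -
  have "(J h ^^ n) q - q = (J h ^^ n) (q - B r) + ((J h ^^ n) (B r) - B r) - (q - B r)"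
    by (simp add: Jn_diff[symmetric])
  then show ?thesis
    using Jn_contraction[of n "q - B r"] Jn_B_diff[of n r]
      norm_triangle_ineq4[of "(J h ^^ n) (q - B r) + ((J h ^^ n) (B r) - B r)" "q - B r"]
      norm_triangle_ineq[of "(J h ^^ n) (q - B r)" "(J h ^^ n) (B r) - B r"] by simp
qed

text \<open>Consecutive iterates of \<open>B q\<close> differ by \<open>h J\<^sup>j q\<close>, and \<open>J\<^sup>j q\<close> is close to \<open>q\<close> with an explicit rate when \<open>q\<close> is
  close to a vector \<open>B r\<close> of the domain. The estimate is uniform in the step length; in the limit it
  gives both strong continuity and the generator.\<close>

lemma Jn_taylor:
  "norm ((J h ^^ n) (B q) - B q - (n * h) *\<^sub>R q) \<le> (n * h) * ((n * h) * norm r + 2 * norm (q - B r))"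
proof -
  define c where "c = n * h * norm r + 2 * norm (q - B r)"
  have "norm ((J h ^^ m) (B q) - B q - (m * h) *\<^sub>R q) \<le> m * h * c" if "m \<le> n" for m
    using that
  proof (induction m)
    case (Suc m)
    have eq: "(J h ^^ Suc m) (B q) - B q - (Suc m * h) *\<^sub>R q
       = ((J h ^^ m) (B q) - B q - (m * h) *\<^sub>R q) + h *\<^sub>R ((J h ^^ Suc m) q - q)"
      by (simp only: Jn_Suc_B) (simp add: algebra_simps)
    have "Suc m * h * norm r \<le> n * h * norm r"
      using Suc.prems h by (intro mult_right_mono) (simp_all del: of_nat_Suc)
    then have "norm ((J h ^^ Suc m) q - q) \<le> c"
      using Jn_diff_le[of "Suc m" q r] unfolding c_def by linarith
    then have "norm (h *\<^sub>R ((J h ^^ Suc m) q - q)) \<le> h * c"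
      using h by (simp del: funpow.simps)
    moreover have "norm ((J h ^^ m) (B q) - B q - (m * h) *\<^sub>R q) \<le> m * h * c"
      using Suc by simp
    ultimately have "norm ((J h ^^ Suc m) (B q) - B q - (Suc m * h) *\<^sub>R q) \<le> m * h * c + h * c"
      unfolding eq by (intro norm_triangle_le add_mono)
    then show ?case by (simp add: algebra_simps del: funpow.simps)
  qed simp
  then show ?thesis unfolding c_def by (simp add: mult.assoc)
qed

end

text \<open>Two half steps agree with one step up to second order on the domain of \<open>A\<^sup>2\<close>.\<close>

lemma J_halving:
  assumes h: "h > 0"
  shows "norm (J h (B (B w)) - (J (h/2) ^^ 2) (B (B w))) \<le> 2 * h\<^sup>2 * norm w"
proof -
  define k where "k = h/2"
  have k: "k > 0" "h = 2 * k" using h by (auto simp: k_def)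
  interpret Jk: bounded_linear "J k" using J_lin[OF k(1)] .
  have hk: "h *\<^sub>R y = (2 * k) *\<^sub>R y" for y :: 'a using k(2) by simp
  have dbl: "(2 * k\<^sup>2) *\<^sub>R y = k\<^sup>2 *\<^sub>R y + k\<^sup>2 *\<^sub>R y" for y :: 'a by (simp add: scaleR_left_distrib[symmetric])
  \<comment> \<open>expanding the resolvent twice by \<open>J_step\<close> leaves only second-order remainders\<close>
  have h1: "J h (B (B w)) = B (B w) + (2 * k) *\<^sub>R (B w + (2 * k) *\<^sub>R J h w)"
    by (simp only: J_step[OF h] hk)
  have k1: "J k (B (B w)) = B (B w) + k *\<^sub>R (B w + k *\<^sub>R J k w)" by (simp only: J_step[OF k(1)])
  have "(J k ^^ 2) (B (B w)) = J k (B (B w)) + k *\<^sub>R (J k (B w) + k *\<^sub>R J k (J k w))"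
    unfolding numeral_2_eq_2 by (simp add: k1 Jk.add Jk.scaleR)
  also have "\<dots> = B (B w) + k *\<^sub>R (B w + k *\<^sub>R J k w) + k *\<^sub>R (B w + k *\<^sub>R J k w + k *\<^sub>R J k (J k w))"
    by (simp only: k1 J_step[OF k(1)])
  finally have "J h (B (B w)) - (J k ^^ 2) (B (B w)) = (4*k\<^sup>2) *\<^sub>R J h w - (2*k\<^sup>2) *\<^sub>R J k w - k\<^sup>2 *\<^sub>R J k (J k w)"
    unfolding h1 dbl by (simp add: algebra_simps power2_eq_square) (simp add: scaleR_left_distrib[symmetric])
  moreover have "norm ((4*k\<^sup>2) *\<^sub>R J h w) \<le> 4 * k\<^sup>2 * norm w" "norm ((2*k\<^sup>2) *\<^sub>R J k w) \<le> 2 * k\<^sup>2 * norm w"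
    "norm (k\<^sup>2 *\<^sub>R J k (J k w)) \<le> k\<^sup>2 * norm w"
    using J_contraction[OF h, of w] J_contraction[OF k(1), of w] J_contraction[OF k(1), of "J k w"]
    by (simp_all add: mult_left_mono)
  ultimately have "norm (J h (B (B w)) - (J k ^^ 2) (B (B w))) \<le> 7 * k\<^sup>2 * norm w"
    using norm_triangle_ineq4[of "(4*k\<^sup>2) *\<^sub>R J h w - (2*k\<^sup>2) *\<^sub>R J k w" "k\<^sup>2 *\<^sub>R J k (J k w)"]
      norm_triangle_ineq4[of "(4*k\<^sup>2) *\<^sub>R J h w" "(2*k\<^sup>2) *\<^sub>R J k w"] by simp
  also have "\<dots> \<le> 2 * h\<^sup>2 * norm w" unfolding k(2) by (simp add: power_mult_distrib)
  finally show ?thesis unfolding k_def .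
qed

lemma Jn_halving:
  assumes h: "h > 0"
  shows "norm ((J h ^^ n) (B (B w)) - (J (h/2) ^^ (2 * n)) (B (B w))) \<le> n * (2 * h\<^sup>2 * norm w)"
proof (induction n)
  case (Suc n)
  have h2: "h/2 > 0" using h by simp
  define v where "v = (J (h/2) ^^ (2*n)) w"
  have v: "(J (h/2) ^^ (2 * n)) (B (B w)) = B (B v)" by (simp add: v_def Jn_B[OF h2])
  have e: "(J (h/2) ^^ (2 * Suc n)) (B (B w)) = (J (h/2) ^^ 2) (B (B v))"
    by (simp add: v[symmetric] funpow_add[symmetric] numeral_2_eq_2)
  have "(J h ^^ Suc n) (B (B w)) - (J (h/2) ^^ (2 * Suc n)) (B (B w))
     = J h ((J h ^^ n) (B (B w)) - B (B v)) + (J h (B (B v)) - (J (h/2) ^^ 2) (B (B v)))"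
    unfolding e by (simp add: linear_diff[OF bounded_linear.linear[OF J_lin[OF h]]])
  also have "norm \<dots> \<le> n * (2 * h\<^sup>2 * norm w) + 2 * h\<^sup>2 * norm w"
  proof (intro norm_triangle_le add_mono)
    show "norm (J h ((J h ^^ n) (B (B w)) - B (B v))) \<le> n * (2 * h\<^sup>2 * norm w)"
      using Suc J_contraction[OF h] order.trans unfolding v by blast
    have "2 * h\<^sup>2 * norm v \<le> 2 * h\<^sup>2 * norm w"
      unfolding v_def by (intro mult_left_mono Jn_contraction[OF h2]) simp
    then show "norm (J h (B (B v)) - (J (h/2) ^^ 2) (B (B v))) \<le> 2 * h\<^sup>2 * norm w"
      using J_halving[OF h, of v] by simp
  qed
  finally show ?case by (simp add: algebra_simps)
qed simp

text \<open>Time \<open>t\<close> is approximated from below by multiples of the dyadic step length, so that each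
  refinement halves the step and at most one additional step appears.\<close>

definition mesh :: "nat \<Rightarrow> real" where "mesh k = (1/2) ^ k"
definition steps :: "nat \<Rightarrow> real \<Rightarrow> nat" where "steps k t = nat \<lfloor>t * 2 ^ k\<rfloor>"
definition euler :: "real \<Rightarrow> nat \<Rightarrow> 'a \<Rightarrow> 'a" where "euler t k = J (mesh k) ^^ steps k t"

lemma mesh_pos: "mesh k > 0" by (simp add: mesh_def)

lemma mesh_0: "mesh \<longlonglongrightarrow> 0" unfolding mesh_def by (rule LIMSEQ_realpow_zero) auto

lemma steps_bounds:
  assumes "0 \<le> t"
  shows "steps k t * mesh k \<le> t" "t - mesh k \<le> steps k t * mesh k"
proof -
  have 1: "real (steps k t) \<le> t * 2 ^ k" "t * 2 ^ k - 1 \<le> real (steps k t)"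
    unfolding steps_def using assms by (auto simp: of_nat_nat)
  show "steps k t * mesh k \<le> t" "t - mesh k \<le> steps k t * mesh k"
    using mult_right_mono[OF 1(1), of "mesh k"] mult_right_mono[OF 1(2), of "mesh k"]
    by (simp_all add: mesh_def power_one_over field_simps)
qed

lemma steps_limit: "0 \<le> t \<Longrightarrow> (\<lambda>k. steps k t * mesh k) \<longlonglongrightarrow> t"
  by (rule real_tendsto_sandwich[of "\<lambda>k. t - mesh k" _ _ "\<lambda>k. t"])
    (use steps_bounds tendsto_diff[OF tendsto_const mesh_0, of t] in auto)

lemma steps_Suc:
  assumes "0 \<le> t"
  shows "steps (Suc k) t = 2 * steps k t \<or> steps (Suc k) t = Suc (2 * steps k t)"
proof -
  have "\<lfloor>2 * x\<rfloor> = 2 * \<lfloor>x\<rfloor> \<or> \<lfloor>2 * x\<rfloor> = 2 * \<lfloor>x\<rfloor> + 1" for x :: real by linarith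
  from this[of "t * 2 ^ k"] have "\<lfloor>t * 2 ^ Suc k\<rfloor> = 2 * \<lfloor>t * 2 ^ k\<rfloor> \<or> \<lfloor>t * 2 ^ Suc k\<rfloor> = 2 * \<lfloor>t * 2 ^ k\<rfloor> + 1"
    by (simp add: mult_ac)
  moreover have "0 \<le> \<lfloor>t * 2 ^ k\<rfloor>" using assms by simp
  moreover have "nat a = 2 * nat b \<or> nat a = Suc (2 * nat b)" if "a = 2 * b \<or> a = 2 * b + 1" "0 \<le> b" for a b :: int
    using that by (auto simp: nat_add_distrib nat_mult_distrib)
  ultimately show ?thesis unfolding steps_def by blast
qed

text \<open>The approximate semigroup law fails by at most one Euler step, which tends to the identity.\<close>

lemma steps_add:
  assumes "0 \<le> s" "0 \<le> t"
  shows "steps k (s + t) = steps k s + steps k t \<or> steps k (s + t) = Suc (steps k s + steps k t)"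
proof -
  have "\<lfloor>x + y\<rfloor> = \<lfloor>x\<rfloor> + \<lfloor>y\<rfloor> \<or> \<lfloor>x + y\<rfloor> = \<lfloor>x\<rfloor> + \<lfloor>y\<rfloor> + 1" for x y :: real by linarith
  from this[of "s * 2 ^ k" "t * 2 ^ k"]
  have "\<lfloor>(s + t) * 2 ^ k\<rfloor> = \<lfloor>s * 2 ^ k\<rfloor> + \<lfloor>t * 2 ^ k\<rfloor> \<or> \<lfloor>(s + t) * 2 ^ k\<rfloor> = \<lfloor>s * 2 ^ k\<rfloor> + \<lfloor>t * 2 ^ k\<rfloor> + 1"
    by (simp add: distrib_right)
  moreover have "0 \<le> \<lfloor>s * 2 ^ k\<rfloor>" "0 \<le> \<lfloor>t * 2 ^ k\<rfloor>" using assms by simp_all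
  moreover have "nat a = nat b + nat c \<or> nat a = Suc (nat b + nat c)"
    if "a = b + c \<or> a = b + c + 1" "0 \<le> b" "0 \<le> c" for a b c :: int
    using that by (auto simp: nat_add_distrib)
  ultimately show ?thesis unfolding steps_def by blast
qed

lemma euler_step:
  assumes t: "0 \<le> t"
  shows "norm (euler t (Suc k) (B (B w)) - euler t k (B (B w))) \<le> (2 * t * norm w + norm (B w)) * (1/2) ^ k"
proof -
  let ?x = "B (B w)" and ?n = "steps k t" and ?h = "mesh k"
  have h: "?h / 2 = mesh (Suc k)" by (simp add: mesh_def)
  have "norm ((J (mesh (Suc k)) ^^ (2 * ?n)) ?x - euler t k ?x) \<le> ?n * (2 * ?h\<^sup>2 * norm w)"
    using Jn_halving[OF mesh_pos[of k], of ?n w] unfolding h euler_def by (simp add: norm_minus_commute)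
  also have "\<dots> = 2 * (?n * ?h) * ?h * norm w" by (simp add: power2_eq_square)
  also have "\<dots> \<le> 2 * t * ?h * norm w"
    using steps_bounds(1)[OF t, of k] mesh_pos[of k] by (intro mult_right_mono) auto
  finally have 1: "norm ((J (mesh (Suc k)) ^^ (2 * ?n)) ?x - euler t k ?x) \<le> 2 * t * ?h * norm w" .
  have "norm (euler t (Suc k) ?x - (J (mesh (Suc k)) ^^ (2 * ?n)) ?x) \<le> ?h * norm (B w)"
    using steps_Suc[OF t, of k]
  proof
    assume "steps (Suc k) t = 2 * ?n"
    then show ?thesis using mesh_pos[of k] by (simp add: euler_def)
  next
    assume *: "steps (Suc k) t = Suc (2 * ?n)"
    have "euler t (Suc k) ?x - (J (mesh (Suc k)) ^^ (2 * ?n)) ?x = mesh (Suc k) *\<^sub>R (J (mesh (Suc k)) ^^ Suc (2 * ?n)) (B w)"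
      unfolding euler_def * Jn_Suc_B[OF mesh_pos] by simp
    also have "norm \<dots> \<le> mesh (Suc k) * norm (B w)"
      using Jn_contraction[OF mesh_pos[of "Suc k"], of "Suc (2 * ?n)" "B w"] mesh_pos[of "Suc k"]
      by (simp only: norm_scaleR abs_of_pos mult_left_mono less_imp_le)
    also have "\<dots> \<le> ?h * norm (B w)" by (intro mult_right_mono) (simp_all add: mesh_def)
    finally show ?thesis .
  qed
  with 1 have "norm (euler t (Suc k) ?x - euler t k ?x) \<le> ?h * norm (B w) + 2 * t * ?h * norm w"
    using norm_triangle_ineq[of "euler t (Suc k) ?x - (J (mesh (Suc k)) ^^ (2 * ?n)) ?x"
        "(J (mesh (Suc k)) ^^ (2 * ?n)) ?x - euler t k ?x"] by simp
  then show ?thesis by (simp add: mesh_def algebra_simps)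
qed

lemma euler_lin: "bounded_clinear (euler t k)"
  unfolding euler_def by (rule Jn_clinear[OF mesh_pos])

lemma euler_contraction: "norm (euler t k x) \<le> norm x"
  unfolding euler_def by (rule Jn_contraction[OF mesh_pos])

lemma euler_diff: "euler t k x - euler t k y = euler t k (x - y)"
  unfolding euler_def by (rule Jn_diff[OF mesh_pos])

text \<open>The estimate \<open>euler_step\<close> is summable in \<open>k\<close> on the range of \<open>B B\<close>, the domain of \<open>A\<^sup>2\<close>, which is
  dense.\<close>

lemma euler_convergent:
  assumes t: "0 \<le> t"
  shows "convergent (\<lambda>k. euler t k x)"
proof -
  let ?V = "{x. convergent (\<lambda>k. euler t k x)}"
  have cl: "closed ?V"
    by (rule closed_convergent_contractions) (simp add: euler_diff euler_contraction)
  have "B ` closure (range B) \<subseteq> ?V"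
  proof (rule image_closure_subset[OF _ cl])
    show "continuous_on (closure (range B)) B" by (rule B.continuous_on) (rule continuous_on_id)
    have "convergent (\<lambda>k. euler t k (B (B w)))" for w
      by (rule convergent_if_geometric_steps) (rule euler_step[OF t])
    then show "B ` range B \<subseteq> ?V" by auto
  qed
  then have "range B \<subseteq> ?V" by (simp only: dense_range)
  from closure_minimal[OF this cl] show ?thesis unfolding dense_range by auto
qed

definition T :: "real \<Rightarrow> 'a \<Rightarrow> 'a" where "T t x = lim (\<lambda>k. euler t k x)"

lemma T_lim: "0 \<le> t \<Longrightarrow> (\<lambda>k. euler t k x) \<longlonglongrightarrow> T t x"
  using euler_convergent unfolding T_def by (simp add: convergent_LIMSEQ_iff)

lemma T_contraction: "0 \<le> t \<Longrightarrow> norm (T t x) \<le> norm x"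
  by (rule LIMSEQ_le_const2[OF tendsto_norm[OF T_lim]]) (auto simp: euler_contraction)

lemma T_lin:
  assumes t: "0 \<le> t"
  shows "bounded_clinear (T t)"
proof (rule bounded_clinearI[where B=1])
  note l = bounded_clinear_linear[OF euler_lin]
  show "T t (x + y) = T t x + T t y" for x y
    using LIMSEQ_unique[OF T_lim[OF t, of "x + y"]] tendsto_add[OF T_lim[OF t, of x] T_lim[OF t, of y]]
    by (simp add: linear_add[OF bounded_linear.linear[OF l]])
  show "T t (a *\<^sub>C x) = a *\<^sub>C T t x" for a x
    using LIMSEQ_unique[OF T_lim[OF t, of "a *\<^sub>C x"]] bounded_linear.tendsto[OF bounded_linear_scaleC T_lim[OF t, of x], of a]
      euler_lin by (simp add: bounded_clinear_def)
  show "norm (T t x) \<le> 1 * norm x" for x using T_contraction[OF t] by simp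
qed

lemma T_0: "T 0 x = x"
proof -
  have "euler 0 k x = x" for k by (simp add: euler_def steps_def)
  then have "(\<lambda>k. x) \<longlonglongrightarrow> T 0 x" using T_lim[of 0 x] by simp
  then show ?thesis by (rule LIMSEQ_unique[OF _ tendsto_const])
qed

lemma T_taylor:
  assumes t: "0 \<le> t"
  shows "norm (T t (B q) - B q - t *\<^sub>R q) \<le> t * (t * norm r + 2 * norm (q - B r))"
proof (rule LIMSEQ_le)
  let ?s = "\<lambda>k. steps k t * mesh k"
  show "(\<lambda>k. norm (euler t k (B q) - B q - ?s k *\<^sub>R q)) \<longlonglongrightarrow> norm (T t (B q) - B q - t *\<^sub>R q)"
    by (intro tendsto_intros T_lim steps_limit t)
  show "(\<lambda>k. ?s k * (?s k * norm r + 2 * norm (q - B r))) \<longlonglongrightarrow> t * (t * norm r + 2 * norm (q - B r))"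
    by (intro tendsto_intros steps_limit t)
  show "\<exists>N. \<forall>k\<ge>N. norm (euler t k (B q) - B q - ?s k *\<^sub>R q) \<le> ?s k * (?s k * norm r + 2 * norm (q - B r))"
    unfolding euler_def using Jn_taylor[OF mesh_pos] by blast
qed

lemma J_limit: "(\<lambda>k. J (mesh k) x) \<longlonglongrightarrow> x"
proof (rule metric_LIMSEQ_I)
  fix e :: real assume e: "0 < e"
  obtain r where r: "dist (B r) x < e/4"
    using dense_range e closure_approachable[of x "range B"] by (metis UNIV_I imageE zero_less_divide_iff zero_less_numeral)
  have "(\<lambda>k. mesh k * norm r) \<longlonglongrightarrow> 0 * norm r" by (intro tendsto_intros mesh_0)
  then have "\<forall>\<^sub>F k in sequentially. mesh k * norm r < e/2"
    by (rule order_tendstoD(2)) (use e in simp)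
  then obtain N where N: "\<And>k. k \<ge> N \<Longrightarrow> mesh k * norm r < e/2"
    by (auto simp: eventually_sequentially)
  have "dist (J (mesh k) x) x < e" if "k \<ge> N" for k
    using Jn_diff_le[OF mesh_pos[of k], of 1 x r] N[OF that] r by (simp add: dist_norm norm_minus_commute)
  then show "\<exists>N. \<forall>k\<ge>N. dist (J (mesh k) x) x < e" by blast
qed

lemma T_add:
  assumes s: "0 \<le> s" and t: "0 \<le> t"
  shows "T (s + t) x = T s (T t x)"
proof -
  have d: "norm (euler s k (euler t k x) - euler (s + t) k x) \<le> norm (J (mesh k) x - x)" for k
  proof -
    have e: "euler s k (euler t k x) = (J (mesh k) ^^ (steps k s + steps k t)) x"
      by (simp add: euler_def funpow_add)
    have "euler (s + t) k x = euler s k (euler t k x)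
        \<or> euler (s + t) k x = (J (mesh k) ^^ (steps k s + steps k t)) (J (mesh k) x)"
      using steps_add[OF s t, of k] unfolding e by (auto simp: euler_def funpow_swap1)
    then show ?thesis
    proof
      assume "euler (s + t) k x = (J (mesh k) ^^ (steps k s + steps k t)) (J (mesh k) x)"
      then show ?thesis unfolding e
        using Jn_contraction[OF mesh_pos[of k], of "steps k s + steps k t" "x - J (mesh k) x"]
        by (simp add: Jn_diff[OF mesh_pos] norm_minus_commute)
    qed simp
  qed
  have "(\<lambda>k. norm (J (mesh k) x - x)) \<longlonglongrightarrow> 0"
    using J_limit[of x] by (simp add: tendsto_norm_zero LIM_zero)
  then have 1: "(\<lambda>k. euler s k (euler t k x) - euler (s + t) k x) \<longlonglongrightarrow> 0"
    by (rule Lim_null_comparison[rotated]) (use d in auto)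
  have d': "norm (euler s k (euler t k x) - euler s k (T t x)) \<le> norm (euler t k x - T t x)" for k
    by (simp add: euler_diff euler_contraction)
  have "(\<lambda>k. norm (euler t k x - T t x)) \<longlonglongrightarrow> 0"
    using T_lim[OF t, of x] by (simp add: tendsto_norm_zero LIM_zero)
  then have 2: "(\<lambda>k. euler s k (euler t k x) - euler s k (T t x)) \<longlonglongrightarrow> 0"
    by (rule Lim_null_comparison[OF always_eventually, rotated]) (intro allI d')
  have "(\<lambda>k. euler (s + t) k x + (euler s k (euler t k x) - euler (s + t) k x)
      - (euler s k (euler t k x) - euler s k (T t x))) \<longlonglongrightarrow> T (s + t) x + 0 - 0"
    using s t by (intro tendsto_add tendsto_diff 1 2 T_lim) simp
  then have "(\<lambda>k. euler s k (T t x)) \<longlonglongrightarrow> T (s + t) x" by simp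
  then show ?thesis using T_lim[OF s] LIMSEQ_unique by blast
qed

lemma T_right_derivative: "((\<lambda>h. (T h (B q) - B q) /\<^sub>R h) \<longlongrightarrow> q) (at_right 0)"
proof (rule tendstoI)
  fix e :: real assume e: "0 < e"
  obtain r where r: "dist (B r) q < e/4"
    using dense_range e closure_approachable[of q "range B"] by (metis UNIV_I imageE zero_less_divide_iff zero_less_numeral)
  have "((\<lambda>h. h * norm r) \<longlongrightarrow> 0 * norm r) (at_right 0)" by (intro tendsto_intros)
  then have "\<forall>\<^sub>F h in at_right 0. h * norm r < e/2"
    by (rule order_tendstoD(2)) (use e in simp)
  then show "\<forall>\<^sub>F h in at_right 0. dist ((T h (B q) - B q) /\<^sub>R h) q < e"
    using eventually_at_right_less[of "0::real"]
  proof eventually_elim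
    case (elim h)
    have "(T h (B q) - B q) /\<^sub>R h - q = (T h (B q) - B q - h *\<^sub>R q) /\<^sub>R h"
      using elim by (simp add: scaleR_diff_right)
    then have "norm ((T h (B q) - B q) /\<^sub>R h - q) = \<bar>inverse h\<bar> * norm (T h (B q) - B q - h *\<^sub>R q)"
      by (simp only: norm_scaleR)
    also have "\<dots> = norm (T h (B q) - B q - h *\<^sub>R q) / h"
      unfolding abs_of_pos[OF positive_imp_inverse_positive[OF elim(2)]] by (rule divide_inverse_commute[symmetric])
    also have "\<dots> \<le> h * norm r + 2 * norm (q - B r)"
      using T_taylor[of h q r] elim(2) by (simp only: pos_divide_le_eq mult.commute less_imp_le)
    also have "\<dots> < e" using elim(1) r by (simp add: dist_norm norm_minus_commute)
    finally show ?case by (simp add: dist_norm)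
  qed
qed

lemma T_right_continuous: "((\<lambda>h. T h x) \<longlongrightarrow> x) (at_right 0)"
proof (rule tendstoI)
  fix e :: real assume e: "0 < e"
  obtain q where q: "dist (B q) x < e/3"
    using dense_range e closure_approachable[of x "range B"] by (metis UNIV_I imageE zero_less_divide_iff zero_less_numeral)
  have "((\<lambda>h. norm (h *\<^sub>R ((T h (B q) - B q) /\<^sub>R h))) \<longlongrightarrow> norm (0 *\<^sub>R q)) (at_right 0)"
    by (intro tendsto_intros T_right_derivative)
  then have "\<forall>\<^sub>F h in at_right 0. norm (h *\<^sub>R ((T h (B q) - B q) /\<^sub>R h)) < e/3"
    by (rule order_tendstoD(2)) (use e in simp)
  then show "\<forall>\<^sub>F h in at_right 0. dist (T h x) x < e"
    using eventually_at_right_less[of "0::real"]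
  proof eventually_elim
    case (elim h)
    have "T h x - x = T h (x - B q) + (T h (B q) - B q) - (x - B q)"
      using elim by (simp add: linear_diff[OF bounded_linear.linear[OF bounded_clinear_linear[OF T_lin]]])
    then have "norm (T h x - x) \<le> norm (x - B q) + norm (T h (B q) - B q) + norm (x - B q)"
      using T_contraction[of h "x - B q"] elim
        norm_triangle_ineq4[of "T h (x - B q) + (T h (B q) - B q)" "x - B q"]
        norm_triangle_ineq[of "T h (x - B q)" "T h (B q) - B q"] by simp
    then show ?case using elim q by (simp add: dist_norm norm_minus_commute)
  qed
qed

lemma T_continuous: "continuous_on {0..} (\<lambda>t. T t x)"
proof -
  have d: "dist (T t x) (T s x) \<le> dist (T (t - s) x) x" if "0 \<le> s" "s \<le> t" for s t
  proof -
    have "T t x - T s x = T s (T (t - s) x - x)"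
      using T_add[of s "t - s" x] that
      by (simp add: linear_diff[OF bounded_linear.linear[OF bounded_clinear_linear[OF T_lin]]])
    then show ?thesis using T_contraction[OF that(1)] by (simp add: dist_norm)
  qed
  show ?thesis
    unfolding continuous_on_iff
  proof (intro ballI allI impI)
    fix t e :: real assume t: "t \<in> {0..}" and e: "0 < e"
    obtain \<delta> where \<delta>: "\<delta> > 0" "\<And>h. 0 < h \<Longrightarrow> h < \<delta> \<Longrightarrow> dist (T h x) x < e"
      using tendstoD[OF T_right_continuous e, of x] unfolding eventually_at_right_field by auto
    have \<delta>': "dist (T h x) x < e" if "0 \<le> h" "h < \<delta>" for h
      using \<delta>(2)[of h] that e T_0 by (cases "h = 0") auto
    have "dist (T s x) (T t x) < e" if "s \<in> {0..}" "dist s t < \<delta>" for s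
      using d[of s t] d[of t s] \<delta>'[of "\<bar>s - t\<bar>"] t that
      by (cases "s \<le> t") (auto simp: dist_commute dist_real_def abs_minus_commute)
    then show "\<exists>d>0. \<forall>s\<in>{0..}. dist s t < d \<longrightarrow> dist (T s x) (T t x) < e"
      using \<delta>(1) by blast
  qed
qed

lemma C0_T: "C0_semigroup T"
  unfolding C0_semigroup_def
  using T_lin T_0 T_add T_continuous by (auto simp: bounded_clinear_def)

end

lemma generator_eq_Some:
  "generator T x = Some y \<longleftrightarrow> ((\<lambda>h. (T h x - x) /\<^sub>R h) \<longlongrightarrow> y) (at_right 0)"
  unfolding generator_def
  by (rule pfun_of_eq_Some) (rule tendsto_unique[OF trivial_limit_at_right_real])

text \<open>The generator of the limit semigroup extends \<open>A\<close> by the Taylor estimate. It cannot be a proper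
  extension: it is dissipative, since the semigroup is contractive, and \<open>I - A\<close> is already surjective.\<close>

lemma (in dissipative_inverse) generator_T: "inverts (generator T) B"
  unfolding inverts_def generator_eq_Some
proof (intro allI iffI)
  fix x y
  assume y: "((\<lambda>h. (T h x - x) /\<^sub>R h) \<longlongrightarrow> y) (at_right 0)"
  \<comment> \<open>surjectivity of \<open>I - A\<close>: the pair \<open>(B q, q)\<close> of the graph of \<open>A\<close> has the same difference as \<open>(x, y)\<close>\<close>
  obtain q where q: "x - y = B q - q" using J_props(3)[of 1 "x - y"] by auto
  define d where "d = B q - x"
  have "((\<lambda>h. (T h (B q) - B q) /\<^sub>R h - (T h x - x) /\<^sub>R h) \<longlongrightarrow> q - y) (at_right 0)"
    by (intro tendsto_diff T_right_derivative y)
  then have "((\<lambda>h. inner d ((T h (B q) - B q) /\<^sub>R h - (T h x - x) /\<^sub>R h)) \<longlongrightarrow> inner d (q - y)) (at_right 0)"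
    by (intro tendsto_inner tendsto_const)
  moreover have "\<forall>\<^sub>F h in at_right 0. inner d ((T h (B q) - B q) /\<^sub>R h - (T h x - x) /\<^sub>R h) \<le> 0"
    using eventually_at_right_less[of "0::real"]
  proof eventually_elim
    case (elim h)
    have "(T h (B q) - B q) /\<^sub>R h - (T h x - x) /\<^sub>R h = (T h d - d) /\<^sub>R h"
      using elim by (simp add: d_def scaleR_diff_right algebra_simps
          linear_diff[OF bounded_linear.linear[OF bounded_clinear_linear[OF T_lin]]])
    moreover have "inner d (T h d) \<le> inner d d"
      using norm_cauchy_schwarz[of d "T h d"] mult_left_mono[OF T_contraction[of h d] norm_ge_zero[of d]] elim
      by (simp add: power2_norm_eq_inner[symmetric] power2_eq_square)
    ultimately show ?case using elim by (simp add: inner_diff_right mult_le_0_iff)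
  qed
  ultimately have "inner d (q - y) \<le> 0"
    by (rule tendsto_upperbound) simp
  moreover have "q - y = d" using q by (simp add: d_def algebra_simps)
  ultimately have "inner d d \<le> 0" by simp
  then have "d = 0" by (metis inner_ge_zero order.antisym inner_eq_zero_iff)
  then show "B y = x" using \<open>q - y = d\<close> by (simp add: d_def)
next
  fix x y assume "B y = x"
  then show "((\<lambda>h. (T h x - x) /\<^sub>R h) \<longlongrightarrow> y) (at_right 0)" using T_right_derivative[of y] by simp
qed

text \<open>The Lumer-Phillips theorem for generators with a bounded inverse.\<close>

lemma dissipative_generates_semigroup:
  assumes "bounded_clinear B" "\<And>q. inner q (B q) \<le> 0" "inverts A B"
  shows "\<exists>T. C0_semigroup T \<and> generator T = A"
proof -
  interpret dissipative_inverse B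
    by unfold_locales (use assms invertsD(3) in auto)
  show ?thesis using C0_T inverts_unique[OF generator_T assms(3)] by blast
qed

lemma op_exp_semigroup:
  assumes "bounded_clinear B" "\<And>q. inner q (B q) \<le> 0" "inverts A B"
  shows "C0_semigroup (op_exp A)" "generator (op_exp A) = A"
  using someI_ex[OF dissipative_generates_semigroup[OF assms]] unfolding op_exp_def by auto

section \<open>Exponential decay of orbits\<close>

text \<open>The definition of the generator gives directly only right derivatives along orbits. Comparing with a line of slope \<open>\<epsilon>\<close>, the last
  point at which the function is below the line cannot be interior, as the function stays below it
  a little longer.\<close>

lemma nonincreasing_if_right_derivative_nonpos:
  fixes f :: "real \<Rightarrow> real"
  assumes cont: "continuous_on {0..} f"
    and der: "\<And>t. 0 \<le> t \<Longrightarrow> \<exists>D\<le>0. (f has_real_derivative D) (at t within {t<..})"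
    and b: "0 \<le> b"
  shows "f b \<le> f 0"
proof (rule field_le_epsilon)
  fix e :: real assume e: "0 < e"
  \<comment> \<open>\<open>b + 1\<close> instead of \<open>b\<close> keeps the slope meaningful for \<open>b = 0\<close>\<close>
  define \<epsilon> where "\<epsilon> = e / (b + 1)"
  have \<epsilon>: "\<epsilon> > 0" "\<epsilon> * b \<le> e" using e b by (auto simp: \<epsilon>_def field_simps)
  define g where "g t = f t - f 0 - \<epsilon> * t" for t
  have cg: "continuous_on {0..b} g"
    unfolding g_def by (intro continuous_intros continuous_on_subset[OF cont]) auto
  let ?Z = "{t \<in> {0..b}. g t \<le> 0}"
  have Z: "?Z = {0..b} \<inter> g -` {..0}" by auto
  have "closed ?Z" unfolding Z by (rule continuous_closed_preimage[OF cg]) auto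
  moreover have "bounded ?Z" by (rule bounded_subset[of "{0..b}"]) auto
  ultimately have "compact ?Z" by (simp only: compact_eq_bounded_closed)
  moreover have "0 \<in> ?Z" using b by (simp add: g_def)
  ultimately obtain c where c: "c \<in> ?Z" "\<And>t. t \<in> ?Z \<Longrightarrow> t \<le> c"
    using compact_attains_sup[of ?Z] by blast
  have "c = b"
  proof (rule ccontr)
    assume "c \<noteq> b"
    then have cb: "0 \<le> c" "c < b" using c(1) by auto
    obtain D where D: "D \<le> 0" "(f has_real_derivative D) (at c within {c<..})" using der[OF cb(1)] by blast
    have "(g has_real_derivative D - \<epsilon>) (at c within {c<..})"
      unfolding g_def by (auto intro!: derivative_eq_intros D(2))
    from has_real_derivative_neg_dec_right[OF this] obtain d
      where d: "d > 0" "\<And>h. 0 < h \<Longrightarrow> h < d \<Longrightarrow> g (c + h) < g c" using D(1) \<epsilon>(1) by auto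
    define h where "h = min (d/2) (b - c)"
    have h: "0 < h" "h < d" "c + h \<le> b" using d(1) cb by (auto simp: h_def)
    have "c + h \<in> ?Z" using d(2)[OF h(1,2)] c(1) h cb by auto
    from c(2)[OF this] h(1) show False by simp
  qed
  then show "f b \<le> f 0 + e" using c(1) \<epsilon>(2) by (simp add: g_def)
qed

lemma has_vector_derivative_right:
  assumes "((\<lambda>h. (v (t + h) - v t) /\<^sub>R h) \<longlongrightarrow> D) (at_right 0)"
  shows "(v has_vector_derivative D) (at t within {t<..})"
  unfolding has_vector_derivative_def has_derivative_within
proof
  show "bounded_linear (\<lambda>x. x *\<^sub>R D)" by (rule bounded_linear_scaleR_left)
  have "((\<lambda>h. (v (t + h) - v t) /\<^sub>R h - D) \<longlongrightarrow> 0) (at_right 0)"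
    using tendsto_diff[OF assms tendsto_const[of D]] by simp
  then have "((\<lambda>h. (1 / norm (h + t - t)) *\<^sub>R (v (h + t) - (v t + (h + t - t) *\<^sub>R D))) \<longlongrightarrow> 0) (at_right 0)"
  proof (rule Lim_transform_eventually)
    show "\<forall>\<^sub>F h in at_right 0. (v (t + h) - v t) /\<^sub>R h - D
        = (1 / norm (h + t - t)) *\<^sub>R (v (h + t) - (v t + (h + t - t) *\<^sub>R D))"
      using eventually_at_right_less[of "0::real"]
      by eventually_elim (simp add: algebra_simps divide_inverse)
  qed
  then show "((\<lambda>y. (1 / norm (y - t)) *\<^sub>R (v y - (v t + (y - t) *\<^sub>R D))) \<longlongrightarrow> 0) (at t within {t<..})"
    by (subst filterlim_at_right_to_0)
qed

lemma orbit_right_derivative: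
  assumes T: "C0_semigroup T" and u: "generator T u = Some w" and t: "0 \<le> t"
  shows "generator T (T t u) = Some (T t w)"
    "((\<lambda>s. T s u) has_vector_derivative T t w) (at t within {t<..})"
proof -
  have lin: "bounded_linear (T t)" using T t by (simp add: C0_semigroup_def)
  have "((\<lambda>h. T t ((T h u - u) /\<^sub>R h)) \<longlongrightarrow> T t w) (at_right 0)"
    using u unfolding generator_eq_Some by (rule bounded_linear.tendsto[OF lin])
  then have lim: "((\<lambda>h. (T t (T h u) - T t u) /\<^sub>R h) \<longlongrightarrow> T t w) (at_right 0)"
    by (simp add: linear_diff[OF bounded_linear.linear[OF lin]] linear_scale[OF bounded_linear.linear[OF lin]])
  have add: "T t (T h u) = T (t + h) u" "T h (T t u) = T (t + h) u" if "0 < h" for h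
    using T t that add.commute[of h t] unfolding C0_semigroup_def by (metis less_imp_le)+
  show "generator T (T t u) = Some (T t w)"
    unfolding generator_eq_Some
    by (rule Lim_transform_eventually[OF lim], use eventually_at_right_less[of "0::real"] in eventually_elim)
      (simp add: add)
  show "((\<lambda>s. T s u) has_vector_derivative T t w) (at t within {t<..})"
    by (rule has_vector_derivative_right, rule Lim_transform_eventually[OF lim],
        use eventually_at_right_less[of "0::real"] in eventually_elim) (simp add: add)
qed

text \<open>The weighted energy \<open>e\<^bsup>-2\<mu>t\<^esup> \<parallel>L T(t) u\<parallel>\<^sup>2\<close> has a nonpositive right derivative. Here \<open>L\<close> plays the
  role of a change of norm.\<close>

lemma semigroup_decay:
  assumes T: "C0_semigroup T" and L: "bounded_linear L"
    and diss: "\<And>u w. generator T u = Some w \<Longrightarrow> inner (L u) (L w) \<le> \<mu> * (norm (L u))\<^sup>2"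
    and u: "generator T u = Some w" and t: "0 \<le> t"
  shows "norm (L (T t u)) \<le> exp (\<mu> * t) * norm (L u)"
proof -
  define f where "f s = exp (- 2 * \<mu> * s) * inner (L (T s u)) (L (T s u))" for s
  have "f t \<le> f 0"
  proof (rule nonincreasing_if_right_derivative_nonpos[OF _ _ t])
    have "continuous_on {0..} (\<lambda>s. T s u)" using T by (simp add: C0_semigroup_def)
    then show "continuous_on {0..} f"
      unfolding f_def by (intro continuous_intros bounded_linear.continuous_on[OF L])
  next
    fix s :: real assume s: "0 \<le> s"
    note o = orbit_right_derivative[OF T u s]
    let ?p = "L (T s u)" and ?q = "L (T s w)"
    have "((\<lambda>s. L (T s u)) has_vector_derivative ?q) (at s within {s<..})"
      by (rule bounded_linear.has_vector_derivative[OF L o(2)])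
    from bounded_bilinear.has_vector_derivative[OF bounded_bilinear_inner this this]
    have "((\<lambda>s. inner (L (T s u)) (L (T s u))) has_real_derivative 2 * inner ?p ?q) (at s within {s<..})"
      by (simp add: has_real_derivative_iff_has_vector_derivative inner_commute)
    then have "(f has_real_derivative exp (- 2 * \<mu> * s) * (2 * inner ?p ?q - 2 * \<mu> * inner ?p ?p)) (at s within {s<..})"
      unfolding f_def by (auto intro!: derivative_eq_intros simp: algebra_simps)
    moreover have "exp (- 2 * \<mu> * s) * (2 * inner ?p ?q - 2 * \<mu> * inner ?p ?p) \<le> 0"
      using diss[OF o(1)] by (simp add: mult_le_0_iff power2_norm_eq_inner)
    ultimately show "\<exists>D\<le>0. (f has_real_derivative D) (at s within {s<..})" by blast
  qed
  moreover have "T 0 u = u" using T by (simp add: C0_semigroup_def)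
  ultimately have "exp (- 2 * \<mu> * t) * (norm (L (T t u)))\<^sup>2 \<le> (norm (L u))\<^sup>2"
    by (simp add: f_def power2_norm_eq_inner)
  then have "exp (2 * \<mu> * t) * (exp (- 2 * \<mu> * t) * (norm (L (T t u)))\<^sup>2) \<le> exp (2 * \<mu> * t) * (norm (L u))\<^sup>2"
    by (intro mult_left_mono) auto
  then have "(norm (L (T t u)))\<^sup>2 \<le> (exp (\<mu> * t) * norm (L u))\<^sup>2"
    by (simp add: mult.assoc[symmetric] exp_add[symmetric] power_mult_distrib exp_double[symmetric])
  then show ?thesis by (rule power2_le_imp_le) simp
qed

section \<open>Bounded operators and the inverse of the phase operator\<close>

text \<open>A selfadjoint operator is closed, and boundedness makes the values along any sequence
  converging to a given point a Cauchy sequence.\<close>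

lemma bounded_selfadjoint_total:
  assumes sa: "selfadjoint T" and bd: "bounded_op T"
  obtains f where "T = (\<lambda>x. Some (f x))" "bounded_clinear f" "symmetric_map f"
proof -
  have lin: "linear_op T" using sa by (simp add: selfadjoint_def)
  note l = linear_opD[OF lin]
  obtain b where b: "\<And>x. x \<in> dom T \<Longrightarrow> norm (the (T x)) \<le> b * norm x"
    using bd unfolding bounded_op_def by blast
  \<comment> \<open>a bound one can divide by; the given one need not be positive\<close>
  define c where "c = \<bar>b\<bar> + 1"
  have bc: "b \<le> c" unfolding c_def by linarith
  have c: "c > 0" "\<And>x. x \<in> dom T \<Longrightarrow> norm (the (T x)) \<le> c * norm x"
  proof -
    show "norm (the (T x)) \<le> c * norm x" if "x \<in> dom T" for x
      using b[OF that] mult_right_mono[OF bc norm_ge_zero[of x]] by linarith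
  qed (simp add: c_def)
  have total: "x \<in> dom T" for x
  proof -
    have "x \<in> closure (dom T)" using sa by (simp add: selfadjoint_def)
    then obtain X where X: "\<And>n. X n \<in> dom T" "X \<longlonglongrightarrow> x" unfolding closure_sequential by blast
    have "Cauchy (\<lambda>n. the (T (X n)))"
    proof (rule metric_CauchyI)
      fix e :: real assume e: "0 < e"
      have "Cauchy X" using X(2) by (rule LIMSEQ_imp_Cauchy)
      then obtain K where K: "\<And>m n. m \<ge> K \<Longrightarrow> n \<ge> K \<Longrightarrow> dist (X m) (X n) < e / c"
        using metric_CauchyD[of X "e / c"] c(1) e by auto
      have "dist (the (T (X m))) (the (T (X n))) < e" if "m \<ge> K" "n \<ge> K" for m n
      proof -
        have n: "- X n \<in> dom T" "the (T (- X n)) = - the (T (X n))"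
          using l(4,5)[OF X(1)[of n], of "-1"] by simp_all
        have "X m - X n \<in> dom T" "the (T (X m - X n)) = the (T (X m)) - the (T (X n))"
          using l(2)[OF X(1)[of m] n(1)] l(3)[OF X(1)[of m] n(1)] n(2) by simp_all
        then have "dist (the (T (X m))) (the (T (X n))) \<le> c * dist (X m) (X n)"
          using c(2)[of "X m - X n"] by (simp add: dist_norm)
        also have "\<dots> < e" using K[OF that] c(1) by (simp add: field_simps)
        finally show ?thesis .
      qed
      then show "\<exists>K. \<forall>m\<ge>K. \<forall>n\<ge>K. dist (the (T (X m))) (the (T (X n))) < e" by blast
    qed
    then obtain y where "(\<lambda>n. the (T (X n))) \<longlonglongrightarrow> y" using Cauchy_convergent convergent_def by blast
    from selfadjoint_closed[OF sa X this] show ?thesis by auto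
  qed
  define f where "f x = the (T x)" for x
  show ?thesis
  proof (rule that[of f])
    show "T = (\<lambda>x. Some (f x))" unfolding f_def using total by (auto simp: fun_eq_iff domD)
    show "bounded_clinear f"
      unfolding f_def by (rule bounded_clinearI[OF _ _ c(2)]) (use l total in auto)
    show "symmetric_map f"
      unfolding f_def symmetric_map_def using selfadjoint_symmetric[OF sa] total by simp
  qed
qed

lemma bounded_posdef_total:
  assumes "posdef_op T" "bounded_op T"
  obtains f and c :: real where "T = (\<lambda>x. Some (f x))" "bounded_clinear f" "symmetric_map f"
    "c > 0" "\<And>x. c * (norm x)\<^sup>2 \<le> inner x (f x)"
proof -
  obtain f where f: "T = (\<lambda>x. Some (f x))" "bounded_clinear f" "symmetric_map f"
    by (rule bounded_selfadjoint_total[OF _ assms(2)]) (use assms(1) posdef_op_def in auto)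
  from assms(1) obtain c where "c > 0" "\<And>x. x \<in> dom T \<Longrightarrow> c * (norm x)\<^sup>2 \<le> inner x (the (T x))"
    unfolding posdef_op_def inner_eq_Re_cinner by auto
  then show ?thesis using that[OF f, of c] f(1) by auto
qed

lemma bounded_posdef_sqrt:
  assumes pd: "posdef_op M" and M: "M = (\<lambda>x. Some (m x))" "bounded_clinear m"
  obtains N Ni where "op_sqrt M = (\<lambda>x. Some (N x))" "bounded_clinear N" "symmetric_map N"
    "bounded_clinear Ni" "\<And>x. N (Ni x) = x" "\<And>x. Ni (N x) = x" "\<And>x. N (N x) = m x"
proof -
  obtain Ni where Ni: "bounded_clinear Ni" "symmetric_map Ni" "inverts (op_sqrt M) Ni" "inverts M (\<lambda>x. Ni (Ni x))"
    by (rule posdef_op_sqrt_inverse[OF pd])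
  have mi: "Ni (Ni (m x)) = x" for x
  proof -
    have "M x = Some (m x) \<longleftrightarrow> Ni (Ni (m x)) = x" using Ni(4) unfolding inverts_def by blast
    then show ?thesis by (simp add: M(1))
  qed
  define N where "N x = the (op_sqrt M x)" for x
  have i: "op_sqrt M x = Some y \<longleftrightarrow> Ni y = x" for x y using Ni(3) by (simp add: inverts_def)
  have S: "op_sqrt M x = Some (N x)" for x
    unfolding N_def using i[of x "Ni (m x)"] mi by auto
  have 1: "Ni (N x) = x" for x using i S by blast
  have 2: "N (Ni x) = x" for x using i[of "Ni x" x] S[of "Ni x"] by simp
  have inj: "x = y" if "Ni x = Ni y" for x y using that 2 by metis
  have sym: "inner (N x) y = inner x (N y)" for x y
    using Ni(2) unfolding symmetric_map_def by (metis 1)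
  have NN: "N (N x) = m x" for x by (rule inj, rule inj) (simp add: 1 mi)
  interpret m: bounded_linear m using M(2) by (rule bounded_clinear_linear)
  obtain b where b: "\<And>x. norm (m x) \<le> norm x * b" "b > 0" using m.pos_bounded by blast
  have bd: "norm (N x) \<le> sqrt b * norm x" for x
  proof -
    have "inner (N x) (N x) = inner x (m x)" by (simp add: sym NN)
    also have "\<dots> \<le> norm x * norm (m x)" by (rule norm_cauchy_schwarz)
    also have "\<dots> \<le> norm x * (norm x * b)" by (intro mult_left_mono b) simp
    also have "\<dots> = (sqrt b * norm x)\<^sup>2" using b(2) by (simp add: power_mult_distrib power2_eq_square)
    finally have "(norm (N x))\<^sup>2 \<le> (sqrt b * norm x)\<^sup>2" by (simp add: power2_norm_eq_inner)
    then show ?thesis by (rule power2_le_imp_le) (use b in simp)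
  qed
  have Nl: "bounded_clinear N"
  proof (rule bounded_clinearI[OF _ _ bd])
    show "N (x + y) = N x + N y" for x y
      by (rule inj) (simp add: 1 linear_add[OF bounded_linear.linear[OF bounded_clinear_linear[OF Ni(1)]]])
    show "N (a *\<^sub>C x) = a *\<^sub>C N x" for a x
      by (rule inj) (use Ni(1) in \<open>simp add: 1 bounded_clinear_def\<close>)
  qed
  show ?thesis
    by (rule that[of N Ni]) (use S Nl sym Ni(1) 1 2 NN in \<open>auto simp: symmetric_map_def fun_eq_iff\<close>)
qed

text \<open>The inverse of the phase operator, where \<open>R = K\<^bsup>-1/2\<^esup>\<close> and \<open>N = M\<^bsup>1/2\<^esup>\<close>: solving
  \<open>K\<^bsup>1/2\<^esup> N\<^bsup>-1\<^esup> v = f\<close> and \<open>- N\<^bsup>-1\<^esup> (K\<^bsup>1/2\<^esup> u + C N\<^bsup>-1\<^esup> v) = g\<close> gives \<open>v = N R f\<close> and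
  \<open>u = - R (N g + C R f)\<close>.\<close>

definition phase_inv :: "('a::complex_hilbert \<Rightarrow> 'a) \<Rightarrow> ('a \<Rightarrow> 'a) \<Rightarrow> ('a \<Rightarrow> 'a) \<Rightarrow> 'a \<times> 'a \<Rightarrow> 'a \<times> 'a" where
  "phase_inv R N c p = (- R (N (snd p) + c (R (fst p))), N (R (fst p)))"

lemma phase_inv_bounded_clinear:
  assumes "bounded_clinear R" "bounded_clinear N" "bounded_clinear c"
  shows "bounded_clinear (phase_inv R N c)"
proof -
  note l = bounded_clinear_compose[OF assms(1)] bounded_clinear_compose[OF assms(2)] bounded_clinear_compose[OF assms(3)]
  show ?thesis
    unfolding phase_inv_def
    by (intro bounded_clinear_Pair bounded_clinear_uminus l bounded_clinear_add bounded_clinear_fst bounded_clinear_snd)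
qed

text \<open>The off-diagonal blocks are skew and cancel; only the damping term \<open>- (R f, C R f)\<close> remains.\<close>

lemma phase_inv_dissipative:
  assumes "symmetric_map R" "symmetric_map N" "\<And>s. 0 \<le> inner (R s) (c (R s))"
  shows "inner q (phase_inv R N c q) \<le> 0"
proof -
  obtain f g where q: "q = (f, g)" by (cases q)
  have R: "inner f (R x) = inner (R f) x" for x using assms(1) by (simp add: symmetric_map_def)
  have N: "inner g (N x) = inner (N g) x" for x using assms(2) by (simp add: symmetric_map_def)
  have "inner q (phase_inv R N c q) = - inner (R f) (c (R f))"
    by (simp add: q phase_inv_def R N inner_add_right inner_commute)
  then show ?thesis using assms(3)[of f] by simp
qed

lemma phase_inv_range:
  assumes R: "bounded_clinear R" and N: "\<And>x. N (Ni x) = x"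
  shows "range (phase_inv R N c) = range R \<times> N ` range R"
proof
  interpret bounded_linear R using R by (rule bounded_clinear_linear)
  have "phase_inv R N c q \<in> range R \<times> N ` range R" for q
    by (auto simp: phase_inv_def linear_neg[OF linear, symmetric])
  then show "range (phase_inv R N c) \<subseteq> range R \<times> N ` range R" by blast
  have "(R a, N (R b)) = phase_inv R N c (b, Ni (- a - c (R b)))" for a b
    by (simp add: phase_inv_def N linear_neg[OF linear])
  then show "range R \<times> N ` range R \<subseteq> range (phase_inv R N c)" by blast
qed

lemma phase_op_inverts:
  assumes M: "op_sqrt M = (\<lambda>x. Some (N x))" and N: "\<And>x. N (Ni x) = x" "\<And>x. Ni (N x) = x"
    and Ni: "bounded_clinear Ni" and C: "C = (\<lambda>x. Some (c x))"
    and R: "inverts (op_sqrt K) R" "bounded_clinear R"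
  shows "inverts (phase_op M C K) (phase_inv R N c)"
proof -
  interpret R: bounded_linear R using R(2) by (rule bounded_clinear_linear)
  interpret Ni: bounded_linear Ni using Ni by (rule bounded_clinear_linear)
  have "inverts (op_sqrt M) Ni" unfolding M inverts_def using N by auto
  then have inv: "op_inv (op_sqrt M) = (\<lambda>x. Some (Ni x))" by (rule op_inv_eq)
  have S: "op_sqrt K (R a) = Some a" for a using invertsD(1)[OF R(1)] .
  have dS: "dom (op_sqrt K) = range R" using invertsD(2)[OF R(1)] .
  have val: "phase_op M C K (R a, N (R b)) = Some (b, - Ni (a + c (R b)))" for a b
  proof -
    have "(R a, N (R b)) \<in> dom (op_sqrt K) \<times> (\<lambda>x. the (op_sqrt M x)) ` dom (op_sqrt K)"
      by (simp add: dS M)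
    then show ?thesis
      unfolding phase_op_def block_op_def
      by (simp add: inv C S N op_zero_def op_scale_def map_comp_def dom_def Ni.add)
  qed
  have dom: "dom (phase_op M C K) \<subseteq> range R \<times> N ` range R"
    unfolding phase_op_def dom_restrict by (auto simp: dS M)
  show ?thesis
    unfolding inverts_def
  proof (intro allI iffI)
    fix p q assume p: "phase_op M C K p = Some q"
    then obtain a b where ab: "p = (R a, N (R b))" using dom by blast
    then have q: "q = (b, Ni (- (a + c (R b))))"
      using p val[of a b] unfolding linear_neg[OF Ni.linear] by simp
    have "N (snd q) = - (a + c (R b))" "fst q = b"
      unfolding q by (simp_all only: snd_conv fst_conv N(1))
    then show "phase_inv R N c q = p" by (simp add: phase_inv_def ab R.add linear_neg[OF R.linear])
  next
    fix p q assume "phase_inv R N c q = p"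
    then have p: "p = (R (- (N (snd q) + c (R (fst q)))), N (R (fst q)))"
      unfolding phase_inv_def linear_neg[OF R.linear] by (rule sym)
    have "Ni (- (N (snd q) + c (R (fst q))) + c (R (fst q))) = - snd q"
      by (simp add: linear_neg[OF Ni.linear] N)
    then show "phase_op M C K p = Some q" unfolding p val by simp
  qed
qed

section \<open>The decay bound\<close>

lemma symmetric_cinner_real:
  assumes "bounded_clinear f" "symmetric_map f"
  shows "cinner x (f x) = complex_of_real (inner x (f x))"
proof -
  have "inner (\<i> *\<^sub>C x) (f x) = inner (\<i> *\<^sub>C f x) x"
    using assms(1) assms(2)[unfolded symmetric_map_def, rule_format, of "\<i> *\<^sub>C x" x]
    by (simp add: bounded_clinear_def)
  also have "\<dots> = inner (f x) ((- \<i>) *\<^sub>C x)" by (simp add: inner_scaleC_left)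
  also have "(- \<i>) *\<^sub>C x = - (\<i> *\<^sub>C x)"
    using scaleC_scaleC[of "-1" "\<i>" x] by simp
  finally have "Im (cinner x (f x)) = 0" by (simp add: Im_cinner inner_commute)
  then show ?thesis by (simp add: complex_eq_iff inner_eq_Re_cinner)
qed

text \<open>The real part of the root of \<open>a \<lambda>\<^sup>2 + b \<lambda> + k\<close> that lies furthest to the right.\<close>

definition decay_rate :: "real \<Rightarrow> real \<Rightarrow> real \<Rightarrow> real" where
  "decay_rate a b k = (- b + Re (csqrt (complex_of_real (b\<^sup>2 - 4 * a * k)))) / (2 * a)"

lemma Re_csqrt_real: "0 \<le> Re (csqrt (complex_of_real d))" "d \<le> (Re (csqrt (complex_of_real d)))\<^sup>2"
  "0 \<le> e \<Longrightarrow> d \<le> e\<^sup>2 \<Longrightarrow> Re (csqrt (complex_of_real d)) \<le> e"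
proof -
  have e: "Re (csqrt (complex_of_real d)) = sqrt ((\<bar>d\<bar> + d) / 2)" by simp
  show "0 \<le> Re (csqrt (complex_of_real d))" unfolding e by simp
  show "d \<le> (Re (csqrt (complex_of_real d)))\<^sup>2" unfolding e by simp
  show "Re (csqrt (complex_of_real d)) \<le> e" if "0 \<le> e" "d \<le> e\<^sup>2" for e
    unfolding e by (rule real_le_lsqrt) (use that in \<open>auto simp: abs_if\<close>)
qed

lemma decay_rate_nonpos:
  assumes "a > 0" "b \<ge> 0" "k \<ge> 0"
  shows "decay_rate a b k \<le> 0"
proof -
  have "Re (csqrt (complex_of_real (b\<^sup>2 - 4 * a * k))) \<le> b"
    by (rule Re_csqrt_real(3)) (use assms in auto)
  then show ?thesis using assms(1) by (simp add: decay_rate_def divide_le_0_iff)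
qed

text \<open>With \<open>d\<close> the discriminant and \<open>r\<close> the real part of its square root, the quadratic equals
  \<open>((2 a \<mu> + b)\<^sup>2 - d) / (4 a)\<close> at \<open>\<mu>\<close>, and \<open>d \<le> r\<^sup>2\<close> whether the roots are real or not.\<close>

lemma quadratic_above_decay_rate:
  assumes a: "a > 0" and g: "decay_rate a b k \<le> g" and m: "g \<le> \<mu>"
  shows "a * (\<mu> - g)\<^sup>2 \<le> \<mu>\<^sup>2 * a + \<mu> * b + k" "0 \<le> 2 * \<mu> * a + b"
proof -
  define d where "d = b\<^sup>2 - 4 * a * k"
  define r where "r = Re (csqrt (complex_of_real d))"
  have r: "0 \<le> r" "d \<le> r\<^sup>2" using Re_csqrt_real by (simp_all add: r_def)
  have rg: "r \<le> 2 * a * g + b"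
  proof -
    have "(- b + r) / (2 * a) \<le> g" using g unfolding decay_rate_def r_def d_def .
    then have "- b + r \<le> g * (2 * a)" by (subst (asm) pos_divide_le_eq) (use a in auto)
    then show ?thesis by (simp add: mult_ac)
  qed
  define e where "e = 2 * a * (\<mu> - g)"
  have e: "0 \<le> e" using a m by (simp add: e_def)
  have p: "e + r \<le> 2 * a * \<mu> + b" using rg by (simp add: e_def algebra_simps)
  show "0 \<le> 2 * \<mu> * a + b" using p e r(1) by (simp add: algebra_simps)
  have "e\<^sup>2 + r\<^sup>2 \<le> (e + r)\<^sup>2" using e r(1) by (simp add: power2_sum)
  also have "\<dots> \<le> (2 * a * \<mu> + b)\<^sup>2" using p e r(1) by (intro power_mono) auto
  finally have "e\<^sup>2 + d \<le> (2 * a * \<mu> + b)\<^sup>2" using r(2) by linarith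
  moreover have "4 * a * (a * (\<mu> - g)\<^sup>2) = e\<^sup>2"
    unfolding e_def by (simp add: power_mult_distrib power2_eq_square[of a])
  moreover have "4 * a * (\<mu>\<^sup>2 * a + \<mu> * b + k) = (2 * a * \<mu> + b)\<^sup>2 - d"
    unfolding d_def power2_eq_square by (simp add: algebra_simps)
  ultimately have "4 * a * (a * (\<mu> - g)\<^sup>2) \<le> 4 * a * (\<mu>\<^sup>2 * a + \<mu> * b + k)"
    by linarith
  then show "a * (\<mu> - g)\<^sup>2 \<le> \<mu>\<^sup>2 * a + \<mu> * b + k"
    by (rule mult_left_le_imp_le) (use a in simp)
qed

text \<open>The supremum defining the decay bound runs over a set that is bounded above by \<open>0\<close>, so it
  dominates each of its members.\<close>

lemma decay_rate_le_decay_bound: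
  assumes M: "M = (\<lambda>x. Some (m x))" "bounded_clinear m" "symmetric_map m" "\<And>x. x \<noteq> 0 \<Longrightarrow> 0 < inner x (m x)"
    and C: "C = (\<lambda>x. Some (c x))" "bounded_clinear c" "symmetric_map c" "\<And>x. 0 \<le> inner x (c x)"
    and R: "inverts (op_sqrt K) R" and s: "R s \<noteq> 0"
  shows "decay_rate (inner (R s) (m (R s))) (inner (R s) (c (R s))) ((norm s)\<^sup>2) \<le> decay_bound M C K"
proof -
  let ?f = "\<lambda>x. Re ((- cinner x (the (C x))
             + csqrt ((cinner x (the (C x)))\<^sup>2
                 - 4 * cinner x (the (M x)) * complex_of_real ((norm (the (op_sqrt K x)))\<^sup>2)))
            / (2 * cinner x (the (M x))))"
  have f: "?f x = decay_rate (inner x (m x)) (inner x (c x)) ((norm (the (op_sqrt K x)))\<^sup>2)" for x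
  proof -
    define a b k where "a = inner x (m x)" "b = inner x (c x)" "k = (norm (the (op_sqrt K x)))\<^sup>2"
    have "?f x = Re ((- complex_of_real b + csqrt ((complex_of_real b)\<^sup>2 - 4 * complex_of_real a * complex_of_real k)) / (2 * complex_of_real a))"
      by (simp only: M(1) C(1) option.sel symmetric_cinner_real[OF M(2,3)] symmetric_cinner_real[OF C(2,3)] a_b_k_def)
    also have "\<dots> = Re ((- complex_of_real b + csqrt (complex_of_real (b\<^sup>2 - 4 * a * k))) / complex_of_real (2 * a))"
      by simp
    also have "\<dots> = decay_rate a b k" unfolding Re_divide_of_real decay_rate_def by simp
    finally show ?thesis unfolding a_b_k_def .
  qed
  have bdd: "bdd_above (?f ` (dom (op_sqrt K) - {0}))"
    unfolding f by (rule bdd_aboveI2[where M=0]) (use M(4) C(4) in \<open>auto intro!: decay_rate_nonpos\<close>)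
  have "R s \<in> dom (op_sqrt K) - {0}" using s invertsD(2)[OF R] by auto
  from cSUP_upper[OF this bdd] have "?f (R s) \<le> decay_bound M C K"
    unfolding decay_bound_def .
  then show ?thesis unfolding f using invertsD(1)[OF R, of s] by simp
qed

section \<open>The shifted stiffness operator\<close>

text \<open>A form of the factorisation lemma of Douglas: \<open>R U = T V\<close> writes \<open>T y\<close> as a value of \<open>R\<close> for the
  vectors \<open>y\<close> in the range of \<open>V\<close>, and the norm bound lets this pass to limits. It yields
  \<open>K\<^bsup>1/2\<^esup> K(\<mu>)\<^bsup>-1/2\<^esup>\<close> as an everywhere defined bounded operator.\<close>

lemma douglas_factor:
  fixes R T U V :: "'a::complex_hilbert \<Rightarrow> 'a"
  assumes R: "bounded_clinear R" "inj R" and T: "bounded_clinear T"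
    and U: "bounded_clinear U" and V: "bounded_clinear V"
    and eq: "\<And>w. R (U w) = T (V w)" and le: "\<And>w. norm (U w) \<le> b * norm (V w)"
    and dense: "closure (range V) = UNIV"
  obtains Q where "bounded_clinear Q" "\<And>y. R (Q y) = T y"
proof -
  note lR = bounded_clinear_linear[OF R(1)] and lT = bounded_clinear_linear[OF T]
  note lU = bounded_linear.linear[OF bounded_clinear_linear[OF U]]
  note lV = bounded_linear.linear[OF bounded_clinear_linear[OF V]]
  have "\<exists>s. R s = T y \<and> norm s \<le> b * norm y" for y
  proof -
    have "y \<in> closure (range V)" using dense by simp
    then obtain Y where Y: "\<forall>n. Y n \<in> range V" "Y \<longlonglongrightarrow> y" unfolding closure_sequential by blast
    then have "\<forall>n. \<exists>w. Y n = V w" by blast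
    from choice[OF this] obtain W where W: "\<And>n. Y n = V (W n)" by blast
    \<comment> \<open>a bound one can divide by; the given one need not be positive\<close>
    define c where "c = \<bar>b\<bar> + 1"
    have bc: "b \<le> c" "c > 0" unfolding c_def by linarith+
    have c: "c > 0" "norm (U w) \<le> c * norm (V w)" for w
      using bc(2) le[of w] mult_right_mono[OF bc(1) norm_ge_zero[of "V w"]] by linarith+
    have "Cauchy (\<lambda>n. U (W n))"
    proof (rule metric_CauchyI)
      fix e :: real assume e: "0 < e"
      have "Cauchy Y" using Y(2) by (rule LIMSEQ_imp_Cauchy)
      then obtain K where K: "\<And>m n. m \<ge> K \<Longrightarrow> n \<ge> K \<Longrightarrow> dist (Y m) (Y n) < e / c"
        using metric_CauchyD[of Y "e / c"] c(1) e by auto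
      have "dist (U (W m)) (U (W n)) < e" if "m \<ge> K" "n \<ge> K" for m n
      proof -
        have "dist (U (W m)) (U (W n)) \<le> c * dist (Y m) (Y n)"
          using c(2)[of "W m - W n"] by (simp add: dist_norm W linear_diff[OF lU] linear_diff[OF lV])
        also have "\<dots> < e" using K[OF that] c(1) by (simp add: field_simps)
        finally show ?thesis .
      qed
      then show "\<exists>K. \<forall>m\<ge>K. \<forall>n\<ge>K. dist (U (W m)) (U (W n)) < e" by blast
    qed
    then obtain s where s: "(\<lambda>n. U (W n)) \<longlonglongrightarrow> s" using Cauchy_convergent convergent_def by blast
    have "(\<lambda>n. R (U (W n))) \<longlonglongrightarrow> R s" by (rule bounded_linear.tendsto[OF lR s])
    moreover have "(\<lambda>n. T (Y n)) \<longlonglongrightarrow> T y" by (rule bounded_linear.tendsto[OF lT Y(2)])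
    ultimately have "R s = T y" by (simp add: eq W[symmetric] LIMSEQ_unique)
    moreover have "norm s \<le> b * norm y"
      by (rule LIMSEQ_le[OF tendsto_norm[OF s] tendsto_mult[OF tendsto_const tendsto_norm[OF Y(2)]]])
        (simp add: W le)
    ultimately show ?thesis by blast
  qed
  then have "\<forall>y. \<exists>s. R s = T y \<and> norm s \<le> b * norm y" by blast
  from choice[OF this] obtain Q where Q: "\<And>y. R (Q y) = T y" "\<And>y. norm (Q y) \<le> b * norm y" by blast
  have "bounded_clinear Q"
  proof (rule bounded_clinearI[OF _ _ Q(2)])
    show "Q (x + y) = Q x + Q y" for x y
      by (rule injD[OF R(2)])
        (simp add: Q(1) linear_add[OF bounded_linear.linear[OF lR]] linear_add[OF bounded_linear.linear[OF lT]])
    show "Q (a *\<^sub>C x) = a *\<^sub>C Q x" for a x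
      by (rule injD[OF R(2)]) (use R(1) T in \<open>simp add: Q(1) bounded_clinear_def\<close>)
  qed
  then show ?thesis by (rule that) (rule Q(1))
qed

text \<open>With \<open>R = K\<^bsup>-1/2\<^esup>\<close> one has \<open>K + F = R\<^bsup>-1\<^esup> (I + R F R) R\<^bsup>-1\<^esup>\<close>, where the middle factor is bounded and
  coercive. Its inverse \<open>V\<close> gives the bounded inverse \<open>R V R\<close> of \<open>K + F\<close>.\<close>

lemma shifted_inverse:
  assumes R: "bounded_clinear R" "symmetric_map R" "inverts K (\<lambda>x. R (R x))"
    and F: "bounded_clinear F" "symmetric_map F"
    and d: "d > 0" "\<And>s. d * (norm s)\<^sup>2 \<le> (norm s)\<^sup>2 + inner (R s) (F (R s))"
    and K': "\<And>x. K' x = (case K x of None \<Rightarrow> None | Some y \<Rightarrow> Some (F x + y))"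
  obtains V where "bounded_clinear V" "\<And>x. V x + R (F (R (V x))) = x" "\<And>x. V (x + R (F (R x))) = x"
    "inverts K' (\<lambda>y. R (V (R y)))" "posdef_op K'"
proof -
  interpret R: bounded_linear R using R(1) by (rule bounded_clinear_linear)
  interpret F: bounded_linear F using F(1) by (rule bounded_clinear_linear)
  have W: "bounded_clinear (\<lambda>x. x + R (F (R x)))"
    by (intro bounded_clinear_add bounded_clinear_ident bounded_clinear_compose[OF R(1)]
        bounded_clinear_compose[OF F(1)] R(1))
  have WRF: "inner s (s + R (F (R s))) = (norm s)\<^sup>2 + inner (R s) (F (R s))" for s
    using R(2) by (simp add: inner_add_right symmetric_map_def power2_norm_eq_inner)
  have co: "d * (norm s)\<^sup>2 \<le> inner s (s + R (F (R s)))" for s using d(2) WRF by simp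
  obtain V where V: "bounded_clinear V" "\<And>x. V x + R (F (R (V x))) = x" "\<And>x. V (x + R (F (R x))) = x"
    by (rule coercive_inverse[OF W d(1) co]) (rule that; assumption)
  have symW: "inner (x + R (F (R x))) y = inner x (y + R (F (R y)))" for x y
    using R(2) F(2) by (simp add: inner_add_left inner_add_right symmetric_map_def)
  have symV: "inner (V x) y = inner x (V y)" for x y
    using symW[of "V x" "V y"] by (simp add: V(2))
  have inv: "inverts K' (\<lambda>y. R (V (R y)))"
    unfolding inverts_def
  proof (intro allI iffI)
    fix x y assume "K' x = Some y"
    then obtain k where k: "K x = Some k" "y = F x + k" unfolding K' by (auto split: option.splits)
    have x: "R (R k) = x" using k(1) R(3) by (simp add: inverts_def)
    have "R y = R k + R (F (R (R k)))" by (simp add: k(2) R.add x)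
    then show "R (V (R y)) = x" using V(3)[of "R k"] by (simp add: x)
  next
    fix x y assume x: "R (V (R y)) = x"
    define k where "k = y - F x"
    have "R k = V (R y)" using V(2)[of "R y"] by (simp add: k_def R.diff x algebra_simps)
    then have "K x = Some k" using R(3) x by (simp add: inverts_def)
    then show "K' x = Some y" unfolding K' by (simp add: k_def)
  qed
  have G: "bounded_clinear (\<lambda>y. R (V (R y)))"
    by (intro bounded_clinear_compose[OF R(1)] bounded_clinear_compose[OF V(1)] R(1))
  have symG: "symmetric_map (\<lambda>y. R (V (R y)))"
    using R(2) symV by (simp add: symmetric_map_def)
  obtain b where b: "b > 0" "\<And>s. norm (R s) \<le> norm s * b" using R.pos_bounded by blast
  have "d / b\<^sup>2 * (norm (R (V (R y))))\<^sup>2 \<le> inner (R (V (R y))) y" for y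
  proof -
    let ?s = "V (R y)"
    have "(norm (R ?s))\<^sup>2 \<le> (norm ?s * b)\<^sup>2" by (intro power_mono b) simp
    then have "d / b\<^sup>2 * (norm (R ?s))\<^sup>2 \<le> d / b\<^sup>2 * (norm ?s * b)\<^sup>2"
      using d(1) by (intro mult_left_mono) auto
    also have "\<dots> = d * (norm ?s)\<^sup>2" using b(1) by (simp add: power_mult_distrib)
    also have "\<dots> \<le> inner ?s (R y)" using co[of ?s] unfolding V(2) .
    also have "\<dots> = inner (R ?s) y" using R(2) by (simp add: symmetric_map_def)
    finally show ?thesis .
  qed
  then have "\<forall>x\<in>dom K'. d / b\<^sup>2 * (norm x)\<^sup>2 \<le> Re (cinner x (the (K' x)))"
    unfolding invertsD(2)[OF inv] by (auto simp: invertsD(1)[OF inv] inner_eq_Re_cinner[symmetric])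
  moreover have "d / b\<^sup>2 > 0" using d(1) b(1) by simp
  ultimately have "posdef_op K'"
    unfolding posdef_op_def using selfadjoint_if_inverts[OF inv G symG] by blast
  then show ?thesis by (rule that[OF V inv])
qed

text \<open>The maps \<open>R\<close> and \<open>R'\<close> stand for \<open>K\<^bsup>-1/2\<^esup>\<close> and \<open>K(\<mu>)\<^bsup>-1/2\<^esup>\<close>. From
  \<open>\<parallel>R' w\<parallel>\<^sup>2 = (V R w, (I + R F R) V R w)\<close> and the upper and lower bounds of \<open>I + R F R\<close>, the norms of \<open>R' w\<close>
  and \<open>V R w\<close> are equivalent, and \<open>R' R' = R (V R)\<close> can be factorised in both directions. In
  particular \<open>R\<close> and \<open>R'\<close> have the same range: the two square roots have the same domain.\<close>

lemma shifted_sqrt_factors: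
  assumes R: "bounded_clinear R" "symmetric_map R" "inj R" and R': "bounded_clinear R'" "symmetric_map R'" "inj R'"
    and F: "bounded_clinear F"
    and d: "d > 0" "\<And>s. d * (norm s)\<^sup>2 \<le> (norm s)\<^sup>2 + inner (R s) (F (R s))"
    and V: "bounded_clinear V" "\<And>x. V x + R (F (R (V x))) = x" "\<And>x. V (x + R (F (R x))) = x"
    and RVR: "\<And>y. R' (R' y) = R (V (R y))"
  obtains P Q where "bounded_clinear P" "bounded_clinear Q" "\<And>y. R' (P y) = R y" "\<And>y. R (Q y) = R' y"
proof -
  have VR: "bounded_clinear (\<lambda>w. V (R w))" by (rule bounded_clinear_compose[OF V(1) R(1)])
  have nR': "(norm (R' w))\<^sup>2 = (norm (V (R w)))\<^sup>2 + inner (R (V (R w))) (F (R (V (R w))))" for w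
  proof -
    let ?s = "V (R w)"
    have "(norm (R' w))\<^sup>2 = inner w (R' (R' w))" using R'(2) by (simp add: power2_norm_eq_inner symmetric_map_def)
    also have "\<dots> = inner (R w) ?s" using R(2) by (simp add: RVR symmetric_map_def)
    also have "\<dots> = inner ?s (?s + R (F (R ?s)))" unfolding V(2) by (rule inner_commute)
    also have "\<dots> = (norm ?s)\<^sup>2 + inner (R ?s) (F (R ?s))"
      by (simp only: inner_add_right power2_norm_eq_inner R(2)[unfolded symmetric_map_def, rule_format])
    finally show ?thesis .
  qed
  have le1: "norm (V (R w)) \<le> (1 / sqrt d) * norm (R' w)" for w
  proof -
    have "(sqrt d * norm (V (R w)))\<^sup>2 \<le> (norm (R' w))\<^sup>2"
      using d(2)[of "V (R w)"] d(1) by (simp add: nR' power_mult_distrib)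
    then have "sqrt d * norm (V (R w)) \<le> norm (R' w)" by (rule power2_le_imp_le) simp
    then show ?thesis using d(1) by (simp add: field_simps)
  qed
  obtain Q where Q: "bounded_clinear Q" "\<And>y. R (Q y) = R' y"
    by (rule douglas_factor[OF R(1,3) R'(1) VR R'(1) RVR[symmetric] le1
          dense_range_of_symmetric_inj[OF bounded_clinear_linear[OF R'(1)] R'(2,3)]])
      (rule that; assumption)
  have "bounded_clinear (\<lambda>s. R (F (R s)))"
    by (intro bounded_clinear_compose[OF R(1)] bounded_clinear_compose[OF F] R(1))
  then obtain e where e: "e > 0" "\<And>s. norm (R (F (R s))) \<le> norm s * e"
    using bounded_linear.pos_bounded[OF bounded_clinear_linear] by blast
  have le2: "norm (R' w) \<le> sqrt (1 + e) * norm (V (R w))" for w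
  proof -
    let ?s = "V (R w)"
    have "inner (R ?s) (F (R ?s)) = inner ?s (R (F (R ?s)))" using R(2) by (simp add: symmetric_map_def)
    also have "\<dots> \<le> norm ?s * norm (R (F (R ?s)))" by (rule norm_cauchy_schwarz)
    also have "\<dots> \<le> norm ?s * (norm ?s * e)" by (intro mult_left_mono e) simp
    finally have "inner (R ?s) (F (R ?s)) \<le> e * (norm ?s)\<^sup>2" by (simp add: power2_eq_square mult_ac)
    moreover have "(sqrt (1 + e) * norm ?s)\<^sup>2 = (norm ?s)\<^sup>2 + e * (norm ?s)\<^sup>2"
      using e(1) by (simp add: power_mult_distrib distrib_right)
    ultimately have "(norm (R' w))\<^sup>2 \<le> (sqrt (1 + e) * norm ?s)\<^sup>2" unfolding nR' by linarith
    then show ?thesis by (rule power2_le_imp_le) (use e(1) in simp)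
  qed
  have dVR: "closure (range (\<lambda>w. V (R w))) = UNIV"
  proof -
    have "V ` closure (range R) \<subseteq> closure (range (\<lambda>w. V (R w)))"
      by (rule image_closure_subset)
        (use closure_subset[of "range (\<lambda>w. V (R w))"] in \<open>auto intro!: bounded_linear.continuous_on[OF bounded_clinear_linear[OF V(1)]]\<close>)
    moreover have "V ` UNIV = UNIV" by (rule surjI[where f="\<lambda>x. x + R (F (R x))"]) (rule V(3))
    ultimately have "UNIV \<subseteq> closure (range (\<lambda>w. V (R w)))"
      using dense_range_of_symmetric_inj[OF bounded_clinear_linear[OF R(1)] R(2,3)] by simp
    then show ?thesis by blast
  qed
  obtain P where P: "bounded_clinear P" "\<And>y. R' (P y) = R y"
    by (rule douglas_factor[OF R'(1,3) R(1) R'(1) VR RVR le2 dVR])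
      (rule that; assumption)
  show ?thesis using that[OF P(1) Q(1) P(2) Q(2)] .
qed

section \<open>The similarity transformation\<close>

lemma bounded_op_total: "bounded_clinear f \<Longrightarrow> bounded_op (\<lambda>x. Some (f x))"
proof -
  assume f: "bounded_clinear f"
  interpret bounded_linear f using f by (rule bounded_clinear_linear)
  have "\<exists>b. \<forall>x. norm (f x) \<le> b * norm x" using bounded by (auto simp: mult.commute)
  moreover have "linear_op (\<lambda>x. Some (f x))"
    using f by (simp add: linear_op_def add bounded_clinear_def domI)
  ultimately show "bounded_op (\<lambda>x. Some (f x))" by (auto simp: bounded_op_def)
qed

text \<open>The bounded maps behind the theorem: \<open>R = K\<^bsup>-1/2\<^esup>\<close>, \<open>R' = K(\<mu>)\<^bsup>-1/2\<^esup>\<close>, \<open>P = K(\<mu>)\<^bsup>1/2\<^esup> K\<^bsup>-1/2\<^esup>\<close>,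
  \<open>Q = K\<^bsup>1/2\<^esup> K(\<mu>)\<^bsup>-1/2\<^esup>\<close>, \<open>N = M\<^bsup>1/2\<^esup>\<close> and \<open>Ni\<close> its inverse. The condition \<open>shift\<close> is the identity
  \<open>K(\<mu>) = K + \<mu>\<^sup>2 M + \<mu> C\<close> on the domain of \<open>K\<close>, written with the inverses, and \<open>nonneg\<close> says that the
  form of \<open>C(\<mu>) = 2 \<mu> M + C\<close> is nonnegative on the common domain of the square roots.\<close>

locale shifted_phase =
  fixes R R' P Q N Ni m c :: "'a::complex_hilbert \<Rightarrow> 'a" and \<mu> :: real
  assumes clin: "bounded_clinear R" "bounded_clinear R'" "bounded_clinear P" "bounded_clinear Q"
      "bounded_clinear N" "bounded_clinear m" "bounded_clinear c"
    and sym: "symmetric_map R'" "symmetric_map N"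
    and inj: "inj R" "inj R'"
    and factor: "\<And>y. R' (P y) = R y" "\<And>y. R (Q y) = R' y"
    and N: "\<And>x. N (Ni x) = x" "\<And>x. Ni (N x) = x" "\<And>x. N (N x) = m x"
    and shift: "\<And>y s. R' (R' y) = R s \<longleftrightarrow> R y = s + R (\<mu>\<^sup>2 *\<^sub>R m (R s) + \<mu> *\<^sub>R c (R s))"
    and nonneg: "\<And>s. 0 \<le> inner (R' s) ((2 * \<mu>) *\<^sub>R m (R' s) + c (R' s))"
begin

interpretation R: bounded_linear R using clin(1) by (rule bounded_clinear_linear)
interpretation R': bounded_linear R' using clin(2) by (rule bounded_clinear_linear)
interpretation N: bounded_linear N using clin(5) by (rule bounded_clinear_linear)
interpretation m: bounded_linear m using clin(6) by (rule bounded_clinear_linear)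
interpretation c: bounded_linear c using clin(7) by (rule bounded_clinear_linear)

definition c' :: "'a \<Rightarrow> 'a" where "c' x = (2 * \<mu>) *\<^sub>R m x + c x"
definition L :: "'a \<times> 'a \<Rightarrow> 'a \<times> 'a" where
  "L p = (Q (fst p), \<mu> *\<^sub>R N (R' (fst p)) + snd p)"
definition Li :: "'a \<times> 'a \<Rightarrow> 'a \<times> 'a" where
  "Li p = (P (fst p), snd p + (- \<mu>) *\<^sub>R N (R (fst p)))"

abbreviation "B \<equiv> phase_inv R N c"
abbreviation "B' \<equiv> phase_inv R' N c'"

lemma PQ: "P (Q y) = y" "Q (P y) = y"
proof -
  show "P (Q y) = y" by (rule injD[OF inj(2)]) (simp add: factor)
  show "Q (P y) = y" by (rule injD[OF inj(1)]) (simp add: factor)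
qed

lemma L_inverse: "L (Li p) = p" "Li (L p) = p"
  by (simp_all add: L_def Li_def PQ factor prod_eq_iff)

lemma L_clin: "bounded_clinear L"
  unfolding L_def
  by (intro bounded_clinear_Pair bounded_clinear_compose[OF clin(4)] bounded_clinear_compose[OF clin(5)]
      bounded_clinear_compose[OF clin(2)] bounded_clinear_add bounded_clinear_scaleR
      bounded_clinear_fst bounded_clinear_snd)

lemma Li_clin: "bounded_clinear Li"
  unfolding Li_def
  by (intro bounded_clinear_Pair bounded_clinear_compose[OF clin(3)] bounded_clinear_compose[OF clin(5)]
      bounded_clinear_compose[OF clin(1)] bounded_clinear_add bounded_clinear_scaleR
      bounded_clinear_fst bounded_clinear_snd)

text \<open>The identity \<open>L A' = (A - \<mu>) L\<close>, with \<open>A'\<close> the shifted phase operator, written as \<open>r = A' p\<close> if and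
  only if \<open>L r + \<mu> L p = A L p\<close> and then expressed by the inverses \<open>B\<close> and \<open>B'\<close>. As these are everywhere
  defined, the equivalence contains the equality of the domains of both sides.\<close>

lemma intertwine: "B (L (r + \<mu> *\<^sub>R p)) = L p \<longleftrightarrow> B' r = p"
proof -
  obtain f g u v where r: "r = (f, g)" and p: "p = (u, v)" by (cases r, cases p)
  define y where "y = N g + c' (R' f)"
  let ?x = "R' u"
  have dbl: "(2 * \<mu>) *\<^sub>R x = \<mu> *\<^sub>R x + \<mu> *\<^sub>R x" for x :: 'a
    by (simp add: scaleR_left_distrib[symmetric])
  have RQ: "R (Q (f + \<mu> *\<^sub>R u)) = R' f + \<mu> *\<^sub>R ?x" by (simp add: factor R'.add R'.scaleR)
  have 2: "snd (B (L (r + \<mu> *\<^sub>R p))) = snd (L p) \<longleftrightarrow> N (R' f) = v"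
    by (simp add: phase_inv_def L_def r p RQ N.add N.scaleR)
  have 1: "fst (B (L (r + \<mu> *\<^sub>R p))) = fst (L p) \<longleftrightarrow> - R' y = u" if v: "v = N (R' f)"
  proof -
    have "fst (B (L (r + \<mu> *\<^sub>R p)))
        = - R (N (\<mu> *\<^sub>R N (R' (f + \<mu> *\<^sub>R u)) + (g + \<mu> *\<^sub>R N (R' f))) + c (R' f + \<mu> *\<^sub>R ?x))"
      by (simp add: phase_inv_def L_def r p RQ v)
    also have "\<dots> = - R (y + (\<mu>\<^sup>2 *\<^sub>R m ?x + \<mu> *\<^sub>R c ?x))"
    proof -
      have "N (\<mu> *\<^sub>R N (R' (f + \<mu> *\<^sub>R u)) + (g + \<mu> *\<^sub>R N (R' f))) + c (R' f + \<mu> *\<^sub>R ?x)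
          = \<mu> *\<^sub>R m (R' f) + (\<mu> * \<mu>) *\<^sub>R m ?x + N g + \<mu> *\<^sub>R m (R' f) + c (R' f) + \<mu> *\<^sub>R c ?x"
        by (simp add: N.add N.scaleR N(3) R'.add R'.scaleR c.add c.scaleR scaleR_add_right)
      also have "\<dots> = y + (\<mu>\<^sup>2 *\<^sub>R m ?x + \<mu> *\<^sub>R c ?x)"
        unfolding y_def c'_def dbl power2_eq_square by (simp add: algebra_simps)
      finally show ?thesis by simp
    qed
    finally have "fst (B (L (r + \<mu> *\<^sub>R p))) = fst (L p)
        \<longleftrightarrow> - R (y + (\<mu>\<^sup>2 *\<^sub>R m ?x + \<mu> *\<^sub>R c ?x)) = Q u" by (simp add: L_def p)
    also have "\<dots> \<longleftrightarrow> R (- y) = Q u + R (\<mu>\<^sup>2 *\<^sub>R m (R (Q u)) + \<mu> *\<^sub>R c (R (Q u)))"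
      unfolding factor R.add linear_neg[OF R.linear] by (auto simp: algebra_simps eq_neg_iff_add_eq_0 neg_eq_iff_add_eq_0)
    also have "\<dots> \<longleftrightarrow> R' (R' (- y)) = R' u"
      unfolding factor(2)[of u, symmetric] by (rule shift[symmetric])
    also have "\<dots> \<longleftrightarrow> - R' y = u"
      by (simp only: linear_neg[OF R'.linear, of y, symmetric] inj_eq[OF inj(2)])
    finally show ?thesis .
  qed
  have "B' r = p \<longleftrightarrow> N (R' f) = v \<and> - R' y = u"
    by (auto simp: phase_inv_def r p y_def)
  then show ?thesis
    unfolding prod_eq_iff[of "B (L (r + \<mu> *\<^sub>R p))"] using 1 2 by blast
qed

lemma intertwine': "B (q + \<mu> *\<^sub>R L p) = L p \<longleftrightarrow> B' (Li q) = p"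
proof -
  interpret L: bounded_linear L using L_clin by (rule bounded_clinear_linear)
  have "L (Li q + \<mu> *\<^sub>R p) = q + \<mu> *\<^sub>R L p" by (simp add: L.add L.scaleR L_inverse)
  then show ?thesis using intertwine[of "Li q" p] by simp
qed

lemma range_B_eq: "range B' = range B"
proof -
  have "range R' = range R"
  proof (intro subset_antisym image_subsetI)
    show "R' y \<in> range R" for y unfolding factor(2)[symmetric] by (rule rangeI)
    show "R y \<in> range R'" for y unfolding factor(1)[symmetric] by (rule rangeI)
  qed
  then show ?thesis
    by (simp add: phase_inv_range[where Ni=Ni, OF clin(1) N(1)] phase_inv_range[where Ni=Ni, OF clin(2) N(1)])
qed

lemma L_invariant: "p \<in> range B \<Longrightarrow> L p \<in> range B"
proof -
  assume "p \<in> range B"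
  then obtain r where "B' r = p" unfolding range_B_eq[symmetric] by blast
  then have "B (L (r + \<mu> *\<^sub>R p)) = L p" by (simp add: intertwine)
  then show "L p \<in> range B" by (metis rangeI)
qed

lemma Li_invariant: "p \<in> range B \<Longrightarrow> Li p \<in> range B"
proof -
  assume "p \<in> range B"
  then obtain q where q: "B q = p" by blast
  have "B ((q - \<mu> *\<^sub>R p) + \<mu> *\<^sub>R L (Li p)) = L (Li p)" by (simp add: L_inverse q)
  then have "B' (Li (q - \<mu> *\<^sub>R p)) = Li p" unfolding intertwine' .
  then show "Li p \<in> range B" unfolding range_B_eq[symmetric] by (metis rangeI)
qed

text \<open>In the norm \<open>\<parallel>Li u\<parallel>\<close> the operator \<open>A - \<mu>\<close> is dissipative, being similar to the shifted phase
  operator, whose damping \<open>C(\<mu>)\<close> is nonnegative.\<close>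

lemma shifted_dissipative:
  assumes "B w = u"
  shows "inner (Li u) (Li w) \<le> \<mu> * (norm (Li u))\<^sup>2"
proof -
  let ?p = "Li u" and ?r = "Li w - \<mu> *\<^sub>R Li u"
  have "B (L (?r + \<mu> *\<^sub>R ?p)) = L ?p" using assms by (simp add: L_inverse)
  then have "B' ?r = ?p" unfolding intertwine .
  moreover have "inner ?r (B' ?r) \<le> 0"
    by (rule phase_inv_dissipative[OF sym]) (use nonneg in \<open>simp add: c'_def\<close>)
  ultimately have "inner ?r ?p \<le> 0" by (simp only:)
  then show ?thesis
    by (simp add: inner_diff_left inner_diff_right power2_norm_eq_inner inner_commute)
qed

lemma semigroup_bound:
  assumes A: "inverts A B" and c: "\<And>s. 0 \<le> inner (R s) (c (R s))" and R: "symmetric_map R" and t: "0 \<le> t"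
  shows "onorm (op_exp A t) \<le> onorm L * onorm Li * exp (\<mu> * t)"
proof -
  have Bc: "bounded_clinear B" by (rule phase_inv_bounded_clinear[OF clin(1,5,7)])
  have Bd: "inner q (B q) \<le> 0" for q by (rule phase_inv_dissipative[OF R sym(2) c])
  note T = op_exp_semigroup[OF Bc Bd A]
  define T where "T = op_exp A"
  have T: "C0_semigroup T" "generator T = A" using T by (simp_all add: T_def)
  note Ll = bounded_clinear_linear[OF L_clin] and Lil = bounded_clinear_linear[OF Li_clin]
  let ?k = "onorm L * onorm Li * exp (\<mu> * t)"
  have core: "norm (T t u) \<le> ?k * norm u" if u: "u \<in> range B" for u
  proof -
    obtain w where w: "B w = u" using u by blast
    have "A u = Some w" using w by (simp only: inverts_eq_Some[OF A])
    then have gu: "generator T u = Some w" using T(2) by simp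
    have "norm (Li (T t u)) \<le> exp (\<mu> * t) * norm (Li u)"
    proof (rule semigroup_decay[OF T(1) Lil _ gu t])
      fix u w assume "generator T u = Some w"
      then have "B w = u" by (simp only: T(2) inverts_eq_Some[OF A])
      then show "inner (Li u) (Li w) \<le> \<mu> * (norm (Li u))\<^sup>2" by (rule shifted_dissipative)
    qed
    also have "\<dots> \<le> exp (\<mu> * t) * (onorm Li * norm u)"
      by (intro mult_left_mono onorm[OF Lil]) simp
    finally have le: "norm (Li (T t u)) \<le> exp (\<mu> * t) * (onorm Li * norm u)" .
    have "norm (T t u) = norm (L (Li (T t u)))" by (simp add: L_inverse)
    also have "\<dots> \<le> onorm L * norm (Li (T t u))" by (rule onorm[OF Ll])
    also have "\<dots> \<le> onorm L * (exp (\<mu> * t) * (onorm Li * norm u))"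
      by (intro mult_left_mono le onorm_pos_le Ll)
    finally show ?thesis by (simp add: mult_ac)
  qed
  have dense: "closure (range B) = UNIV"
  proof -
    interpret dissipative_inverse B
      by unfold_locales (use Bc Bd invertsD(3)[OF A] in auto)
    show ?thesis by (rule dense_range)
  qed
  have "bounded_linear (T t)" using T(1) t by (simp add: C0_semigroup_def)
  then have "closed {u. norm (T t u) \<le> ?k * norm u}"
    by (intro closed_Collect_le continuous_intros linear_continuous_on)
  then have "closure (range B) \<subseteq> {u. norm (T t u) \<le> ?k * norm u}"
    by (rule closure_minimal[rotated]) (use core in blast)
  then have "norm (op_exp A t u) \<le> ?k * norm u" for u unfolding dense T_def by blast
  then show ?thesis
    by (rule onorm_bound[rotated]) (intro mult_nonneg_nonneg onorm_pos_le Ll Lil exp_ge_zero)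
qed

end

text \<open>Positive definiteness of \<open>K(\<mu>)\<close> and nonnegativity of \<open>C(\<mu>)\<close> come from the decay bound: for each \<open>x\<close> the number
  \<open>\<mu>\<close> lies to the right of the roots of \<open>(x, M x) \<lambda>\<^sup>2 + (x, C x) \<lambda> + \<parallel>K\<^bsup>1/2\<^esup> x\<parallel>\<^sup>2\<close>, at a distance bounded below
  independently of \<open>x\<close>.\<close>

lemma shifted_system:
  fixes M C K :: "'a::complex_hilbert \<rightharpoonup> 'a" and \<mu> :: real
  assumes M: "posdef_op M" "bounded_op M"
    and C: "posdef_op C" "bounded_op C"
    and K: "posdef_op K"
    and \<mu>: "decay_bound M C K < \<mu>" "\<mu> \<le> 0"
  obtains R R' P Q N Ni m c where "shifted_phase R R' P Q N Ni m c \<mu>"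
    "symmetric_map R" "\<And>x. 0 \<le> inner x (c x)"
    "L_op M C K \<mu> = (\<lambda>p. Some (shifted_phase.L R' Q N \<mu> p))"
    "inverts (phase_op M C K) (phase_inv R N c)"
    "inverts (phase_op_shifted M C K \<mu>) (phase_inv R' N (shifted_phase.c' m c \<mu>))"
proof -
  obtain m cm where m: "M = (\<lambda>x. Some (m x))" "bounded_clinear m" "symmetric_map m"
    and cm: "cm > 0" "\<And>x. cm * (norm x)\<^sup>2 \<le> inner x (m x)"
    by (rule bounded_posdef_total[OF M]) (rule that; assumption)
  obtain c cc where c: "C = (\<lambda>x. Some (c x))" "bounded_clinear c" "symmetric_map c"
    and cc: "cc > 0" "\<And>x. cc * (norm x)\<^sup>2 \<le> inner x (c x)"
    by (rule bounded_posdef_total[OF C]) (rule that; assumption)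
  obtain N Ni where N: "op_sqrt M = (\<lambda>x. Some (N x))" "bounded_clinear N" "symmetric_map N"
    "bounded_clinear Ni" "\<And>x. N (Ni x) = x" "\<And>x. Ni (N x) = x" "\<And>x. N (N x) = m x"
    by (rule bounded_posdef_sqrt[OF M(1) m(1,2)]) (rule that; assumption)
  obtain R where R: "bounded_clinear R" "symmetric_map R" "inverts (op_sqrt K) R" "inverts K (\<lambda>x. R (R x))"
    by (rule posdef_op_sqrt_inverse[OF K]) (rule that; assumption)
  interpret m: bounded_linear m using m(2) by (rule bounded_clinear_linear)
  interpret c: bounded_linear c using c(2) by (rule bounded_clinear_linear)
  have mpos: "0 < inner x (m x)" if "x \<noteq> 0" for x
  proof -
    have "0 < cm * (norm x)\<^sup>2" using cm(1) that by simp
    then show ?thesis using cm(2)[of x] by linarith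
  qed
  have cpos: "0 \<le> inner x (c x)" for x
  proof -
    have "0 \<le> cc * (norm x)\<^sup>2" using cc(1) by simp
    then show ?thesis using cc(2)[of x] by linarith
  qed
  define g where "g = decay_bound M C K"
  have g: "g < \<mu>" using \<mu>(1) by (simp add: g_def)
  define F where "F x = \<mu>\<^sup>2 *\<^sub>R m x + \<mu> *\<^sub>R c x" for x
  define c' where "c' x = (2 * \<mu>) *\<^sub>R m x + c x" for x
  have F: "bounded_clinear F" unfolding F_def by (intro bounded_clinear_add bounded_clinear_scaleR m c)
  have c': "bounded_clinear c'" unfolding c'_def by (intro bounded_clinear_add bounded_clinear_scaleR m c)
  have symF: "symmetric_map F"
    using m(3) c(3) by (simp add: F_def symmetric_map_def inner_add_left inner_add_right)
  \<comment> \<open>the lower bound of \<open>K(\<mu>)\<close> supplied by the distance from \<open>\<mu>\<close> to the decay bound\<close>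
  define m0 where "m0 = cm * (\<mu> - g)\<^sup>2"
  have m0: "m0 > 0" using cm(1) g by (simp add: m0_def)
  define form where "form s = (norm s)\<^sup>2 + inner (R s) (F (R s))" for s
  have form_eq: "form s = \<mu>\<^sup>2 * inner (R s) (m (R s)) + \<mu> * inner (R s) (c (R s)) + (norm s)\<^sup>2" for s
    by (simp add: form_def F_def inner_add_right)
  have form1: "m0 * (norm (R s))\<^sup>2 \<le> form s \<and> 0 \<le> inner (R s) (c' (R s))" for s
  proof (cases "R s = 0")
    case True
    then show ?thesis by (simp add: form_def)
  next
    case False
    let ?a = "inner (R s) (m (R s))"
    have a: "0 < ?a" using mpos False by blast
    have q: "decay_rate ?a (inner (R s) (c (R s))) ((norm s)\<^sup>2) \<le> g"
      unfolding g_def by (rule decay_rate_le_decay_bound[OF m mpos c cpos R(3) False])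
    note q = quadratic_above_decay_rate[OF a q less_imp_le[OF g]]
    have "m0 * (norm (R s))\<^sup>2 = (cm * (norm (R s))\<^sup>2) * (\<mu> - g)\<^sup>2" by (simp add: m0_def mult_ac)
    also have "\<dots> \<le> ?a * (\<mu> - g)\<^sup>2" by (intro mult_right_mono cm) simp
    also have "\<dots> \<le> form s" using q(1) by (simp add: form_eq)
    finally show ?thesis using q(2) by (simp add: c'_def inner_add_right)
  qed
  obtain b where b: "b > 0" "\<And>x. norm (c x) \<le> norm x * b" using c.pos_bounded by blast
  \<comment> \<open>as \<open>\<mu> \<le> 0\<close>, the form of \<open>K\<close> exceeds that of \<open>K(\<mu>)\<close> by at most
    \<open>\<bar>\<mu>\<bar> (x, C x) \<le> \<bar>\<mu>\<bar> b \<parallel>x\<parallel>\<^sup>2\<close>, which the bound \<open>form1\<close> absorbs\<close>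
  define d where "d = 1 / (1 + \<bar>\<mu>\<bar> * b / m0)"
  have d: "d > 0" unfolding d_def using b(1) m0 by (simp add: add_pos_nonneg)
  have form2: "d * (norm s)\<^sup>2 \<le> form s" for s
  proof -
    let ?x = "R s"
    have "inner ?x (c ?x) \<le> norm ?x * norm (c ?x)" by (rule norm_cauchy_schwarz)
    also have "\<dots> \<le> norm ?x * (norm ?x * b)" by (intro mult_left_mono b) simp
    finally have "inner ?x (c ?x) \<le> b * (norm ?x)\<^sup>2" by (simp add: power2_eq_square mult_ac)
    then have 1: "\<bar>\<mu>\<bar> * inner ?x (c ?x) \<le> \<bar>\<mu>\<bar> * (b * (norm ?x)\<^sup>2)" by (intro mult_left_mono) auto
    have "(norm ?x)\<^sup>2 \<le> form s / m0" using form1[of s] m0 by (simp add: pos_le_divide_eq mult.commute)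
    then have 2: "(\<bar>\<mu>\<bar> * b) * (norm ?x)\<^sup>2 \<le> (\<bar>\<mu>\<bar> * b) * (form s / m0)"
      using b(1) by (intro mult_left_mono) auto
    have 3: "0 \<le> \<mu>\<^sup>2 * inner ?x (m ?x)" using mpos[of ?x] by (cases "?x = 0") (auto simp: less_imp_le)
    have "\<mu> * inner ?x (c ?x) = - (\<bar>\<mu>\<bar> * inner ?x (c ?x))" using \<mu>(2) by simp
    then have "(norm s)\<^sup>2 \<le> form s + (\<bar>\<mu>\<bar> * b) * (form s / m0)"
      using form_eq[of s] 1 2 3 unfolding mult.assoc by linarith
    also have "\<dots> = form s * (1 + \<bar>\<mu>\<bar> * b / m0)" by (simp add: algebra_simps)
    also have "\<dots> = form s / d" unfolding d_def by simp
    finally show ?thesis using d by (simp add: pos_le_divide_eq mult.commute)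
  qed
  define K' where "K' = K_shift M C K \<mu>"
  have K': "K' x = (case K x of None \<Rightarrow> None | Some y \<Rightarrow> Some (F x + y))" for x
    unfolding K'_def K_shift_def op_add_def op_scale_def F_def m(1) c(1)
    by (cases "K x") (auto simp: dom_def simp del: of_real_power)
  obtain V where V: "bounded_clinear V" "\<And>x. V x + R (F (R (V x))) = x" "\<And>x. V (x + R (F (R x))) = x"
    "inverts K' (\<lambda>y. R (V (R y)))" "posdef_op K'"
    by (rule shifted_inverse[OF R(1,2,4) F symF d form2[unfolded form_def] K']) (rule that; assumption)
  obtain R' where R': "bounded_clinear R'" "symmetric_map R'" "inverts (op_sqrt K') R'" "inverts K' (\<lambda>x. R' (R' x))"
    by (rule posdef_op_sqrt_inverse[OF V(5)]) (rule that; assumption)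
  have inj: "inj R" "inj R'" using invertsD(3) R(3) R'(3) by blast+
  have RVR: "R' (R' y) = R (V (R y))" for y
    using invertsD(1)[OF V(4), of y] R'(4) by (simp add: inverts_def)
  obtain P Q where PQ: "bounded_clinear P" "bounded_clinear Q" "\<And>y. R' (P y) = R y" "\<And>y. R (Q y) = R' y"
    by (rule shifted_sqrt_factors[OF R(1,2) inj(1) R'(1,2) inj(2) F d form2[unfolded form_def] V(1-3) RVR])
      (rule that; assumption)
  have shift: "R' (R' y) = R s \<longleftrightarrow> R y = s + R (\<mu>\<^sup>2 *\<^sub>R m (R s) + \<mu> *\<^sub>R c (R s))" for y s
    unfolding RVR inj_eq[OF inj(1)] F_def[symmetric] using V(2)[of "R y"] V(3)[of s] by metis
  have nonneg: "0 \<le> inner (R' s) ((2 * \<mu>) *\<^sub>R m (R' s) + c (R' s))" for s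
    using form1[of "Q s"] unfolding PQ(4) c'_def by blast
  interpret S: shifted_phase R R' P Q N Ni m c \<mu>
    by unfold_locales (fact R R' PQ N m c inj shift nonneg)+
  have inv: "op_inv (op_sqrt K') = (\<lambda>x. Some (R' x))" by (rule op_inv_eq[OF R'(3)])
  have SR: "op_sqrt K (R' x) = Some (Q x)" for x
    using invertsD(1)[OF R(3), of "Q x"] by (simp add: PQ(4))
  have Lop: "L_op M C K \<mu> = (\<lambda>p. Some (S.L p))"
    unfolding L_op_def K'_def[symmetric] inv block_op_def op_scale_def op_zero_def op_id_def N(1)
    by (auto simp: fun_eq_iff map_comp_def SR dom_def S.L_def)
  have A: "inverts (phase_op M C K) (phase_inv R N c)"
    by (rule phase_op_inverts[OF N(1,5,6,4) c(1) R(3,1)])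
  have Cs: "C_shift M C \<mu> = (\<lambda>x. Some (S.c' x))"
    unfolding C_shift_def op_add_def op_scale_def m(1) c(1) S.c'_def
    by (auto simp: fun_eq_iff dom_def simp del: of_real_mult of_real_numeral)
  have A': "inverts (phase_op_shifted M C K \<mu>) (phase_inv R' N S.c')"
    unfolding phase_op_shifted_def
    by (rule phase_op_inverts[OF N(1,5,6,4) Cs R'(3)[unfolded K'_def] R'(1)])
  show ?thesis
    by (rule that[OF S.shifted_phase_axioms R(2) cpos Lop A A'])
qed

text \<open>Here the total maps are exchanged for the partial operators. Equality of the two products of
  operators is equality of their graphs, which \<open>intertwine'\<close> expresses by the inverses.\<close>

lemma shifted_phase_op_similarity:
  fixes M C K :: "'a::complex_hilbert \<rightharpoonup> 'a" and \<mu> :: real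
  assumes M: "posdef_op M" "bounded_op M"
    and C: "posdef_op C" "bounded_op C"
    and K: "posdef_op K"
    and \<mu>: "decay_bound M C K < \<mu>" "\<mu> \<le> 0"
  shows "bounded_op (L_op M C K \<mu>)" "dom (L_op M C K \<mu>) = UNIV"
    "bounded_op (op_inv (L_op M C K \<mu>))" "dom (op_inv (L_op M C K \<mu>)) = UNIV"
    "leaves_invariant (L_op M C K \<mu>) (dom (phase_op M C K))"
    "leaves_invariant (op_inv (L_op M C K \<mu>)) (dom (phase_op M C K))"
    "L_op M C K \<mu> \<circ>\<^sub>m phase_op_shifted M C K \<mu> =
        (phase_op M C K \<oplus> (- complex_of_real \<mu>) \<odot> op_id) \<circ>\<^sub>m L_op M C K \<mu>"
    "0 \<le> t \<Longrightarrow> onorm (op_exp (phase_op M C K) t) \<le>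
        op_norm (L_op M C K \<mu>) * op_norm (op_inv (L_op M C K \<mu>)) * exp (\<mu> * t)"
proof -
  obtain R R' P Q N Ni m c where S: "shifted_phase R R' P Q N Ni m c \<mu>"
    and R: "symmetric_map R" and c: "\<And>x. 0 \<le> inner x (c x)"
    and Lop: "L_op M C K \<mu> = (\<lambda>p. Some (shifted_phase.L R' Q N \<mu> p))"
    and A: "inverts (phase_op M C K) (phase_inv R N c)"
    and A': "inverts (phase_op_shifted M C K \<mu>) (phase_inv R' N (shifted_phase.c' m c \<mu>))"
    by (rule shifted_system[OF assms]) (rule that; assumption)
  interpret shifted_phase R R' P Q N Ni m c \<mu> by (rule S)
  have "inverts (\<lambda>p. Some (L p)) Li"
    unfolding inverts_def option.inject by (metis L_inverse)
  then have Liop: "op_inv (L_op M C K \<mu>) = (\<lambda>p. Some (Li p))" unfolding Lop by (rule op_inv_eq)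
  have dA: "dom (phase_op M C K) = range B" by (rule invertsD(2)[OF A])
  show "bounded_op (L_op M C K \<mu>)" unfolding Lop by (rule bounded_op_total[OF L_clin])
  show "bounded_op (op_inv (L_op M C K \<mu>))" unfolding Liop by (rule bounded_op_total[OF Li_clin])
  show "dom (L_op M C K \<mu>) = UNIV" by (auto simp: Lop)
  show "dom (op_inv (L_op M C K \<mu>)) = UNIV" by (auto simp: Liop)
  show "leaves_invariant (L_op M C K \<mu>) (dom (phase_op M C K))"
    unfolding leaves_invariant_def dA using L_invariant by (auto simp: Lop)
  show "leaves_invariant (op_inv (L_op M C K \<mu>)) (dom (phase_op M C K))"
    unfolding leaves_invariant_def dA using Li_invariant by (auto simp: Liop)
  show "L_op M C K \<mu> \<circ>\<^sub>m phase_op_shifted M C K \<mu> =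
        (phase_op M C K \<oplus> (- complex_of_real \<mu>) \<odot> op_id) \<circ>\<^sub>m L_op M C K \<mu>" (is "?l = ?r")
  proof (rule ext)
    fix p
    have sc: "(- complex_of_real \<mu>) *\<^sub>C x = - (\<mu> *\<^sub>R x)" for x :: "'a \<times> 'a"
      using scaleC_of_real[of "- \<mu>" x] by simp
    have "?l p = Some q \<longleftrightarrow> ?r p = Some q" for q
    proof -
      have "?l p = Some q \<longleftrightarrow> phase_op_shifted M C K \<mu> p = Some (Li q)"
        unfolding map_comp_Some_iff Lop option.inject by (metis L_inverse)
      also have "\<dots> \<longleftrightarrow> B' (Li q) = p" by (rule inverts_eq_Some[OF A'])
      also have "\<dots> \<longleftrightarrow> B (q + \<mu> *\<^sub>R L p) = L p" by (rule intertwine'[symmetric])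
      also have "\<dots> \<longleftrightarrow> phase_op M C K (L p) = Some (q + \<mu> *\<^sub>R L p)"
        by (rule inverts_eq_Some[OF A, symmetric])
      also have "\<dots> \<longleftrightarrow> ?r p = Some q"
        unfolding map_comp_Some_iff Lop op_add_def op_scale_def op_id_def
        by (cases "phase_op M C K (L p)") (auto simp: dom_def sc algebra_simps)
      finally show ?thesis .
    qed
    then show "?l p = ?r p" by (metis not_Some_eq)
  qed
  show "onorm (op_exp (phase_op M C K) t) \<le>
        op_norm (L_op M C K \<mu>) * op_norm (op_inv (L_op M C K \<mu>)) * exp (\<mu> * t)" if "0 \<le> t"
    unfolding op_norm_def Liop unfolding Lop option.sel by (rule semigroup_bound[OF A c R that])
qed

lemma semigroup_type_le:
  assumes "\<And>t. 0 \<le> t \<Longrightarrow> onorm (op_exp A t) \<le> k * exp (\<beta> * t)"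
  shows "semigroup_type A \<le> ereal \<beta>"
  unfolding semigroup_type_def by (rule Inf_lower) (use assms in blast)

theorem theorem1:
  fixes M C K :: "'a::complex_hilbert \<rightharpoonup> 'a" and \<mu> :: real
  assumes nonzero: "\<exists>x::'a. x \<noteq> 0"
    and M: "posdef_op M" "bounded_op M"
    and C: "posdef_op C" "bounded_op C"
    and K: "posdef_op K"
    and \<mu>: "decay_bound M C K < \<mu>" "\<mu> \<le> 0"
  shows
    "(bounded_op (L_op M C K \<mu>) \<and> dom (L_op M C K \<mu>) = UNIV \<and>
      bounded_op (op_inv (L_op M C K \<mu>)) \<and> dom (op_inv (L_op M C K \<mu>)) = UNIV) \<and>
     (leaves_invariant (L_op M C K \<mu>) (dom (phase_op M C K)) \<and>
      leaves_invariant (op_inv (L_op M C K \<mu>)) (dom (phase_op M C K)) \<and>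
      L_op M C K \<mu> \<circ>\<^sub>m phase_op_shifted M C K \<mu> =
        (phase_op M C K \<oplus> (- complex_of_real \<mu>) \<odot> op_id) \<circ>\<^sub>m L_op M C K \<mu>) \<and>
     (\<forall>t\<ge>0. onorm (op_exp (phase_op M C K) t) \<le>
        op_norm (L_op M C K \<mu>) * op_norm (op_inv (L_op M C K \<mu>)) * exp (\<mu> * t)) \<and>
     semigroup_type (phase_op M C K) \<le> ereal (decay_bound M C K)"
proof -
  \<comment> \<open>the exponential bound holds for every exponent between the decay bound and \<open>\<mu>\<close>,
    with a constant that may depend on the exponent\<close>
  have "semigroup_type (phase_op M C K) \<le> ereal \<nu>" if "decay_bound M C K < \<nu>" "\<nu> \<le> \<mu>" for \<nu>
    by (rule semigroup_type_le) (rule shifted_phase_op_similarity(8)[OF M C K that(1)], use that \<mu> in auto)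
  then have "semigroup_type (phase_op M C K) \<le> ereal \<nu>" if "decay_bound M C K < \<nu>" for \<nu>
    using that \<mu>(1) by (cases "\<nu> \<le> \<mu>") (auto intro: order.trans[of _ "ereal \<mu>"])
  then have "semigroup_type (phase_op M C K) \<le> ereal (decay_bound M C K) + ereal \<epsilon>" if "0 < \<epsilon>" for \<epsilon>
    using that by simp
  then have "semigroup_type (phase_op M C K) \<le> ereal (decay_bound M C K)"
    by (rule ereal_le_epsilon2)
  then show ?thesis
    by (intro conjI allI impI shifted_phase_op_similarity[OF M C K \<mu>])
qed

end
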